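(* Let $(G,k,\gamma)$ be an instance of \textsc{Red-Blue Reinforcement}, where $G$ is a red-blue graph on $n$ vertices. One can decide whether $(G,k,\gamma)$ is a yes-instance in time $2^{mw}n^{O(1)}$, where $mw$ is the modular-width of $G$.
   Context: A red-blue graph is a graph $G=(V,E)$ together with sets $R,B\subseteq V$ with $V=R\cup B$ (not necessarily disjoint); vertices of $R$ are red, vertices of $B$ are blue. For $v\in V$, $N[v]$ is the closed neighborhood of $v$. The red-blue domination number $\gamma_{rb}(G)$ is the minimum size of a set $D\subseteq R$ such that $N[v]\cap D\neq\emptyset$ for every $v\in B$. For $S\subseteq V$, $G[V\setminus S]$ is the induced subgraph (with red and blue sets $R\setminus S$, $B\setminus S$). \textsc{Red-Blue Reinforcement}: given a red-blue graph $G$ and integers $k,\gamma$ (where $\gamma=\gamma_{rb}(G)-\alpha$ for a positive integer $\alpha$), decide whether there exists $S\subseteq B$ with $|S|\le k$ and $\gamma_{rb}(G[V\setminus S])\le\gamma$. Modular-width: a modular decomposition is a rooted tree in which each node $b$ represents a graph $G_b$; a leaf represents a single isolated vertex; an internal node $b$ with children $b_1,\dots,b_c$ representing graphs $G_1,\dots,G_c$ is associated with a graph $H_b$ on vertices $w_1,\dots,w_c$, and $G_b$ has vertex set $\bigcup_i V(G_i)$ and edge set $\bigcup_i E(G_i)\cup\{uv: u\in V(G_i),v\in V(G_j), w_iw_j\in E(H_b)\}$. Its width is the maximum number of children of a node; it is a modular decomposition of $G$ if the root represents $G$. The modular-width of $G$ is the minimum width of a modular decomposition of $G$. *)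

theory Defs
  imports Main "HOL-Library.Extended_Nat"
begin

section \<open>Red-blue graphs and reinforcement\<close>

definition simple_edges :: "'a set \<Rightarrow> 'a set set \<Rightarrow> bool" where
  "simple_edges V E \<longleftrightarrow> (\<forall>e\<in>E. \<exists>u\<in>V. \<exists>v\<in>V. u \<noteq> v \<and> e = {u, v})"

record 'a rb_graph =
  verts :: "'a set"
  edges :: "'a set set"
  red :: "'a set"
  blue :: "'a set"

definition is_rb_graph :: "'a rb_graph \<Rightarrow> bool" where
  "is_rb_graph G \<longleftrightarrow>
     finite (verts G) \<and> simple_edges (verts G) (edges G) \<and> red G \<union> blue G = verts G"

definition closed_nbhd :: "'a rb_graph \<Rightarrow> 'a \<Rightarrow> 'a set" where
  "closed_nbhd G v = insert v {u \<in> verts G. {u, v} \<in> edges G}"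

definition rb_dominating :: "'a rb_graph \<Rightarrow> 'a set \<Rightarrow> bool" where
  "rb_dominating G D \<longleftrightarrow> D \<subseteq> red G \<and> (\<forall>v\<in>blue G. closed_nbhd G v \<inter> D \<noteq> {})"

text \<open>The value is \<^term>\<open>\<infinity>\<close> if some blue vertex has no red vertex in its closed
  neighbourhood, so that no dominating set exists.\<close>

definition gamma_rb :: "'a rb_graph \<Rightarrow> enat" where
  "gamma_rb G = (INF D \<in> {D. rb_dominating G D}. enat (card D))"

definition delete_verts :: "'a rb_graph \<Rightarrow> 'a set \<Rightarrow> 'a rb_graph" where
  "delete_verts G S =
     \<lparr>verts = verts G - S, edges = {e \<in> edges G. e \<inter> S = {}}, red = red G - S, blue = blue G - S\<rparr>"

definition rbr_instance :: "'a rb_graph \<Rightarrow> int \<Rightarrow> int \<Rightarrow> bool" where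
  "rbr_instance G k \<gamma> \<longleftrightarrow>
     is_rb_graph G \<and> (\<exists>g \<alpha>. gamma_rb G = enat g \<and> 0 < \<alpha> \<and> \<gamma> = int g - int \<alpha>)"

definition rbr_yes :: "'a rb_graph \<Rightarrow> int \<Rightarrow> int \<Rightarrow> bool" where
  "rbr_yes G k \<gamma> \<longleftrightarrow>
     (\<exists>S. S \<subseteq> blue G \<and> int (card S) \<le> k \<and>
          (\<exists>g. gamma_rb (delete_verts G S) = enat g \<and> int g \<le> \<gamma>))"


section \<open>Modular-width\<close>

text \<open>In \<open>Module H [T\<^sub>0, \<dots>, T\<^sub>c]\<close> the graph associated with the node has vertices
  \<open>0, \<dots>, c\<close>, vertex \<open>i\<close> corresponding to the child \<open>T\<^sub>i\<close>, and edge set \<open>H\<close>.\<close>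

datatype 'a moddec = Single 'a | Module "nat set set" "'a moddec list"

fun md_verts :: "'a moddec \<Rightarrow> 'a set" where
  "md_verts (Single v) = {v}"
| "md_verts (Module H Ts) = (\<Union>T\<in>set Ts. md_verts T)"

fun md_edges :: "'a moddec \<Rightarrow> 'a set set" where
  "md_edges (Single v) = {}"
| "md_edges (Module H Ts) =
     (\<Union>T\<in>set Ts. md_edges T) \<union>
     {{u, v} | u v i j. i < length Ts \<and> j < length Ts \<and> {i, j} \<in> H \<and>
        u \<in> md_verts (Ts ! i) \<and> v \<in> md_verts (Ts ! j)}"

fun md_wf :: "'a moddec \<Rightarrow> bool" where
  "md_wf (Single v) \<longleftrightarrow> True"
| "md_wf (Module H Ts) \<longleftrightarrow>
     Ts \<noteq> [] \<and> simple_edges {..<length Ts} H \<and>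
     (\<forall>i<length Ts. \<forall>j<length Ts. i \<noteq> j \<longrightarrow> md_verts (Ts ! i) \<inter> md_verts (Ts ! j) = {}) \<and>
     (\<forall>T\<in>set Ts. md_wf T)"

fun md_width :: "'a moddec \<Rightarrow> nat" where
  "md_width (Single v) = 0"
| "md_width (Module H Ts) = Max (insert (length Ts) (md_width ` set Ts))"

definition is_moddec_of :: "'a moddec \<Rightarrow> 'a rb_graph \<Rightarrow> bool" where
  "is_moddec_of T G \<longleftrightarrow> md_wf T \<and> md_verts T = verts G \<and> md_edges T = edges G"

text \<open>The minimum ranges over a nonempty set exactly when the graph is nonempty, see
  \<open>ex_moddec\<close> below; there is no decomposition of the empty graph.\<close>

definition modular_width :: "'a rb_graph \<Rightarrow> nat" where
  "modular_width G = (LEAST w. \<exists>T. is_moddec_of T G \<and> md_width T = w)"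

lemma ex_moddec:
  assumes "is_rb_graph G" "verts G \<noteq> {}"
  shows "\<exists>T. is_moddec_of T G"
proof -
  obtain xs where xs: "set xs = verts G" "distinct xs"
    using assms(1) finite_distinct_list unfolding is_rb_graph_def by blast
  define H where "H = {{i, j} | i j. i < length xs \<and> j < length xs \<and> {xs ! i, xs ! j} \<in> edges G}"
  define T where "T = Module H (map Single xs)"
  have E: "simple_edges (verts G) (edges G)"
    using assms(1) by (simp add: is_rb_graph_def)
  have ne: "i \<noteq> j" if "{xs ! i, xs ! j} \<in> edges G" for i j
    using E that unfolding simple_edges_def by (metis doubleton_eq_iff)
  have mem: "{i, j} \<in> H \<longleftrightarrow> {xs ! i, xs ! j} \<in> edges G" if "i < length xs" "j < length xs" for i j
    using that unfolding H_def by (auto simp: doubleton_eq_iff insert_commute)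
  have "simple_edges {..<length xs} H"
    unfolding simple_edges_def H_def using ne by blast
  moreover have "md_edges T = edges G"
  proof (intro subset_antisym subsetI)
    fix e assume "e \<in> md_edges T"
    then show "e \<in> edges G" unfolding T_def using mem by auto
  next
    fix e assume e: "e \<in> edges G"
    then obtain u v where uv: "u \<in> verts G" "v \<in> verts G" "e = {u, v}"
      using E unfolding simple_edges_def by blast
    then obtain i j where ij: "i < length xs" "xs ! i = u" "j < length xs" "xs ! j = v"
      using xs by (metis in_set_conv_nth)
    have "{i, j} \<in> H" using mem ij e uv by simp
    moreover have "u \<in> md_verts (map Single xs ! i)" "v \<in> md_verts (map Single xs ! j)"
      using ij by auto
    ultimately show "e \<in> md_edges T"
      unfolding T_def uv using ij by fastforce
  qed
  moreover have "md_verts T = verts G"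
    using xs by (auto simp: T_def)
  ultimately have "is_moddec_of T G"
    using xs assms(2) by (auto simp: is_moddec_of_def T_def nth_eq_iff_index_eq)
  then show ?thesis ..
qed


section \<open>Model of computation\<close>

text \<open>
  Programs are finite lists of first-order, mutually recursive functions over binary trees (pure
  LISP with the single atom \<^term>\<open>Tip\<close>), evaluated call-by-value; execution starts in
  function 0. Variable \<open>i\<close> is the \<open>i\<close>-th argument of the function being evaluated. Running time
  counts evaluation steps, one for every evaluated (sub)expression and call.

  Every step costs a random access machine \<open>O(1)\<close> operations (allocate a cell, follow a pointer,
  compare with \<^term>\<open>Tip\<close>, push or pop a stack frame whose size depends on the program only), on
  addresses bounded linearly by running time plus input size. In particular there is no
  unit-cost arithmetic on large numbers.
\<close>

datatype tree = Tip | Pair tree tree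

fun left :: "tree \<Rightarrow> tree" where
  "left Tip = Tip"
| "left (Pair a b) = a"

fun right :: "tree \<Rightarrow> tree" where
  "right Tip = Tip"
| "right (Pair a b) = b"

datatype expr =
    Var nat
  | TipE
  | PairE expr expr
  | LeftE expr
  | RightE expr
  | Cond expr expr expr
  | Call nat "expr list"

type_synonym program = "expr list"

inductive eval :: "program \<Rightarrow> tree list \<Rightarrow> expr \<Rightarrow> tree \<Rightarrow> nat \<Rightarrow> bool"
  and evals :: "program \<Rightarrow> tree list \<Rightarrow> expr list \<Rightarrow> tree list \<Rightarrow> nat \<Rightarrow> bool"
  for P :: program where
  eval_Var: "i < length env \<Longrightarrow> eval P env (Var i) (env ! i) 1"
| eval_Tip: "eval P env TipE Tip 1"
| eval_Pair: "eval P env a v t \<Longrightarrow> eval P env b w u \<Longrightarrow>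
    eval P env (PairE a b) (Pair v w) (t + u + 1)"
| eval_Left: "eval P env a v t \<Longrightarrow> eval P env (LeftE a) (left v) (t + 1)"
| eval_Right: "eval P env a v t \<Longrightarrow> eval P env (RightE a) (right v) (t + 1)"
| eval_Cond_True: "eval P env c x t \<Longrightarrow> x \<noteq> Tip \<Longrightarrow> eval P env a v u \<Longrightarrow>
    eval P env (Cond c a b) v (t + u + 1)"
| eval_Cond_False: "eval P env c Tip t \<Longrightarrow> eval P env b v u \<Longrightarrow>
    eval P env (Cond c a b) v (t + u + 1)"
| eval_Call: "f < length P \<Longrightarrow> evals P env es vs t \<Longrightarrow> eval P vs (P ! f) v u \<Longrightarrow>
    eval P env (Call f es) v (t + u + 1)"
| evals_Nil: "evals P env [] [] 0"
| evals_Cons: "eval P env e v t \<Longrightarrow> evals P env es vs u \<Longrightarrow>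
    evals P env (e # es) (v # vs) (t + u)"

definition runs :: "program \<Rightarrow> tree \<Rightarrow> tree \<Rightarrow> nat \<Rightarrow> bool" where
  "runs P x v t \<longleftrightarrow> P \<noteq> [] \<and> eval P [x] (P ! 0) v t"

inductive_cases VarE: "eval P env (Var i) v t"
inductive_cases TipEE: "eval P env TipE v t"
inductive_cases PairEE: "eval P env (PairE a b) v t"
inductive_cases LeftEE: "eval P env (LeftE a) v t"
inductive_cases RightEE: "eval P env (RightE a) v t"
inductive_cases CondE: "eval P env (Cond c a b) v t"
inductive_cases CallE: "eval P env (Call f es) v t"
inductive_cases evals_NilE: "evals P env [] vs t"
inductive_cases evals_ConsE: "evals P env (e # es) vs t"

lemma
  eval_deterministic: "eval P env e v t \<Longrightarrow> eval P env e v' t' \<Longrightarrow> v' = v \<and> t' = t" and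
  evals_deterministic: "evals P env es vs t \<Longrightarrow> evals P env es vs' t' \<Longrightarrow> vs' = vs \<and> t' = t"
proof (induction arbitrary: v' t' and vs' t' rule: eval_evals.inducts)
  case eval_Var then show ?case by (elim VarE) simp
next
  case eval_Tip then show ?case by (elim TipEE) simp
next
  case eval_Pair from eval_Pair.prems show ?case by (rule PairEE) (auto dest!: eval_Pair.IH(2,4))
next
  case eval_Left from eval_Left.prems show ?case by (rule LeftEE) (auto dest!: eval_Left.IH(2))
next
  case eval_Right from eval_Right.prems show ?case by (rule RightEE) (auto dest!: eval_Right.IH(2))
next
  case eval_Cond_True
  from eval_Cond_True.prems show ?case
    by (rule CondE) (use eval_Cond_True.hyps in \<open>auto dest!: eval_Cond_True.IH(2,4)\<close>)
next
  case eval_Cond_False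
  from eval_Cond_False.prems show ?case
    by (rule CondE) (auto dest!: eval_Cond_False.IH(2,4))
next
  case eval_Call from eval_Call.prems show ?case by (rule CallE) (auto dest!: eval_Call.IH(3,5))
next
  case evals_Nil then show ?case by (elim evals_NilE) simp
next
  case evals_Cons from evals_Cons.prems show ?case by (rule evals_ConsE) (auto dest!: evals_Cons.IH(2,4))
qed

lemma runs_deterministic: "runs P x v t \<Longrightarrow> runs P x v' t' \<Longrightarrow> v' = v \<and> t' = t"
  unfolding runs_def using eval_deterministic by blast


section \<open>Encoding of instances\<close>

fun enc_list :: "tree list \<Rightarrow> tree" where
  "enc_list [] = Tip"
| "enc_list (x # xs) = Pair x (enc_list xs)"

definition enc_bool :: "bool \<Rightarrow> tree" where
  "enc_bool b = (if b then Pair Tip Tip else Tip)"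

text \<open>Binary, least significant bit first, without leading zeros.\<close>

fun enc_nat :: "nat \<Rightarrow> tree" where
  "enc_nat n = (if n = 0 then Tip else Pair (enc_bool (odd n)) (enc_nat (n div 2)))"

declare enc_nat.simps [simp del]

definition enc_int :: "int \<Rightarrow> tree" where
  "enc_int z = Pair (enc_bool (z < 0)) (enc_nat (nat \<bar>z\<bar>))"

text \<open>A graph with vertex set \<^term>\<open>{..<n}\<close> is given by its adjacency matrix, each row preceded
  by the colours of its vertex.\<close>

definition enc_graph :: "nat \<Rightarrow> nat rb_graph \<Rightarrow> tree" where
  "enc_graph n G = enc_list (map (\<lambda>u.
     Pair (Pair (enc_bool (u \<in> red G)) (enc_bool (u \<in> blue G)))
          (enc_list (map (\<lambda>v. enc_bool ({u, v} \<in> edges G)) [0..<n]))) [0..<n])"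

definition enc_instance :: "nat \<Rightarrow> nat rb_graph \<Rightarrow> int \<Rightarrow> int \<Rightarrow> tree" where
  "enc_instance n G k \<gamma> = Pair (enc_graph n G) (Pair (enc_int k) (enc_int \<gamma>))"

end

theory Submission
  imports Defs
begin

text \<open>
  Deleting \<open>S\<close> helps iff some red set \<open>D\<close> with \<open>card D \<le> \<gamma>\<close> leaves at most \<open>k\<close> blue vertices undominated
  (take \<open>S\<close> to be those vertices). The algorithm contracts modules one after the other. Each current
  vertex stands for a block of original vertices and carries the table of all pairs
  \<open>(card D, number of undominated blue vertices of the block)\<close> with \<open>D\<close> ranging over the red sets of the
  block. To contract a module one guesses which of its blocks meet \<open>D\<close>; then blocks adjacent to a guessed
  one are dominated completely, the other ones only from inside, and the table entries add up. This costs
  \<open>2 ^ c\<close> polynomial steps for a module with \<open>c\<close> elements.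

  No modular decomposition is computed: a smallest module with at least two elements is found as the
  closure of a pair of vertices under adding splitters, and descending in an optimal decomposition shows
  that it has at most modular-width many elements, in every induced subgraph.
\<close>

section \<open>Polynomially bounded evaluation\<close>

text \<open>The delicate point is size, not the number of guesses. Tables arise from products and
  from unions of exponentially many partial results, and bounds composed from the code alone would
  compound over the contraction rounds. A table is therefore bounded by its meaning: it holds
  distinct pairs of vertex counts. So there are two kinds of bounds: auxiliary functions are
  polynomial by a syntactic argument (\<open>poly_fun\<close>), whereas loops whose accumulator may
  grow by a factor, and the guessing recursion, are analysed on domains that describe what their
  arguments mean.

  A contracted module is represented by one of its vertices, with the original adjacency row of that
  vertex. The current graph thus remains an induced subgraph of the input, so the bound on a
  smallest module holds in every round, and the costs of at most n rounds merely add up.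

  The time bound is in n alone, yet k and \<gamma> are binary integers with arbitrarily many digits.
  Achievable pairs have entries up to n, so nonnegative k and \<gamma> may be replaced by their
  minimum with n, which takes at most n digits to find.\<close>

definition poly_bdd :: "(nat \<Rightarrow> nat) \<Rightarrow> bool" where
  "poly_bdd h \<longleftrightarrow> (\<exists>C d. \<forall>m. h m \<le> C * Suc m ^ d)"

lemma poly_bdd_mono: "poly_bdd h \<Longrightarrow> (\<And>m. g m \<le> h m) \<Longrightarrow> poly_bdd g"
  unfolding poly_bdd_def by (meson le_trans)

lemma poly_bdd_const : "poly_bdd (\<lambda>_. c)"
  unfolding poly_bdd_def by (intro exI[of _ c] exI[of _ 0]) simp

lemma poly_bdd_id : "poly_bdd (\<lambda>m. m)"
  unfolding poly_bdd_def by (intro exI[of _ 1] allI) simp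

lemma poly_bdd_add:
  assumes "poly_bdd g" "poly_bdd h"
  shows "poly_bdd (\<lambda>m. g m + h m)"
proof -
  obtain C d C' d' where *: "\<And>m. g m \<le> C * Suc m ^ d" "\<And>m. h m \<le> C' * Suc m ^ d'"
    using assms unfolding poly_bdd_def by blast
  have "g m + h m \<le> (C + C') * Suc m ^ (d + d')" for m
  proof -
    have "C * Suc m ^ d \<le> C * Suc m ^ (d + d')" "C' * Suc m ^ d' \<le> C' * Suc m ^ (d + d')"
      by (auto intro!: mult_le_mono2 power_increasing simp del: power_Suc)
    then show ?thesis
      using *[of m] unfolding add_mult_distrib by linarith
  qed
  then show ?thesis unfolding poly_bdd_def by blast
qed

lemma poly_bdd_mult:
  assumes "poly_bdd g" "poly_bdd h"
  shows "poly_bdd (\<lambda>m. g m * h m)"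
proof -
  obtain C d C' d' where *: "\<And>m. g m \<le> C * Suc m ^ d" "\<And>m. h m \<le> C' * Suc m ^ d'"
    using assms unfolding poly_bdd_def by blast
  have "g m * h m \<le> (C * C') * Suc m ^ (d + d')" for m
    using mult_mono[OF *(1)[of m] *(2)[of m]] by (simp add: power_add ac_simps)
  then show ?thesis unfolding poly_bdd_def by blast
qed

lemma poly_bdd_power: "poly_bdd g \<Longrightarrow> poly_bdd (\<lambda>m. g m ^ k)"
  by (induction k) (auto intro: poly_bdd_const poly_bdd_mult)

lemma poly_bdd_Suc: "poly_bdd g \<Longrightarrow> poly_bdd (\<lambda>m. Suc (g m))"
  using poly_bdd_add[OF _ poly_bdd_const[of 1]] by simp

lemmas poly_bdd_intros = poly_bdd_const poly_bdd_id poly_bdd_add poly_bdd_mult poly_bdd_power poly_bdd_Suc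

lemma poly_bdd_comp:
  assumes "poly_bdd g" "poly_bdd h"
  shows "poly_bdd (\<lambda>m. g (h m))"
proof -
  obtain C d where *: "\<And>m. g m \<le> C * Suc m ^ d"
    using assms unfolding poly_bdd_def by blast
  show ?thesis
    by (rule poly_bdd_mono[OF _ *]) (intro poly_bdd_intros assms(2))
qed

text \<open>Parameters of a callee are only bounded by a known value, not equal to it; a monotone
  bound can be enlarged along that inequality.\<close>

lemma poly_bdd_majorant:
  assumes "poly_bdd h"
  obtains h' where "poly_bdd h'" "mono h'" "\<And>m. h m \<le> h' m"
proof -
  obtain C d where *: "\<And>m. h m \<le> C * Suc m ^ d"
    using assms unfolding poly_bdd_def by blast
  show ?thesis
    by (rule that[of "\<lambda>m. C * Suc m ^ d"])
      (use * in \<open>auto simp: mono_def intro!: mult_left_mono power_mono poly_bdd_intros\<close>)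
qed

text \<open>\<open>S w m env\<close> is a domain of environments with polynomial parameter
  \<open>m\<close> and exponent budget \<open>w\<close>. The bound \<open>h\<close> depends on
  \<open>m\<close> only, so one polynomial serves all widths.\<close>

definition ptime ::
  "program \<Rightarrow> (nat \<Rightarrow> nat \<Rightarrow> tree list \<Rightarrow> bool) \<Rightarrow> expr \<Rightarrow> (tree list \<Rightarrow> tree) \<Rightarrow> bool" where
  "ptime P S e g \<longleftrightarrow>
     (\<exists>h. poly_bdd h \<and> (\<forall>w m env. S w m env \<longrightarrow> (\<exists>t\<le>2 ^ w * h m. eval P env e (g env) t)))"

text \<open>There is no factor \<open>2 ^ w\<close> here: results become arguments of later calls
  and enter their parameter \<open>m\<close>, so they must stay polynomial.\<close>

definition psize :: "(nat \<Rightarrow> nat \<Rightarrow> tree list \<Rightarrow> bool) \<Rightarrow> (tree list \<Rightarrow> tree) \<Rightarrow> bool" where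
  "psize S g \<longleftrightarrow> (\<exists>h. poly_bdd h \<and> (\<forall>w m env. S w m env \<longrightarrow> size (g env) \<le> h m))"

lemma ptimeI:
  assumes "poly_bdd h" "\<And>w m env. S w m env \<Longrightarrow> \<exists>t\<le>2 ^ w * h m. eval P env e (g env) t"
  shows "ptime P S e g"
  using assms unfolding ptime_def by blast

lemma psizeI:
  assumes "poly_bdd h" "\<And>w m env. S w m env \<Longrightarrow> size (g env) \<le> h m"
  shows "psize S g"
  using assms unfolding psize_def by blast

lemma ptimeE:
  assumes "ptime P S e g"
  obtains h where "poly_bdd h" "mono h" "\<And>w m env. S w m env \<Longrightarrow> \<exists>t\<le>2 ^ w * h m. eval P env e (g env) t"
proof -
  obtain h where h: "poly_bdd h" "\<And>w m env. S w m env \<Longrightarrow> \<exists>t\<le>2 ^ w * h m. eval P env e (g env) t"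
    using assms unfolding ptime_def by blast
  obtain h' where h': "poly_bdd h'" "mono h'" "\<And>m. h m \<le> h' m"
    using poly_bdd_majorant[OF h(1)] by blast
  have "\<exists>t\<le>2 ^ w * h' m. eval P env e (g env) t" if "S w m env" for w m env
    using h(2)[OF that] h'(3)[of m] by (meson le_trans mult_le_mono2)
  then show ?thesis using that h' by blast
qed

lemma psizeE:
  assumes "psize S g"
  obtains h where "poly_bdd h" "mono h" "\<And>w m env. S w m env \<Longrightarrow> size (g env) \<le> h m"
  using assms poly_bdd_majorant unfolding psize_def by (metis le_trans)

lemma ptimeE':
  assumes "ptime P S e g"
  obtains h where "poly_bdd h" "\<And>w m env. S w m env \<Longrightarrow> \<exists>t\<le>2 ^ w * h m. eval P env e (g env) t"
  using assms unfolding ptime_def by blast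

lemma psizeE':
  assumes "psize S g"
  obtains h where "poly_bdd h" "\<And>w m env. S w m env \<Longrightarrow> size (g env) \<le> h m"
  using assms unfolding psize_def by blast

lemma ptime_cong:
  assumes "ptime P S e g" "\<And>w m env. S w m env \<Longrightarrow> g env = g' env"
  shows "ptime P S e g'"
  using assms unfolding ptime_def by metis

lemma psize_cong:
  assumes "psize S g" "\<And>w m env. S w m env \<Longrightarrow> g env = g' env"
  shows "psize S g'"
  using assms unfolding psize_def by metis

text \<open>Change of parameters: \<open>m\<close> may grow polynomially, since polynomials compose,
  but \<open>w\<close> may not grow at all, since it sits in the exponent.\<close>

lemma ptime_shift:
  assumes "ptime P D e g" "poly_bdd h"
    and "\<And>w m env. S w m env \<Longrightarrow> \<exists>w'\<le>w. \<exists>m'\<le>h m. D w' m' env"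
  shows "ptime P S e g"
proof -
  obtain q where q: "poly_bdd q" "mono q" "\<And>w m env. D w m env \<Longrightarrow> \<exists>t\<le>2 ^ w * q m. eval P env e (g env) t"
    using that by (rule ptimeE[OF assms(1)])
  have "\<exists>t\<le>2 ^ w * q (h m). eval P env e (g env) t" if S: "S w m env" for w m env
  proof -
    obtain w' m' where "w' \<le> w" "m' \<le> h m" "D w' m' env"
      using assms(3)[OF S] by blast
    then obtain t where t: "t \<le> 2 ^ w' * q m'" "eval P env e (g env) t"
      using q(3) by blast
    have "(2::nat) ^ w' * q m' \<le> 2 ^ w * q (h m)"
      using \<open>w' \<le> w\<close> \<open>m' \<le> h m\<close> q(2) by (intro mult_mono power_increasing) (auto simp: mono_def)
    then show ?thesis using t le_trans by blast
  qed
  then show ?thesis by (rule ptimeI[OF poly_bdd_comp[OF q(1) assms(2)]])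
qed

lemma psize_shift:
  assumes "psize D g" "poly_bdd h"
    and "\<And>w m env. S w m env \<Longrightarrow> \<exists>w'. \<exists>m'\<le>h m. D w' m' (c env)"
  shows "psize S (\<lambda>env. g (c env))"
proof -
  obtain q where q: "poly_bdd q" "mono q" "\<And>w m env. D w m env \<Longrightarrow> size (g env) \<le> q m"
    using that by (rule psizeE[OF assms(1)])
  have "size (g (c env)) \<le> q (h m)" if "S w m env" for w m env
    using assms(3)[OF that] q(2,3) by (meson le_trans monoD)
  then show ?thesis by (rule psizeI[OF poly_bdd_comp[OF q(1) assms(2)]])
qed

lemma ptime_subset:
  assumes "ptime P D e g" "\<And>w m env. S w m env \<Longrightarrow> D w m env"
  shows "ptime P S e g"
  using assms unfolding ptime_def by blast

lemma psize_subset: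
  assumes "psize D g" "\<And>w m env. S w m env \<Longrightarrow> D w m env"
  shows "psize S g"
  using assms unfolding psize_def by metis

lemma ptime_const_time:
  assumes "\<And>w m env. S w m env \<Longrightarrow> \<exists>t\<le>c. eval P env e (g env) t"
  shows "ptime P S e g"
proof (rule ptimeI[OF poly_bdd_const[of c]])
  fix w m env assume "S w m env"
  then obtain t where t: "t \<le> c" "eval P env e (g env) t" using assms by blast
  have "c \<le> 2 ^ w * c" by simp
  then show "\<exists>t\<le>2 ^ w * c. eval P env e (g env) t" using t le_trans by blast
qed

section \<open>Time bounds for the constructs of the language\<close>

lemma ptime_Var: "(\<And>w m env. S w m env \<Longrightarrow> i < length env) \<Longrightarrow> ptime P S (Var i) (\<lambda>env. env ! i)"
  by (rule ptime_const_time[of _ 1]) (blast intro: eval_Var)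

lemma ptime_Tip: "ptime P S TipE (\<lambda>_. Tip)"
  by (rule ptime_const_time[of _ 1]) (blast intro: eval_Tip)

lemma ptime_op1:
  assumes "ptime P S a g" "\<And>env v t. eval P env a v t \<Longrightarrow> eval P env e (f v) (t + 1)"
  shows "ptime P S e (\<lambda>env. f (g env))"
proof -
  obtain h where h: "poly_bdd h" "\<And>w m env. S w m env \<Longrightarrow> \<exists>t\<le>2 ^ w * h m. eval P env a (g env) t"
    using that by (rule ptimeE'[OF assms(1)])
  have "\<exists>t\<le>2 ^ w * (h m + 1). eval P env e (f (g env)) t" if S: "S w m env" for w m env
  proof -
    have one: "1 \<le> (2::nat) ^ w * 1" by simp
    obtain t where t: "t \<le> 2 ^ w * h m" "eval P env a (g env) t" using h(2)[OF S] by blast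
    have "t + 1 \<le> 2 ^ w * (h m + 1)" using t(1) one unfolding distrib_left by linarith
    then show ?thesis using assms(2)[OF t(2)] by blast
  qed
  then show ?thesis by (intro ptimeI[of "\<lambda>m. h m + 1"] poly_bdd_intros h(1)) blast
qed

lemma ptime_Left: "ptime P S a g \<Longrightarrow> ptime P S (LeftE a) (\<lambda>env. left (g env))"
  by (erule ptime_op1) (rule eval_Left)

lemma ptime_Right: "ptime P S a g \<Longrightarrow> ptime P S (RightE a) (\<lambda>env. right (g env))"
  by (erule ptime_op1) (rule eval_Right)

lemma ptime_Pair:
  assumes "ptime P S a f" "ptime P S b g"
  shows "ptime P S (PairE a b) (\<lambda>env. Pair (f env) (g env))"
proof -
  obtain h where h: "poly_bdd h" "\<And>w m env. S w m env \<Longrightarrow> \<exists>t\<le>2 ^ w * h m. eval P env a (f env) t"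
    using that by (rule ptimeE'[OF assms(1)])
  obtain k where k: "poly_bdd k" "\<And>w m env. S w m env \<Longrightarrow> \<exists>t\<le>2 ^ w * k m. eval P env b (g env) t"
    using that by (rule ptimeE'[OF assms(2)])
  have "\<exists>t\<le>2 ^ w * (h m + k m + 1). eval P env (PairE a b) (Pair (f env) (g env)) t" if S: "S w m env" for w m env
  proof -
    have one: "1 \<le> (2::nat) ^ w * 1" by simp
    obtain t u where t: "t \<le> 2 ^ w * h m" "eval P env a (f env) t" "u \<le> 2 ^ w * k m" "eval P env b (g env) u"
      using h(2)[OF S] k(2)[OF S] by blast
    have "t + u + 1 \<le> 2 ^ w * (h m + k m + 1)"
      using t(1,3) one unfolding distrib_left by linarith
    then show ?thesis using eval_Pair[OF t(2,4)] by blast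
  qed
  then show ?thesis by (intro ptimeI[of "\<lambda>m. h m + k m + 1"] poly_bdd_intros h(1) k(1)) blast
qed

text \<open>Each branch is bounded only on the environments that reach it, so it may rely on the
  outcome of the test. The contraction loop needs this: a module is sought only while two vertices
  remain.\<close>

lemma ptime_Cond:
  assumes "ptime P S c f"
    and "ptime P (\<lambda>w m env. S w m env \<and> f env \<noteq> Tip) a g"
    and "ptime P (\<lambda>w m env. S w m env \<and> f env = Tip) b g'"
  shows "ptime P S (Cond c a b) (\<lambda>env. if f env \<noteq> Tip then g env else g' env)"
proof -
  obtain h where h: "poly_bdd h" "\<And>w m env. S w m env \<Longrightarrow> \<exists>t\<le>2 ^ w * h m. eval P env c (f env) t"
    using that by (rule ptimeE'[OF assms(1)])
  obtain k where k: "poly_bdd k" "\<And>w m env. S w m env \<and> f env \<noteq> Tip \<Longrightarrow> \<exists>t\<le>2 ^ w * k m. eval P env a (g env) t"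
    using that by (rule ptimeE'[OF assms(2)])
  obtain l where l: "poly_bdd l" "\<And>w m env. S w m env \<and> f env = Tip \<Longrightarrow> \<exists>t\<le>2 ^ w * l m. eval P env b (g' env) t"
    using that by (rule ptimeE'[OF assms(3)])
  have "\<exists>t\<le>2 ^ w * (h m + k m + l m + 1). eval P env (Cond c a b) (if f env \<noteq> Tip then g env else g' env) t"
    if S: "S w m env" for w m env
  proof -
    have one: "1 \<le> (2::nat) ^ w * 1" by simp
    obtain t where t: "t \<le> 2 ^ w * h m" "eval P env c (f env) t" using h(2)[OF S] by blast
    show ?thesis
    proof (cases "f env = Tip")
      case True
      then obtain u where u: "u \<le> 2 ^ w * l m" "eval P env b (g' env) u" using l(2)[OF conjI[OF S True]] by blast
      have "t + u + 1 \<le> 2 ^ w * (h m + k m + l m + 1)"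
        using t(1) u(1) one unfolding distrib_left by linarith
      then show ?thesis using eval_Cond_False[OF _ u(2)] t(2) True by auto
    next
      case False
      then obtain u where u: "u \<le> 2 ^ w * k m" "eval P env a (g env) u" using k(2)[OF conjI[OF S False]] by blast
      have "t + u + 1 \<le> 2 ^ w * (h m + k m + l m + 1)"
        using t(1) u(1) one unfolding distrib_left by linarith
      then show ?thesis using eval_Cond_True[OF t(2) False u(2)] False by auto
    qed
  qed
  then show ?thesis by (intro ptimeI[of "\<lambda>m. h m + k m + l m + 1"] poly_bdd_intros h(1) k(1) l(1)) blast
qed

lemma ptime_evals:
  assumes "list_all2 (ptime P S) es gs"
  shows "\<exists>h. poly_bdd h \<and> (\<forall>w m env. S w m env \<longrightarrow>
    (\<exists>t\<le>2 ^ w * h m. evals P env es (map (\<lambda>g. g env) gs) t))"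
  using assms
proof (induction rule: list_all2_induct)
  case Nil
  show ?case by (intro exI[of _ "\<lambda>_. 0"]) (auto intro: evals_Nil poly_bdd_const)
next
  case (Cons e es g gs)
  obtain h where h: "poly_bdd h" "\<And>w m env. S w m env \<Longrightarrow> \<exists>t\<le>2 ^ w * h m. eval P env e (g env) t"
    using that by (rule ptimeE'[OF Cons(1)])
  obtain k where k: "poly_bdd k" "\<And>w m env. S w m env \<Longrightarrow>
      \<exists>t\<le>2 ^ w * k m. evals P env es (map (\<lambda>g. g env) gs) t"
    using Cons(3) by blast
  have "\<exists>t\<le>2 ^ w * (h m + k m). evals P env (e # es) (map (\<lambda>g. g env) (g # gs)) t"
    if S: "S w m env" for w m env
  proof -
    obtain t u where t: "t \<le> 2 ^ w * h m" "eval P env e (g env) t"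
      "u \<le> 2 ^ w * k m" "evals P env es (map (\<lambda>g. g env) gs) u"
      using h(2)[OF S] k(2)[OF S] by blast
    have "t + u \<le> 2 ^ w * (h m + k m)"
      using t(1,3) by (simp add: add_le_mono distrib_left)
    then show ?thesis using evals_Cons[OF t(2,4)] by auto
  qed
  then show ?case using poly_bdd_add[OF h(1) k(1)] by blast
qed

text \<open>The callee is bounded on its own domain \<open>D\<close>. With \<open>w' \<le> w\<close>
  its factor stays below \<open>2 ^ w\<close>, so the costs of arguments and body add up inside a
  single such factor.\<close>

lemma ptime_Call:
  assumes es: "list_all2 (ptime P S) es gs"
    and f: "f < length P" "ptime P D (P ! f) F" "poly_bdd h"
    and D: "\<And>w m env. S w m env \<Longrightarrow> \<exists>w'\<le>w. \<exists>m'\<le>h m. D w' m' (map (\<lambda>g. g env) gs)"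
  shows "ptime P S (Call f es) (\<lambda>env. F (map (\<lambda>g. g env) gs))"
proof -
  obtain k where k: "poly_bdd k" "\<And>w m env. S w m env \<Longrightarrow>
    \<exists>t\<le>2 ^ w * k m. evals P env es (map (\<lambda>g. g env) gs) t"
    using ptime_evals[OF es] by blast
  obtain q where q: "poly_bdd q" "mono q" "\<And>w m env. D w m env \<Longrightarrow> \<exists>t\<le>2 ^ w * q m. eval P env (P ! f) (F env) t"
    using that by (rule ptimeE[OF f(2)])
  have "\<exists>t\<le>2 ^ w * (k m + q (h m) + 1). eval P env (Call f es) (F (map (\<lambda>g. g env) gs)) t"
    if S: "S w m env" for w m env
  proof -
    have one: "1 \<le> (2::nat) ^ w * 1" by simp
    obtain t where t: "t \<le> 2 ^ w * k m" "evals P env es (map (\<lambda>g. g env) gs) t"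
      using k(2)[OF S] by blast
    obtain w' m' where w': "w' \<le> w" "m' \<le> h m" "D w' m' (map (\<lambda>g. g env) gs)" using D[OF S] by blast
    obtain u where u: "u \<le> 2 ^ w' * q m'" "eval P (map (\<lambda>g. g env) gs) (P ! f) (F (map (\<lambda>g. g env) gs)) u"
      using q(3)[OF w'(3)] by blast
    have *: "(2::nat) ^ w' * q m' \<le> 2 ^ w * q (h m)"
      using w'(1,2) q(2) by (intro mult_mono power_increasing) (auto simp: mono_def)
    have "t + u + 1 \<le> 2 ^ w * (k m + q (h m) + 1)"
      using t(1) u(1) one * unfolding distrib_left by linarith
    then show ?thesis using eval_Call[OF f(1) t(2) u(2)] by blast
  qed
  then show ?thesis by (intro ptimeI[of "\<lambda>m. k m + q (h m) + 1"] poly_bdd_intros k(1) poly_bdd_comp[OF q(1) f(3)]) blast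
qed

text \<open>Fixing \<open>w = 0\<close> turns \<open>ptime\<close> into a purely polynomial
  bound.\<close>

definition sized :: "nat \<Rightarrow> nat \<Rightarrow> nat \<Rightarrow> tree list \<Rightarrow> bool" where
  "sized k w m env \<longleftrightarrow> w = 0 \<and> length env = k \<and> (\<forall>a\<in>set env. size a \<le> m)"

text \<open>Time alone would not compose: the caller of an outer function must also bound the size
  of the inner result.\<close>

definition poly_fun :: "program \<Rightarrow> nat \<Rightarrow> nat \<Rightarrow> (tree list \<Rightarrow> tree) \<Rightarrow> bool" where
  "poly_fun P f k F \<longleftrightarrow> f < length P \<and> ptime P (sized k) (P ! f) F \<and> psize (sized k) F"

lemma psize_list:
  assumes "\<forall>g\<in>set gs. psize S g"
  shows "\<exists>h. poly_bdd h \<and> (\<forall>w m env. S w m env \<longrightarrow> sized (length gs) 0 (h m) (map (\<lambda>g. g env) gs))"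
  using assms
proof (induction gs)
  case Nil
  show ?case by (intro exI[of _ "\<lambda>_. 0"]) (auto simp: sized_def intro: poly_bdd_const)
next
  case (Cons g gs)
  obtain h where h: "poly_bdd h" "\<And>w m env. S w m env \<Longrightarrow> sized (length gs) 0 (h m) (map (\<lambda>g. g env) gs)"
    using Cons by auto
  obtain k where k: "poly_bdd k" "\<And>w m env. S w m env \<Longrightarrow> size (g env) \<le> k m"
    using that by (rule psizeE'[of S g, rotated]) (use Cons.prems in auto)
  show ?case
  proof (intro exI[of _ "\<lambda>m. h m + k m"] conjI allI impI poly_bdd_intros h(1) k(1))
    fix w m env assume S: "S w m env"
    show "sized (length (g # gs)) 0 (h m + k m) (map (\<lambda>g. g env) (g # gs))"
      using h(2)[OF S] k(2)[OF S] unfolding sized_def by (auto intro: trans_le_add1 trans_le_add2)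
  qed
qed

lemma ptime_Call_poly:
  assumes "poly_fun P f (length gs) F" "list_all2 (ptime P S) es gs" "\<forall>g\<in>set gs. psize S g"
  shows "ptime P S (Call f es) (\<lambda>env. F (map (\<lambda>g. g env) gs))"
proof -
  obtain h where h: "poly_bdd h" "\<And>w m env. S w m env \<Longrightarrow> sized (length gs) 0 (h m) (map (\<lambda>g. g env) gs)"
    using psize_list[OF assms(3)] by blast
  show ?thesis
    by (rule ptime_Call[OF assms(2) _ _ h(1)]) (use assms(1) h(2) in \<open>blast intro: le_refl | simp add: poly_fun_def\<close>)+
qed

lemma psize_Call_poly:
  assumes "poly_fun P f (length gs) F" "\<forall>g\<in>set gs. psize S g"
  shows "psize S (\<lambda>env. F (map (\<lambda>g. g env) gs))"
proof -
  obtain h where h: "poly_bdd h" "\<And>w m env. S w m env \<Longrightarrow> sized (length gs) 0 (h m) (map (\<lambda>g. g env) gs)"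
    using psize_list[OF assms(2)] by blast
  show ?thesis
    by (rule psize_shift[OF _ h(1), of "sized (length gs)"]) (use assms(1) h(2) in \<open>blast intro: le_refl | simp add: poly_fun_def\<close>)+
qed

lemma psize_Pair:
  assumes "psize S f" "psize S g"
  shows "psize S (\<lambda>env. Pair (f env) (g env))"
proof -
  obtain h k where h: "poly_bdd h" "\<And>w m env. S w m env \<Longrightarrow> size (f env) \<le> h m"
    "poly_bdd k" "\<And>w m env. S w m env \<Longrightarrow> size (g env) \<le> k m"
    using assms unfolding psize_def by metis
  show ?thesis
    by (rule psizeI[of "\<lambda>m. h m + k m + 1"]) (use h in \<open>auto intro!: poly_bdd_intros add_le_mono\<close>)
qed

lemma psize_le:
  assumes "psize S f" "\<And>w m env. S w m env \<Longrightarrow> size (g env) \<le> size (f env)"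
  shows "psize S g"
  using assms unfolding psize_def by (meson le_trans)

lemma size_left: "size (left x) \<le> size x" and size_right: "size (right x) \<le> size x"
  by (cases x; simp)+

lemma psize_if:
  assumes "psize S f" "psize S g"
  shows "psize S (\<lambda>env. if b env then f env else g env)"
  by (rule psize_le[OF psize_Pair[OF assms]]) auto

lemma psize_Tip: "psize S (\<lambda>_. Tip)"
  by (rule psizeI[OF poly_bdd_const[of 0]]) simp

text \<open>The meaning of an expression when calls are interpreted by a given \<open>F\<close>;
  recursion never enters, so this is total.\<close>

fun den :: "(nat \<Rightarrow> tree list \<Rightarrow> tree) \<Rightarrow> tree list \<Rightarrow> expr \<Rightarrow> tree" where
  "den F env (Var i) = env ! i"
| "den F env TipE = Tip"
| "den F env (PairE a b) = Pair (den F env a) (den F env b)"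
| "den F env (LeftE a) = left (den F env a)"
| "den F env (RightE a) = right (den F env a)"
| "den F env (Cond c a b) = (if den F env c \<noteq> Tip then den F env a else den F env b)"
| "den F env (Call f es) = F f (map (den F env) es)"

fun wf_expr :: "(nat \<Rightarrow> nat option) \<Rightarrow> nat \<Rightarrow> expr \<Rightarrow> bool" where
  "wf_expr \<Gamma> k (Var i) \<longleftrightarrow> i < k"
| "wf_expr \<Gamma> k TipE \<longleftrightarrow> True"
| "wf_expr \<Gamma> k (PairE a b) \<longleftrightarrow> wf_expr \<Gamma> k a \<and> wf_expr \<Gamma> k b"
| "wf_expr \<Gamma> k (LeftE a) \<longleftrightarrow> wf_expr \<Gamma> k a"
| "wf_expr \<Gamma> k (RightE a) \<longleftrightarrow> wf_expr \<Gamma> k a"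
| "wf_expr \<Gamma> k (Cond c a b) \<longleftrightarrow> wf_expr \<Gamma> k c \<and> wf_expr \<Gamma> k a \<and> wf_expr \<Gamma> k b"
| "wf_expr \<Gamma> k (Call f es) \<longleftrightarrow> \<Gamma> f = Some (length es) \<and> (\<forall>e\<in>set es. wf_expr \<Gamma> k e)"

text \<open>Code over functions already known to be polynomial is polynomial: the expression is
  fixed, so only a fixed number of polynomials is composed. \<open>\<Gamma>\<close> records the
  arities of the functions that may be called.\<close>

lemma ptime_den:
  assumes \<Gamma>: "\<And>f a. \<Gamma> f = Some a \<Longrightarrow> poly_fun P f a (F f)"
    and S: "\<And>w m env. S w m env \<Longrightarrow> length env = k" "\<And>i. i < k \<Longrightarrow> psize S (\<lambda>env. env ! i)"
    and "wf_expr \<Gamma> k e"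
  shows "ptime P S e (\<lambda>env. den F env e) \<and> psize S (\<lambda>env. den F env e)"
  using assms(4)
proof (induction e)
  case (Var i)
  then show ?case using S by (auto intro: ptime_Var)
next
  case TipE
  show ?case by (auto intro: ptime_Tip psize_Tip)
next
  case (PairE a b)
  then show ?case by (auto intro: ptime_Pair psize_Pair)
next
  case (LeftE a)
  then show ?case by (auto intro: ptime_Left intro!: psize_le[of S "\<lambda>env. den F env a"] size_left)
next
  case (RightE a)
  then show ?case by (auto intro: ptime_Right intro!: psize_le[of S "\<lambda>env. den F env a"] size_right)
next
  case (Cond c a b)
  show ?case unfolding den.simps
    by (rule conjI[OF ptime_Cond psize_if]) (use Cond in \<open>auto elim: ptime_subset\<close>)
next
  case (Call f es)
  have *: "list_all2 (ptime P S) es (map (\<lambda>e env. den F env e) es)"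
    using Call by (auto simp: list_all2_conv_all_nth)
  have **: "\<forall>g\<in>set (map (\<lambda>e env. den F env e) es). psize S g"
    using Call by auto
  have f: "poly_fun P f (length (map (\<lambda>e env. den F env e) es)) (F f)"
    using \<Gamma> Call.prems by simp
  show ?case
    using ptime_Call_poly[OF f * **] psize_Call_poly[OF f **] by (simp add: comp_def)
qed

lemma psize_sized: "i < k \<Longrightarrow> psize (sized k) (\<lambda>env. env ! i)"
  by (rule psizeI[OF poly_bdd_id]) (simp add: sized_def)

lemma poly_fun_den:
  assumes "\<And>f a. \<Gamma> f = Some a \<Longrightarrow> poly_fun P f a (F f)"
    and "f < length P" "wf_expr \<Gamma> k (P ! f)"
    and "\<And>env. length env = k \<Longrightarrow> F f env = den F env (P ! f)"
  shows "poly_fun P f k (F f)"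
proof -
  have *: "ptime P (sized k) (P ! f) (\<lambda>env. den F env (P ! f)) \<and> psize (sized k) (\<lambda>env. den F env (P ! f))"
    by (rule ptime_den[OF assms(1) _ psize_sized assms(3)]) (auto simp: sized_def)
  have eq: "den F env (P ! f) = F f env" if s: "sized k w m env" for w m env
    using assms(4) that by (simp add: sized_def)
  show ?thesis
    unfolding poly_fun_def
    by (intro conjI assms(2) ptime_cong[OF conjunct1[OF *] eq] psize_cong[OF conjunct2[OF *] eq])
qed

text \<open>\<open>loopE f k e\<close> is a tail-recursive fold over the list in variable 0 with accumulator in
  variable 1; the \<open>k\<close> variables from 2 on are fixed.\<close>

definition loopE :: "nat \<Rightarrow> nat \<Rightarrow> expr \<Rightarrow> expr" where
  "loopE f k e = Cond (Var 0) (Call f (RightE (Var 0) # e # map Var [2..<k + 2])) (Var 1)"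

fun list_of :: "tree \<Rightarrow> tree list" where
  "list_of Tip = []"
| "list_of (Pair a b) = a # list_of b"

abbreviation len :: "tree \<Rightarrow> nat" where "len t \<equiv> length (list_of t)"

fun tloop :: "(tree list \<Rightarrow> tree) \<Rightarrow> tree \<Rightarrow> tree \<Rightarrow> tree list \<Rightarrow> tree" where
  "tloop g Tip acc cs = acc"
| "tloop g (Pair a b) acc cs = tloop g b (g (Pair a b # acc # cs)) cs"

lemma evals_Vars:
  assumes "length pre = j"
  shows "evals P (pre @ cs) (map Var [j..<length cs + j]) cs (length cs)"
  using assms
proof (induction cs arbitrary: pre j)
  case Nil
  show ?case by (simp add: evals_Nil)
next
  case (Cons c cs)
  have "evals P ((pre @ [c]) @ cs) (map Var [Suc j..<length cs + Suc j]) cs (length cs)"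
    using Cons.IH[of "pre @ [c]" "Suc j"] Cons.prems by simp
  moreover have "eval P (pre @ c # cs) (Var j) c 1"
    using eval_Var[of j "pre @ c # cs" P] Cons.prems by (simp add: nth_append)
  ultimately have "evals P (pre @ c # cs) (Var j # map Var [Suc j..<length cs + Suc j]) (c # cs) (1 + length cs)"
    using evals_Cons by fastforce
  moreover have "[j..<length (c # cs) + j] = j # [Suc j..<length cs + Suc j]"
    using upt_conv_Cons[of j "length (c # cs) + j"] by simp
  ultimately show ?case by (simp only: list.map list.size) simp
qed

text \<open>\<open>D\<close> is a loop invariant in which \<open>m\<close> keeps its value, so all
  rounds share the bound \<open>h m\<close> and there are at most \<open>m\<close> of them. A round
  adds \<open>k + 5\<close> steps to the cost of \<open>e\<close>: 1 for the test, 2 for the tail of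
  the list, \<open>k\<close> for the fixed variables, 1 for the call and 1 for the conditional. The
  final round takes 3.\<close>

lemma ptime_loop:
  assumes f: "f < length P" "P ! f = loopE f k e"
    and len: "\<And>w m env. D w m env \<Longrightarrow> \<exists>xs acc cs. env = xs # acc # cs \<and> length cs = k \<and> len xs \<le> m"
    and step: "\<And>w m a b acc cs. D w m (Pair a b # acc # cs) \<Longrightarrow>
      D w m (b # g (Pair a b # acc # cs) # cs)"
    and e: "ptime P (\<lambda>w m env. D w m env \<and> hd env \<noteq> Tip) e g"
  shows "ptime P D (P ! f) (\<lambda>env. tloop g (env ! 0) (env ! 1) (drop 2 env))"
proof -
  obtain h where h: "poly_bdd h" "\<And>w m env. D w m env \<and> hd env \<noteq> Tip \<Longrightarrow>
      \<exists>t\<le>2 ^ w * h m. eval P env e (g env) t"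
    using that by (rule ptimeE'[OF e])
  have main: "\<exists>t\<le>2 ^ w * (len xs * (h m + k + 5) + 3).
      eval P (xs # acc # cs) (P ! f) (tloop g xs acc cs) t" if "D w m (xs # acc # cs)" for w m xs acc cs
    using that
  proof (induction xs arbitrary: acc)
    case Tip
    have "eval P (Tip # acc # cs) (P ! f) acc (1 + 1 + 1)"
      unfolding f(2) loopE_def
      by (rule eval_Cond_False) (use eval_Var[of 0 "Tip # acc # cs" P] eval_Var[of 1 "Tip # acc # cs" P] in auto)
    moreover have "(3::nat) \<le> 2 ^ w * 3" by simp
    ultimately show ?case by (intro exI[of _ 3]) (simp add: numeral_3_eq_3)
  next
    case (Pair a b)
    let ?env = "Pair a b # acc # cs"
    obtain t where t: "t \<le> 2 ^ w * h m" "eval P ?env e (g ?env) t"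
      using h(2)[of w m ?env] Pair.prems by auto
    obtain u where u: "u \<le> 2 ^ w * (len b * (h m + k + 5) + 3)"
      "eval P (b # g ?env # cs) (P ! f) (tloop g b (g ?env) cs) u"
      using Pair.IH(2)[OF step[OF Pair.prems]] by blast
    have k: "length cs = k" using len[OF Pair.prems] by auto
    have v0: "eval P ?env (Var 0) (Pair a b) 1" using eval_Var[of 0 ?env P] by simp
    have "eval P ?env (RightE (Var 0)) b (1 + 1)" using eval_Right[OF v0] by simp
    moreover have "evals P ?env (map Var [2..<k + 2]) cs k"
      using evals_Vars[of "[Pair a b, acc]" 2 P cs] k by simp
    ultimately have "evals P ?env (RightE (Var 0) # e # map Var [2..<k + 2]) (b # g ?env # cs) (1 + 1 + (t + k))"
      using t(2) by (intro evals_Cons)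
    from eval_Cond_True[OF v0 _ eval_Call[OF f(1) this u(2)]]
    have "eval P ?env (P ! f) (tloop g b (g ?env) cs) (1 + (1 + 1 + (t + k) + u + 1) + 1)"
      unfolding f(2) loopE_def by simp
    moreover have "1 + (1 + 1 + (t + k) + u + 1) + 1 \<le> 2 ^ w * (len (Pair a b) * (h m + k + 5) + 3)"
    proof -
      have "k + 5 \<le> 2 ^ w * (k + 5)" by simp
      then have "t + u + (k + 5) \<le> 2 ^ w * h m + 2 ^ w * (len b * (h m + k + 5) + 3) + 2 ^ w * (k + 5)"
        using t(1) u(1) by linarith
      also have "\<dots> = 2 ^ w * (len (Pair a b) * (h m + k + 5) + 3)"
        by (simp add: algebra_simps)
      finally show ?thesis by simp
    qed
    ultimately show ?case by auto
  qed
  have "\<exists>t\<le>2 ^ w * (m * (h m + k + 5) + 3).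
      eval P env (P ! f) (tloop g (env ! 0) (env ! 1) (drop 2 env)) t" if D: "D w m env" for w m env
  proof -
    obtain xs acc cs where env: "env = xs # acc # cs" "len xs \<le> m" using len[OF D] by blast
    have le: "(2::nat) ^ w * (len xs * (h m + k + 5) + 3) \<le> 2 ^ w * (m * (h m + k + 5) + 3)"
      using env(2) by (intro mult_left_mono add_right_mono mult_right_mono) auto
    obtain t where t: "t \<le> 2 ^ w * (len xs * (h m + k + 5) + 3)"
      "eval P (xs # acc # cs) (P ! f) (tloop g xs acc cs) t"
      using main[of w m xs acc cs] D env by blast
    have "eval P env (P ! f) (tloop g (env ! 0) (env ! 1) (drop 2 env)) t"
      using t(2) env(1) by simp
    then show ?thesis using le_trans[OF t(1) le] by blast
  qed
  then show ?thesis by (intro ptimeI[of "\<lambda>m. m * (h m + k + 5) + 3"] poly_bdd_intros h(1)) blast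
qed

lemma len_le_size: "len t \<le> size t"
  by (induction t) auto

text \<open>\<open>grow\<close> bounds the increase of the accumulator in one round by a polynomial
  in the list and the fixed arguments, independently of the accumulator. Growth by a factor could
  compound to exponential size.\<close>

lemma poly_fun_loop:
  assumes \<Gamma>: "\<And>f a. \<Gamma> f = Some a \<Longrightarrow> poly_fun P f a (F f)"
    and f: "f < length P" "P ! f = loopE f k e" "wf_expr \<Gamma> (k + 2) e"
    and F: "\<And>xs acc cs. length cs = k \<Longrightarrow> F f (xs # acc # cs) = tloop (\<lambda>env. den F env e) xs acc cs"
    and h: "poly_bdd h"
    and grow: "\<And>m a b acc cs. \<lbrakk>size (Pair a b) \<le> m; length cs = k; \<forall>c\<in>set cs. size c \<le> m\<rbrakk> \<Longrightarrow>
      size (den F (Pair a b # acc # cs) e) \<le> size acc + h m"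
  shows "poly_fun P f (k + 2) (F f)"
proof -
  let ?g = "\<lambda>env. den F env e"
  have step: "ptime P (sized (k + 2)) e ?g"
    by (rule conjunct1[OF ptime_den[OF \<Gamma> _ psize_sized f(3)]]) (auto simp: sized_def)
  obtain h' where h': "poly_bdd h'" "mono h'" "\<And>m. h m \<le> h' m" using poly_bdd_majorant[OF h] by blast
  define q where "q m = m + m * h' m" for m
  have q: "poly_bdd q" unfolding q_def by (intro poly_bdd_intros h'(1))
  \<comment> \<open>\<open>size acc + len xs * h' m0\<close> is a potential: a round adds at most
    \<open>h' m0\<close> to the accumulator and uses up one list element. The parameter is
    \<open>q m0\<close>, not \<open>m0\<close>, so that it bounds the accumulator at all
    times.\<close>
  define D where "D w m env \<longleftrightarrow> w = (0::nat) \<and> (\<exists>m0 xs acc cs. m = q m0 \<and> env = xs # acc # cs \<and> length cs = k \<and>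
    size xs \<le> m0 \<and> (\<forall>c\<in>set cs. size c \<le> m0) \<and> size acc + len xs * h' m0 \<le> q m0)" for w m env
  have D1: "ptime P D (P ! f) (\<lambda>env. tloop ?g (env ! 0) (env ! 1) (drop 2 env))"
  proof (rule ptime_loop[OF f(1,2)])
    show "\<exists>xs acc cs. env = xs # acc # cs \<and> length cs = k \<and> len xs \<le> m" if D: "D w m env" for w m env
    proof -
      obtain m0 xs acc cs where *: "m = q m0" "env = xs # acc # cs" "length cs = k" "size xs \<le> m0"
        using D unfolding D_def by blast
      have "len xs \<le> m" using * len_le_size[of xs] unfolding q_def by simp
      then show ?thesis using * by blast
    qed
    show "D w m (b # ?g (Pair a b # acc # cs) # cs)" if D: "D w m (Pair a b # acc # cs)" for w m a b acc cs
    proof -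
      obtain m0 where m0: "w = 0" "m = q m0" "length cs = k" "size (Pair a b) \<le> m0" "\<forall>c\<in>set cs. size c \<le> m0"
        "size acc + len (Pair a b) * h' m0 \<le> q m0"
        using D unfolding D_def by auto
      have "size (?g (Pair a b # acc # cs)) \<le> size acc + h' m0"
        using grow[OF m0(4,3,5), of acc] h'(3)[of m0] by linarith
      then have "size (?g (Pair a b # acc # cs)) + len b * h' m0 \<le> q m0"
        using m0(6) by simp
      then show ?thesis unfolding D_def using m0 by auto
    qed
    show "ptime P (\<lambda>w m env. D w m env \<and> hd env \<noteq> Tip) e ?g"
    proof (rule ptime_subset[OF step])
      fix w m env assume "D w m env \<and> hd env \<noteq> Tip"
      then obtain m0 xs acc cs where *: "w = 0" "m = q m0" "env = xs # acc # cs" "length cs = k"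
        "size xs \<le> m0" "\<forall>c\<in>set cs. size c \<le> m0" "size acc + len xs * h' m0 \<le> q m0"
        unfolding D_def by blast
      have "m0 \<le> m" using *(2) by (simp add: q_def)
      then show "sized (k + 2) w m env" using * unfolding sized_def by (auto intro: le_trans)
    qed
  qed
  have 2: "\<exists>w'\<le>w. \<exists>m'\<le>q m. D w' m' env" if s: "sized (k + 2) w m env" for w m env
  proof -
    obtain xs acc cs where env: "env = xs # acc # cs" "length cs = k"
      using s unfolding sized_def by (metis (no_types) add_2_eq_Suc' length_Suc_conv)
    have s: "size xs \<le> m" "size acc \<le> m" "\<forall>c\<in>set cs. size c \<le> m" and w: "w = 0"
      using s env unfolding sized_def by auto
    have "len xs * h' m \<le> m * h' m"
      using len_le_size[of xs] s(1) by (intro mult_right_mono) auto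
    then have "size acc + len xs * h' m \<le> q m" unfolding q_def using s(2) by linarith
    then show ?thesis unfolding D_def using env s w by blast
  qed
  have eq: "tloop ?g (env ! 0) (env ! 1) (drop 2 env) = F f env" if s: "sized (k + 2) w m env" for w m env
  proof -
    obtain xs acc cs where "env = xs # acc # cs" "length cs = k"
      using s unfolding sized_def by (metis (no_types) add_2_eq_Suc' length_Suc_conv)
    then show ?thesis using F by simp
  qed
  have sz: "size (tloop ?g xs acc cs) \<le> size acc + len xs * h' m"
    if "length cs = k" "size xs \<le> m" "\<forall>c\<in>set cs. size c \<le> m" for xs acc cs m
    using that
  proof (induction xs arbitrary: acc)
    case (Pair a b)
    have "size (?g (Pair a b # acc # cs)) \<le> size acc + h' m"
      using grow[OF Pair.prems(2,1,3), of acc] h'(3)[of m] by linarith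
    then show ?case using Pair.IH(2)[of "?g (Pair a b # acc # cs)"] Pair.prems by simp
  qed simp
  have "psize (sized (k + 2)) (F f)"
    unfolding psize_def
  proof (intro exI[of _ q] conjI allI impI q)
    fix w m env assume s: "sized (k + 2) w m env"
    then obtain xs acc cs where env: "env = xs # acc # cs" "length cs = k"
      unfolding sized_def by (metis (no_types) add_2_eq_Suc' length_Suc_conv)
    have ss: "size xs \<le> m" "size acc \<le> m" "\<forall>c\<in>set cs. size c \<le> m"
      using s env unfolding sized_def by auto
    have "len xs * h' m \<le> m * h' m"
      using len_le_size[of xs] ss(1) by (intro mult_right_mono) auto
    moreover have "size (F f env) = size (tloop ?g xs acc cs)" using F[OF env(2), of xs acc] env(1) by simp
    ultimately show "size (F f env) \<le> q m"
      using sz[OF env(2) ss(1,3), of acc] ss(2) unfolding q_def by linarith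
  qed
  moreover have "ptime P (sized (k + 2)) (P ! f) (F f)"
    by (rule ptime_cong[OF ptime_shift[OF D1 q 2] eq])
  ultimately show ?thesis unfolding poly_fun_def using f(1) by blast
qed

section \<open>The program\<close>

text \<open>Lists are encoded by \<open>enc_list\<close>, numbers in unary by the length of a list. A current vertex is a
  record of its index, its row of the adjacency matrix and its table.\<close>

lemma tloop_fold:
  assumes "\<And>a b acc. g (Pair a b # acc # cs) = s a acc"
  shows "tloop g xs acc cs = fold s (list_of xs) acc"
  by (induction xs arbitrary: acc) (auto simp: assms)

definition "t_drop i t = fold (\<lambda>_ a. right a) (list_of i) t"
definition "t_add r s = fold (\<lambda>_ a. Pair Tip a) (list_of r) s"
definition "t_le a b \<longleftrightarrow> t_drop b a = Tip"
definition "t_eq a b \<longleftrightarrow> t_le a b \<and> t_le b a"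

abbreviation "idx x \<equiv> left x"
abbreviation "row x \<equiv> left (right x)"
abbreviation "tab x \<equiv> right (right x)"

definition "t_adj x y \<longleftrightarrow> left (t_drop (idx y) (row x)) \<noteq> Tip"
text \<open>In the loops here and below the second argument is the accumulator and the fixed
  arguments follow it, which is the variable order of \<open>loopE\<close>.\<close>

definition "t_mem I acc y = fold (\<lambda>x a. if a \<noteq> Tip then a else enc_bool (t_eq (idx x) (idx y))) (list_of I) acc"
definition "t_dom I acc y = fold (\<lambda>x a. if a \<noteq> Tip then a else enc_bool (t_adj y x)) (list_of I) acc"
definition "t_split Y acc x h = fold (\<lambda>z a. if a \<noteq> Tip then a else enc_bool (t_adj x z \<noteq> t_adj x h)) (list_of Y) acc"
definition "t_grow X acc Y = fold (\<lambda>x a. if t_mem Y Tip x \<noteq> Tip \<or> t_split Y Tip x (left Y) \<noteq> Tip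
  then Pair x a else a) (list_of X) acc"
definition "t_closure fuel acc X = fold (\<lambda>_ a. t_grow X Tip a) (list_of fuel) acc"
text \<open>\<open>right c \<noteq> Tip\<close> asks for two elements: the search also runs over
  pairs \<open>u\<close>, \<open>u\<close>, whose closure is a single vertex.\<close>

definition "t_smaller c b = (if right c \<noteq> Tip \<and> t_le c b then c else b)"
definition "t_inner V acc u X = fold (\<lambda>v a. t_smaller (t_closure X (Pair u (Pair v Tip)) X) a) (list_of V) acc"
definition "t_outer U acc X = fold (\<lambda>u a. t_inner X a u X) (list_of U) acc"
definition "t_tmem T acc e = fold (\<lambda>z a. if a \<noteq> Tip then a else
  enc_bool (t_eq (left z) (left e) \<and> t_eq (right z) (right e))) (list_of T) acc"
text \<open>Removing duplicates keeps tables polynomial: exponentially many guesses produce only few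
  distinct pairs.\<close>

definition "t_union A acc = fold (\<lambda>z a. if t_tmem a Tip z \<noteq> Tip then a else Pair z a) (list_of A) acc"
definition "t_sum T acc e = fold (\<lambda>z a. t_union (Pair (Pair (t_add (left e) (left z))
  (t_add (right e) (right z))) Tip) a) (list_of T) acc"
definition "t_prod A acc T = fold (\<lambda>e a. t_sum T a e) (list_of A) acc"
text \<open>\<open>m\<close> tells whether the block is guessed to meet the dominating set,
  \<open>d\<close> whether it has a guessed neighbour. A first component \<open>Tip\<close> is the
  number 0, so it marks the empty choice; entries that contradict the guess are dropped.\<close>

definition "t_opt T acc m d = fold (\<lambda>e a. if (m \<noteq> Tip) = (left e \<noteq> Tip)
  then t_union (Pair (Pair (left e) (if d \<noteq> Tip then Tip else right e)) Tip) a else a) (list_of T) acc"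
definition "t_minus X acc Y = fold (\<lambda>x a. if t_mem Y Tip x \<noteq> Tip then a else Pair x a) (list_of X) acc"
text \<open>The blue flag is copied as a number, because \<open>enc_bool\<close> yields the unary
  codes of 0 and 1.\<close>

definition "t_inittab c = Pair (Pair Tip (right c)) (if left c \<noteq> Tip then Pair (Pair (Pair Tip Tip) Tip) Tip else Tip)"
text \<open>The accumulator pairs a unary counter, the index of the next vertex, with the records
  built so far. Starting from \<open>Tip\<close> works because both projections of
  \<open>Tip\<close> are \<open>Tip\<close>.\<close>

definition "t_init rows acc = fold (\<lambda>r a. Pair (Pair Tip (left a))
  (Pair (Pair (left a) (Pair (right r) (t_inittab (left r)))) (right a))) (list_of rows) acc"
definition "t_cap v g = (if t_le v g then v else g)"
definition "t_decide T acc k \<gamma> = fold (\<lambda>e a. if a \<noteq> Tip then a else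
  enc_bool (t_le (left e) \<gamma> \<and> t_le (right e) k)) (list_of T) acc"
definition "t_comb ys acc I = fold (\<lambda>y a. t_prod (t_opt (tab y) Tip (t_mem I Tip y) (t_dom I Tip y)) Tip a)
  (list_of ys) acc"

fun t_go :: "tree \<Rightarrow> tree \<Rightarrow> tree \<Rightarrow> tree" where
  "t_go Tip I Y = t_comb Y (Pair (Pair Tip Tip) Tip) I"
| "t_go (Pair a b) I Y = t_union (t_go b (Pair a I) Y) (t_go b I Y)"

text \<open>Index and row are those of the first element of the module. Outside the module all its
  elements have the same neighbours, so no new row has to be built.\<close>

definition "t_merge Y X = Pair (Pair (idx (left Y)) (Pair (row (left Y)) (t_go Y Tip Y))) (t_minus X Tip Y)"
definition "t_contract fuel X = fold (\<lambda>_ a. if right a \<noteq> Tip then t_merge (t_outer a a a) a else a) (list_of fuel) X"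
definition "t_caploop fuel acc g = fold (\<lambda>_ a. if left a \<noteq> Tip then Pair (right (left a))
  (Pair (t_cap (if left (left a) \<noteq> Tip then t_add (right (right a)) (left (right a)) else left (right a)) g)
        (t_cap (t_add (right (right a)) (right (right a))) g)) else a) (list_of fuel) acc"
definition "t_capped fuel z = (let a = t_caploop fuel (Pair z (Pair Tip (Pair Tip Tip))) fuel
  in if left a \<noteq> Tip then fuel else left (right a))"
definition "t_main x = (if left (left (right x)) \<noteq> Tip then Tip
  else if left (right (right x)) \<noteq> Tip then Tip
  else t_decide (tab (left (t_contract (left x) (right (t_init (left x) Tip))))) Tip
    (t_capped (left x) (right (left (right x)))) (t_capped (left x) (right (right (right x)))))"

definition "oneE = PairE TipE TipE"
definition "leE a b = Cond (Call 1 [b, a]) TipE oneE"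
definition "eqE a b = Cond (leE a b) (leE b a) TipE"
definition "adjE x y = LeftE (Call 1 [LeftE y, LeftE (RightE x)])"
abbreviation "elemE \<equiv> LeftE (Var 0)"
definition "orE e = Cond (Var 1) (Var 1) e"
definition "insE e = Call 12 [PairE e TipE, Var 1]"

text \<open>Functions 1 to 18 call at most themselves and functions with smaller positive numbers,
  so their bounds can be proved in this order. The language has no local bindings: 8, 17 and 26 are
  functions of their own so that an argument is computed once and used several times.\<close>

definition prog :: program where
  "prog = [
    Cond (LeftE (LeftE (RightE (Var 0)))) TipE
      (Cond (LeftE (RightE (RightE (Var 0)))) TipE
        (Call 18 [RightE (RightE (LeftE (Call 23 [LeftE (Var 0), RightE (Call 19 [LeftE (Var 0), TipE])]))), TipE,
          Call 25 [LeftE (Var 0), RightE (LeftE (RightE (Var 0)))],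
          Call 25 [LeftE (Var 0), RightE (RightE (RightE (Var 0)))]])),
    loopE 1 0 (RightE (Var 1)),
    loopE 2 0 (PairE TipE (Var 1)),
    loopE 3 1 (orE (eqE (LeftE elemE) (LeftE (Var 2)))),
    loopE 4 1 (orE (Cond (adjE (Var 2) elemE) oneE TipE)),
    loopE 5 2 (orE (Cond (adjE (Var 2) elemE) (Cond (adjE (Var 2) (Var 3)) TipE oneE)
      (Cond (adjE (Var 2) (Var 3)) oneE TipE))),
    loopE 6 1 (Cond (Cond (Call 3 [Var 2, TipE, elemE]) oneE (Call 5 [Var 2, TipE, elemE, LeftE (Var 2)]))
      (PairE elemE (Var 1)) (Var 1)),
    loopE 7 1 (Call 6 [Var 2, TipE, Var 1]),
    Cond (RightE (Var 0)) (Cond (leE (Var 0) (Var 1)) (Var 0) (Var 1)) (Var 1),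
    loopE 9 2 (Call 8 [Call 7 [Var 3, PairE (Var 2) (PairE elemE TipE), Var 3], Var 1]),
    loopE 10 1 (Call 9 [Var 2, Var 1, elemE, Var 2]),
    loopE 11 1 (orE (Cond (eqE (LeftE elemE) (LeftE (Var 2))) (eqE (RightE elemE) (RightE (Var 2))) TipE)),
    loopE 12 0 (Cond (Call 11 [Var 1, TipE, elemE]) (Var 1) (PairE elemE (Var 1))),
    loopE 13 1 (insE (PairE (Call 2 [LeftE (Var 2), LeftE elemE]) (Call 2 [RightE (Var 2), RightE elemE]))),
    loopE 14 1 (Call 13 [Var 2, Var 1, elemE]),
    loopE 15 2 (Cond (Cond (Var 2) (LeftE elemE) (Cond (LeftE elemE) TipE oneE))
      (insE (PairE (LeftE elemE) (Cond (Var 3) TipE (RightE elemE)))) (Var 1)),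
    loopE 16 1 (Cond (Call 3 [Var 2, TipE, elemE]) (Var 1) (PairE elemE (Var 1))),
    Cond (leE (Var 0) (Var 1)) (Var 0) (Var 1),
    loopE 18 2 (orE (Cond (leE (LeftE elemE) (Var 3)) (leE (RightE elemE) (Var 2)) TipE)),
    loopE 19 0 (PairE (PairE TipE (LeftE (Var 1))) (PairE (PairE (LeftE (Var 1))
      (PairE (RightE elemE) (PairE (PairE TipE (RightE (LeftE elemE)))
         (Cond (LeftE (LeftE elemE)) (PairE (PairE oneE TipE) TipE) TipE)))) (RightE (Var 1)))),
    loopE 20 1 (Call 14 [Call 15 [RightE (RightE elemE), TipE, Call 3 [Var 2, TipE, elemE],
      Call 4 [Var 2, TipE, elemE]], TipE, Var 1]),
    Cond (Var 0) (Call 12 [Call 21 [RightE (Var 0), PairE elemE (Var 1), Var 2],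
        Call 21 [RightE (Var 0), Var 1, Var 2]])
      (Call 20 [Var 2, PairE (PairE TipE TipE) TipE, Var 1]),
    PairE (PairE (LeftE elemE) (PairE (LeftE (RightE elemE)) (Call 21 [Var 0, TipE, Var 0])))
      (Call 16 [Var 1, TipE, Var 0]),
    loopE 23 0 (Cond (RightE (Var 1)) (Call 22 [Call 10 [Var 1, Var 1, Var 1], Var 1]) (Var 1)),
    loopE 24 1 (Cond (LeftE (Var 1)) (PairE (RightE (LeftE (Var 1)))
      (PairE (Call 17 [Cond (LeftE (LeftE (Var 1))) (Call 2 [RightE (RightE (Var 1)), LeftE (RightE (Var 1))])
           (LeftE (RightE (Var 1))), Var 2])
         (Call 17 [Call 2 [RightE (RightE (Var 1)), RightE (RightE (Var 1))], Var 2]))) (Var 1)),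
    Call 26 [Call 24 [Var 0, PairE (Var 1) (PairE TipE oneE), Var 0], Var 0],
    Cond (LeftE (Var 0)) (Var 1) (LeftE (RightE (Var 0)))]"

text \<open>Position 0 is a dummy, here and in \<open>arity\<close>, so that list positions agree
  with function numbers. The functions from 19 on are treated separately.\<close>

definition sem :: "nat \<Rightarrow> tree list \<Rightarrow> tree" where
  "sem f env = ([\<lambda>v. Tip,
    \<lambda>v. t_drop (v 0) (v 1), \<lambda>v. t_add (v 0) (v 1), \<lambda>v. t_mem (v 0) (v 1) (v 2),
    \<lambda>v. t_dom (v 0) (v 1) (v 2), \<lambda>v. t_split (v 0) (v 1) (v 2) (v 3), \<lambda>v. t_grow (v 0) (v 1) (v 2),
    \<lambda>v. t_closure (v 0) (v 1) (v 2), \<lambda>v. t_smaller (v 0) (v 1), \<lambda>v. t_inner (v 0) (v 1) (v 2) (v 3),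
    \<lambda>v. t_outer (v 0) (v 1) (v 2), \<lambda>v. t_tmem (v 0) (v 1) (v 2), \<lambda>v. t_union (v 0) (v 1),
    \<lambda>v. t_sum (v 0) (v 1) (v 2), \<lambda>v. t_prod (v 0) (v 1) (v 2), \<lambda>v. t_opt (v 0) (v 1) (v 2) (v 3),
    \<lambda>v. t_minus (v 0) (v 1) (v 2), \<lambda>v. t_cap (v 0) (v 1),
    \<lambda>v. t_decide (v 0) (v 1) (v 2) (v 3)] ! f) ((!) env)"

definition arity :: "nat \<Rightarrow> nat" where
  "arity f = [1, 2, 2, 3, 3, 4, 3, 3, 2, 4, 3, 3, 2, 3, 3, 4, 3, 2, 4] ! f"

lemma length_prog: "length prog = 27" by (simp add: prog_def)

definition known :: "nat \<Rightarrow> nat \<Rightarrow> nat option" where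
  "known N f = (if 1 \<le> f \<and> f < N then Some (arity f) else None)"

definition polys :: "nat \<Rightarrow> bool" where
  "polys N \<longleftrightarrow> (\<forall>f. 1 \<le> f \<and> f < N \<longrightarrow> poly_fun prog f (arity f) (sem f))"

lemma polys_known: "polys N \<Longrightarrow> known N f = Some a \<Longrightarrow> poly_fun prog f a (sem f)"
  unfolding polys_def known_def by (auto split: if_splits)

lemma polys_Suc: "polys N \<Longrightarrow> arity N = k \<Longrightarrow> poly_fun prog N k (sem N) \<Longrightarrow> polys (Suc N)"
  unfolding polys_def by (auto simp: less_Suc_eq)

lemma polys_glue:
  assumes "polys N" "N < 27" "wf_expr (known N) k (prog ! N)" "arity N = k"
    "\<And>env. length env = k \<Longrightarrow> sem N env = den sem env (prog ! N)"
    and N': "N' = Suc N"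
  shows "polys N'"
  unfolding N' by (rule polys_Suc[OF assms(1,4) poly_fun_den[OF polys_known[OF assms(1)] _ assms(3,5)]])
    (use assms(2) length_prog in auto)

lemma polys_loop:
  assumes N: "polys N" "N < 27" "prog ! N = loopE N k e" "wf_expr (known N) (k + 2) e" "arity N = k + 2"
    and F: "\<And>xs acc cs. length cs = k \<Longrightarrow> sem N (xs # acc # cs) = fold (s cs) (list_of xs) acc"
    and s: "\<And>a b acc cs. length cs = k \<Longrightarrow> den sem (Pair a b # acc # cs) e = s cs a acc"
    and h: "poly_bdd h"
    and grow: "\<And>m a acc cs. \<lbrakk>size a < m; length cs = k; \<forall>c\<in>set cs. size c \<le> m\<rbrakk> \<Longrightarrow>
      size (s cs a acc) \<le> size acc + h m"
    and N': "N' = Suc N"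
  shows "polys N'"
  unfolding N'
proof (rule polys_Suc[OF N(1,5)], rule poly_fun_loop[OF polys_known[OF N(1)] _ N(3,4) _ h])
  show "N < length prog" using N(2) length_prog by simp
  show "sem N (xs # acc # cs) = tloop (\<lambda>env. den sem env e) xs acc cs" if "length cs = k" for xs acc cs
    using F[OF that] tloop_fold[of "\<lambda>env. den sem env e" cs "s cs", OF s[OF that]] by simp
  show "size (den sem (Pair a b # acc # cs) e) \<le> size acc + h m"
    if "size (Pair a b) \<le> m" "length cs = k" "\<forall>c\<in>set cs. size c \<le> m" for m a b acc cs
    using grow[of a m cs acc] s[of cs a b acc] that by simp
qed

lemmas code_simps = prog_def arity_def sem_def known_def oneE_def leE_def eqE_def adjE_def orE_def insE_def
  enc_bool_def

lemma size_enc_bool: "size (enc_bool b) \<le> 1"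
  by (simp add: enc_bool_def)

lemma size_fold_list_of:
  assumes "\<And>x a. x \<in> set (list_of t) \<Longrightarrow> size (s x a) \<le> size a + size x + c"
  shows "size (fold s (list_of t) acc) \<le> size acc + size t + len t * c"
  using assms
proof (induction t arbitrary: acc)
  case (Pair a b)
  have "size (s a acc) \<le> size acc + size a + c" using Pair.prems[of a acc] by simp
  moreover have "size (fold s (list_of b) (s a acc)) \<le> size (s a acc) + size b + len b * c"
    using Pair.IH(2)[of "s a acc"] Pair.prems by simp
  ultimately show ?case by simp
qed simp

lemma size_filter:
  assumes "\<And>x a. s x a = a \<or> s x a = Pair x a"
  shows "size (fold s (list_of t) acc) \<le> size acc + size t"
proof (induction t arbitrary: acc)
  case (Pair a b)
  show ?case using Pair.IH(2)[of acc] Pair.IH(2)[of "Pair a acc"] assms[of a acc] by auto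
qed simp

lemma nth23: "(x # y # zs) ! 2 = zs ! 0" "(x # y # zs) ! 3 = zs ! 1"
  by (simp_all add: numeral_2_eq_2 numeral_3_eq_3)

lemma len1: "length cs = Suc 0 \<longleftrightarrow> (\<exists>a. cs = [a])" and len2: "length cs = 2 \<longleftrightarrow> (\<exists>a b. cs = [a, b])"
  by (auto simp: length_Suc_conv numeral_2_eq_2)

section \<open>Polynomial bounds for functions 1 to 18\<close>

lemma polys1: "polys 1"
  by (simp add: polys_def)

lemma polys2: "polys 2"
  by (rule polys_loop[OF polys1, where k = 0 and s = "\<lambda>_ _ a. right a" and h = "\<lambda>_. 0"])
    (auto simp: code_simps t_drop_def size_right intro: poly_bdd_const)

lemma polys3: "polys 3"
  by (rule polys_loop[OF polys2, where k = 0 and s = "\<lambda>_ _ a. Pair Tip a" and h = "\<lambda>_. 1"])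
    (auto simp: code_simps t_add_def intro: poly_bdd_const)

lemma polys4: "polys 4"
  by (rule polys_loop[OF polys3, where k = 1 and h = "\<lambda>_. 1" and
      s = "\<lambda>cs x a. if a \<noteq> Tip then a else enc_bool (t_eq (idx x) (idx (cs ! 0)))"])
    (auto simp: code_simps t_mem_def t_eq_def t_le_def len1 nth23 cong: if_cong intro: poly_bdd_const)

lemma polys5: "polys 5"
  by (rule polys_loop[OF polys4, where k = 1 and h = "\<lambda>_. 1" and
      s = "\<lambda>cs x a. if a \<noteq> Tip then a else enc_bool (t_adj (cs ! 0) x)"])
    (auto simp: code_simps t_dom_def t_adj_def len1 nth23 cong: if_cong intro: poly_bdd_const)

lemma polys6: "polys 6"
  by (rule polys_loop[OF polys5, where k = 2 and h = "\<lambda>_. 1" and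
      s = "\<lambda>cs x a. if a \<noteq> Tip then a else enc_bool (t_adj (cs ! 0) x \<noteq> t_adj (cs ! 0) (cs ! 1))"])
    (auto simp: code_simps t_split_def t_adj_def len2 nth23 cong: if_cong intro: poly_bdd_const)

lemma polys7: "polys 7"
  by (rule polys_loop[OF polys6, where k = 1 and h = "\<lambda>m. m" and
      s = "\<lambda>cs x a. if t_mem (cs ! 0) Tip x \<noteq> Tip \<or> t_split (cs ! 0) Tip x (left (cs ! 0)) \<noteq> Tip
        then Pair x a else a"])
    (auto simp: code_simps t_grow_def len1 nth23 cong: if_cong intro: poly_bdd_id)

lemma size_t_grow: "size (t_grow X acc Y) \<le> size acc + size X"
  unfolding t_grow_def by (rule size_filter) auto

lemma polys8: "polys 8"
  by (rule polys_loop[OF polys7, where k = 1 and h = "\<lambda>m. m" and s = "\<lambda>cs x a. t_grow (cs ! 0) Tip a"])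
    (auto simp: code_simps t_closure_def len1 nth23 cong: if_cong intro: poly_bdd_id trans_le_add2 order_trans[OF size_t_grow])

text \<open>Every round returns a selection from \<open>X\<close>, so sizes do not accumulate; only
  the starting list can be larger than \<open>X\<close>.\<close>

lemma size_t_closure: "size (t_closure fuel acc X) \<le> size acc + size X"
proof -
  have "size (t_closure fuel acc X) \<le> max (size acc) (size X)"
    unfolding t_closure_def
  proof (induction fuel arbitrary: acc)
    case (Pair a b)
    have "size (t_grow X Tip acc) \<le> size X" using size_t_grow[of X Tip acc] by simp
    then have "max (size (t_grow X Tip acc)) (size X) \<le> max (size acc) (size X)" by simp
    from order_trans[OF Pair.IH(2) this] show ?case by simp
  qed simp
  then show ?thesis by simp
qed

lemma polys9: "polys 9"
  by (rule polys_glue[OF polys8, where k = 2]) (auto simp: code_simps t_smaller_def t_le_def)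

lemma polys10: "polys 10"
proof (rule polys_loop[OF polys9, where k = 2 and h = "\<lambda>m. 4 * m + 2" and
      s = "\<lambda>cs x a. t_smaller (t_closure (cs ! 1) (Pair (cs ! 0) (Pair x Tip)) (cs ! 1)) a"])
  show "size (t_smaller (t_closure (cs ! 1) (Pair (cs ! 0) (Pair a Tip)) (cs ! 1)) acc) \<le> size acc + (4 * m + 2)"
    if "size a < m" "length cs = 2" "\<forall>c\<in>set cs. size c \<le> m" for m a acc cs
    using size_t_closure[of "cs ! 1" "Pair (cs ! 0) (Pair a Tip)" "cs ! 1"] that
    by (auto simp: len2 t_smaller_def)
  show "poly_bdd (\<lambda>m. 4 * m + 2)" by (intro poly_bdd_intros)
qed (auto simp: code_simps t_inner_def len2 nth23 cong: if_cong)

lemma size_list_of: "x \<in> set (list_of t) \<Longrightarrow> size x < size t"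
  by (induction t) auto

text \<open>The result is the initial accumulator or a single candidate, so the bound does not
  depend on how many candidates are tried.\<close>

lemma size_t_inner: "size (t_inner V acc u X) \<le> size acc + (size X + size u + size V + 2)"
proof -
  have "size (fold (\<lambda>v a. t_smaller (t_closure X (Pair u (Pair v Tip)) X) a) vs acc)
      \<le> max (size acc) (size X + size u + size V + 2)" if "\<forall>v\<in>set vs. size v \<le> size V" for vs acc
    using that
  proof (induction vs arbitrary: acc)
    case (Cons v vs)
    let ?a = "t_smaller (t_closure X (Pair u (Pair v Tip)) X) acc"
    have "size ?a \<le> max (size acc) (size X + size u + size V + 2)"
      using size_t_closure[of X "Pair u (Pair v Tip)" X] Cons.prems by (auto simp: t_smaller_def)
    then show ?case using Cons.IH[of ?a] Cons.prems by simp
  qed simp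
  from this[of "list_of V" acc] show ?thesis
    unfolding t_inner_def using size_list_of[of _ V] by (force simp: less_imp_le)
qed

lemma polys11: "polys 11"
proof (rule polys_loop[OF polys10, where k = 1 and h = "\<lambda>m. 3 * m + 2" and
      s = "\<lambda>cs x a. t_inner (cs ! 0) a x (cs ! 0)"])
  show "size (t_inner (cs ! 0) acc a (cs ! 0)) \<le> size acc + (3 * m + 2)"
    if "size a < m" "length cs = 1" "\<forall>c\<in>set cs. size c \<le> m" for m a acc cs
    using size_t_inner[of "cs ! 0" acc a "cs ! 0"] that by (auto simp: len1)
  show "poly_bdd (\<lambda>m. 3 * m + 2)" by (intro poly_bdd_intros)
qed (auto simp: code_simps t_outer_def len1 nth23 cong: if_cong)

lemma polys12: "polys 12"
  by (rule polys_loop[OF polys11, where k = 1 and h = "\<lambda>_. 1" and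
      s = "\<lambda>cs z a. if a \<noteq> Tip then a else
        enc_bool (t_eq (left z) (left (cs ! 0)) \<and> t_eq (right z) (right (cs ! 0)))"])
    (auto simp: code_simps t_tmem_def t_eq_def t_le_def len1 nth23 cong: if_cong intro: poly_bdd_const)

lemma polys13: "polys 13"
  by (rule polys_loop[OF polys12, where k = 0 and h = "\<lambda>m. m" and
      s = "\<lambda>_ z a. if t_tmem a Tip z \<noteq> Tip then a else Pair z a"])
    (auto simp: code_simps t_union_def intro: poly_bdd_id)

lemma size_t_union: "size (t_union A acc) \<le> size acc + size A"
  unfolding t_union_def by (rule size_filter) auto

lemma size_t_add: "size (t_add r s) = size s + len r"
  unfolding t_add_def
proof (induction r arbitrary: s)
  case (Pair a b)
  show ?case using Pair.IH(2)[of "Pair Tip s"] by simp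
qed simp

lemma size_left_right: "size (left e) + size (right e) \<le> size e"
  by (cases e) auto

lemma size_t_sum_step: "size (t_union (Pair (Pair (t_add (left e) (left z)) (t_add (right e) (right z))) Tip) a)
    \<le> size a + size z + (size e + 2)"
  using size_t_union[of "Pair (Pair (t_add (left e) (left z)) (t_add (right e) (right z))) Tip" a]
    len_le_size[of "left e"] len_le_size[of "right e"] size_left_right[of e] size_left_right[of z]
  by (simp add: size_t_add)

lemma polys14: "polys 14"
proof (rule polys_loop[OF polys13, where k = 1 and h = "\<lambda>m. 2 * m + 2" and
      s = "\<lambda>cs z a. t_union (Pair (Pair (t_add (left (cs ! 0)) (left z)) (t_add (right (cs ! 0)) (right z))) Tip) a"])
  show "size (t_union (Pair (Pair (t_add (left (cs ! 0)) (left a)) (t_add (right (cs ! 0)) (right a))) Tip) acc)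
    \<le> size acc + (2 * m + 2)" if "size a < m" "length cs = 1" "\<forall>c\<in>set cs. size c \<le> m" for m a acc cs
    using size_t_sum_step[of "cs ! 0" a acc] that by (auto simp: len1)
  show "poly_bdd (\<lambda>m. 2 * m + 2)" by (intro poly_bdd_intros)
qed (auto simp: code_simps t_sum_def len1 nth23 cong: if_cong)

lemma size_t_sum: "size (t_sum T acc e) \<le> size acc + size T + len T * (size e + 2)"
  unfolding t_sum_def by (rule size_fold_list_of) (rule size_t_sum_step)

lemma polys15: "polys 15"
proof (rule polys_loop[OF polys14, where k = 1 and h = "\<lambda>m. m + m * (m + 2)" and
      s = "\<lambda>cs e a. t_sum (cs ! 0) a e"])
  show "size (t_sum (cs ! 0) acc a) \<le> size acc + (m + m * (m + 2))"
    if "size a < m" "length cs = 1" "\<forall>c\<in>set cs. size c \<le> m" for m a acc cs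
  proof -
    have T: "size (cs ! 0) \<le> m" using that by auto
    have "len (cs ! 0) * (size a + 2) \<le> m * (m + 2)"
      using le_trans[OF len_le_size T] that by (intro mult_le_mono) auto
    then show ?thesis using size_t_sum[of "cs ! 0" acc a] T by linarith
  qed
  show "poly_bdd (\<lambda>m. m + m * (m + 2))" by (intro poly_bdd_intros)
qed (auto simp: code_simps t_prod_def len1 nth23 cong: if_cong)

lemma polys16: "polys 16"
proof (rule polys_loop[OF polys15, where k = 2 and h = "\<lambda>m. m + 2" and
      s = "\<lambda>cs e a. if (cs ! 0 \<noteq> Tip) = (left e \<noteq> Tip)
        then t_union (Pair (Pair (left e) (if cs ! 1 \<noteq> Tip then Tip else right e)) Tip) a else a"])
  show "size (if (cs ! 0 \<noteq> Tip) = (left a \<noteq> Tip)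
        then t_union (Pair (Pair (left a) (if cs ! 1 \<noteq> Tip then Tip else right a)) Tip) acc else acc)
      \<le> size acc + (m + 2)"
    if "size a < m" "length cs = 2" "\<forall>c\<in>set cs. size c \<le> m" for m a acc cs
    using size_t_union[of "Pair (Pair (left a) (if cs ! 1 \<noteq> Tip then Tip else right a)) Tip" acc]
      size_left_right[of a] that by auto
  show "poly_bdd (\<lambda>m. m + 2)" by (intro poly_bdd_intros)
qed (auto simp: code_simps t_opt_def len2 nth23 cong: if_cong)

lemma polys17: "polys 17"
  by (rule polys_loop[OF polys16, where k = 1 and h = "\<lambda>m. m" and
      s = "\<lambda>cs x a. if t_mem (cs ! 0) Tip x \<noteq> Tip then a else Pair x a"])
    (auto simp: code_simps t_minus_def len1 nth23 cong: if_cong intro: poly_bdd_id)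

lemma polys18: "polys 18"
  by (rule polys_glue[OF polys17, where k = 2]) (auto simp: code_simps t_cap_def t_le_def)

lemma polys19: "polys 19"
  by (rule polys_loop[OF polys18, where k = 2 and h = "\<lambda>_. 1" and
      s = "\<lambda>cs e a. if a \<noteq> Tip then a else enc_bool (t_le (left e) (cs ! 1) \<and> t_le (right e) (cs ! 0))"])
    (auto simp: code_simps t_decide_def t_le_def len2 nth23 cong: if_cong intro: poly_bdd_const)

section \<open>The tree operations as operations on lists\<close>

lemma list_of_eq_Nil [simp]: "list_of t = [] \<longleftrightarrow> t = Tip"
  by (cases t) auto

lemma list_of_right: "list_of (right a) = tl (list_of a)"
  by (cases a) auto

lemma left_hd: "t \<noteq> Tip \<Longrightarrow> left t = hd (list_of t)"
  by (cases t) auto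

lemma list_of_drop: "list_of (t_drop i t) = drop (len i) (list_of t)"
  unfolding t_drop_def
proof (induction i arbitrary: t)
  case (Pair a b)
  show ?case using Pair.IH(2)[of "right t"] by (simp add: list_of_right drop_Suc)
qed simp

lemma t_le_iff: "t_le a b \<longleftrightarrow> len a \<le> len b"
proof -
  have "t_le a b \<longleftrightarrow> list_of (t_drop b a) = []" by (simp add: t_le_def)
  then show ?thesis by (simp only: list_of_drop drop_eq_Nil)
qed

lemma t_eq_iff: "t_eq a b \<longleftrightarrow> len a = len b"
  by (auto simp: t_eq_def t_le_iff)

lemma right_neq_Tip: "right t \<noteq> Tip \<longleftrightarrow> 2 \<le> len t"
  by (cases t; cases "right t") auto

abbreviation "vid x \<equiv> len (idx x)"

lemma t_adj_nth: "vid y < len (row x) \<Longrightarrow> t_adj x y \<longleftrightarrow> list_of (row x) ! vid y \<noteq> Tip"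
proof -
  assume *: "vid y < len (row x)"
  then have ne: "t_drop (idx y) (row x) \<noteq> Tip"
    by (metis drop_eq_Nil linorder_not_le list_of_drop list_of_eq_Nil)
  show ?thesis
    unfolding t_adj_def left_hd[OF ne] using * by (simp add: list_of_drop hd_drop_conv_nth)
qed

lemma enc_bool_Tip [simp]: "enc_bool b = Tip \<longleftrightarrow> \<not> b"
  by (simp add: enc_bool_def)

lemma fold_or: "fold (\<lambda>x a. if a \<noteq> Tip then a else enc_bool (p x)) xs a \<noteq> Tip \<longleftrightarrow> a \<noteq> Tip \<or> (\<exists>x\<in>set xs. p x)"
  by (induction xs arbitrary: a) auto

lemma t_mem_iff: "t_mem I Tip y \<noteq> Tip \<longleftrightarrow> vid y \<in> vid ` set (list_of I)"
  unfolding t_mem_def fold_or by (auto simp: t_eq_iff image_iff eq_commute[of "vid y"])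

lemma t_dom_iff: "t_dom I Tip y \<noteq> Tip \<longleftrightarrow> (\<exists>z\<in>set (list_of I). t_adj y z)"
  unfolding t_dom_def fold_or by auto

lemma t_split_iff: "t_split Y Tip x h \<noteq> Tip \<longleftrightarrow> (\<exists>z\<in>set (list_of Y). t_adj x z \<noteq> t_adj x h)"
  unfolding t_split_def fold_or by auto

lemma t_tmem_iff: "t_tmem T Tip e \<noteq> Tip \<longleftrightarrow>
    (\<exists>z\<in>set (list_of T). len (left z) = len (left e) \<and> len (right z) = len (right e))"
  unfolding t_tmem_def fold_or by (auto simp: t_eq_iff)

lemma t_decide_iff: "t_decide T Tip k \<gamma> \<noteq> Tip \<longleftrightarrow>
    (\<exists>z\<in>set (list_of T). len (left z) \<le> len \<gamma> \<and> len (right z) \<le> len k)"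
  unfolding t_decide_def fold_or by (auto simp: t_le_iff)

lemma list_of_filter: "list_of (fold (\<lambda>x a. if p x then Pair x a else a) xs acc) = rev (filter p xs) @ list_of acc"
  by (induction xs arbitrary: acc) auto

lemma list_of_grow: "list_of (t_grow X Tip Y) =
    rev (filter (\<lambda>x. t_mem Y Tip x \<noteq> Tip \<or> t_split Y Tip x (left Y) \<noteq> Tip) (list_of X))"
  unfolding t_grow_def list_of_filter by simp

lemma list_of_minus: "list_of (t_minus X Tip Y) = rev (filter (\<lambda>x. t_mem Y Tip x = Tip) (list_of X))"
proof -
  have "t_minus X Tip Y = fold (\<lambda>x a. if t_mem Y Tip x = Tip then Pair x a else a) (list_of X) Tip"
    unfolding t_minus_def by (rule arg_cong[of _ _ "\<lambda>s. fold s _ _"]) (intro ext, simp)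
  then show ?thesis by (simp only: list_of_filter) simp
qed

section \<open>Modules\<close>

definition is_module :: "('a \<Rightarrow> 'a \<Rightarrow> bool) \<Rightarrow> 'a set \<Rightarrow> 'a set \<Rightarrow> bool" where
  "is_module A S Y \<longleftrightarrow> Y \<subseteq> S \<and> (\<forall>x\<in>S - Y. \<forall>a\<in>Y. \<forall>b\<in>Y. A x a = A x b)"

text \<open>A splitter distinguishes two elements of \<open>Y\<close>. The subsets of
  \<open>S\<close> that are fixed points of this map are exactly the modules.\<close>

definition add_splitters :: "('a \<Rightarrow> 'a \<Rightarrow> bool) \<Rightarrow> 'a set \<Rightarrow> 'a set \<Rightarrow> 'a set" where
  "add_splitters A S Y = {x \<in> S. x \<in> Y \<or> (\<exists>a\<in>Y. \<exists>b\<in>Y. A x a \<noteq> A x b)}"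

lemma add_splitters_subset: "add_splitters A S Y \<subseteq> S"
  by (auto simp: add_splitters_def)

lemma funpow_add_splitters:
  assumes "Y \<subseteq> S"
  shows "Y \<subseteq> (add_splitters A S ^^ n) Y" "(add_splitters A S ^^ n) Y \<subseteq> S"
  using assms by (induction n) (auto simp: add_splitters_def)

text \<open>A vertex outside \<open>M\<close> distinguishes no two elements of \<open>M\<close>, so
  adding splitters never leaves \<open>M\<close>. The closure of a pair is therefore contained in
  every module that contains the pair.\<close>

lemma add_splitters_module:
  assumes "is_module A S M" "Y \<subseteq> M"
  shows "(add_splitters A S ^^ n) Y \<subseteq> M"
proof (induction n)
  case (Suc n)
  then show ?case using assms(1) unfolding is_module_def add_splitters_def
    by simp blast
qed (use assms in simp)

text \<open>Every round adds a vertex until the set is stationary. Hence \<open>card S\<close>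
  rounds reach a fixed point or all of \<open>S\<close>, which is a fixed point too.\<close>

lemma module_add_splitters:
  assumes "finite S" "Y \<subseteq> S"
  shows "is_module A S ((add_splitters A S ^^ card S) Y)"
proof -
  let ?f = "add_splitters A S"
  have sub: "(?f ^^ n) Y \<subseteq> S" for n using funpow_add_splitters[OF assms(2)] by blast
  have mono: "(?f ^^ n) Y \<subseteq> (?f ^^ Suc n) Y" for n
    using sub[of n] unfolding funpow.simps comp_apply by (auto simp: add_splitters_def)
  have "?f ((?f ^^ n) Y) = (?f ^^ n) Y \<or> n \<le> card ((?f ^^ n) Y)" for n
  proof (induction n)
    case (Suc n)
    show ?case
    proof (cases "?f ((?f ^^ n) Y) = (?f ^^ n) Y")
      case False
      then have "n \<le> card ((?f ^^ n) Y)" using Suc by blast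
      moreover have "(?f ^^ n) Y \<subset> (?f ^^ Suc n) Y" using mono[of n] False by auto
      then have "card ((?f ^^ n) Y) < card ((?f ^^ Suc n) Y)"
        by (rule psubset_card_mono[OF finite_subset[OF sub assms(1)]])
      ultimately show ?thesis by simp
    qed simp
  qed simp
  then have "?f ((?f ^^ card S) Y) = (?f ^^ card S) Y \<or> (?f ^^ card S) Y = S"
    using card_seteq[OF assms(1) sub] by blast
  moreover have "?f S = S" by (auto simp: add_splitters_def)
  ultimately have "?f ((?f ^^ card S) Y) = (?f ^^ card S) Y" by auto
  moreover have "is_module A S Z" if "Z \<subseteq> S" "?f Z = Z" for Z
  proof -
    have "x \<in> Z" if "x \<in> S" "a \<in> Z" "b \<in> Z" "A x a \<noteq> A x b" for x a b
    proof -
      have "x \<in> ?f Z" using that unfolding add_splitters_def by blast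
      then show ?thesis using \<open>?f Z = Z\<close> by simp
    qed
    then show ?thesis using \<open>Z \<subseteq> S\<close> unfolding is_module_def by blast
  qed
  ultimately show ?thesis using sub by blast
qed

lemma closed_module: "is_module A S S"
  by (simp add: is_module_def)

lemma md_edges_subset: "md_wf T \<Longrightarrow> e \<in> md_edges T \<Longrightarrow> e \<subseteq> md_verts T"
proof (induction T arbitrary: e)
  case (Module H Ts)
  then show ?case by (fastforce simp: in_set_conv_nth)
qed simp

lemma md_edges_Module_cases:
  assumes "{u, v} \<in> md_edges (Module H Ts)"
  obtains j where "j < length Ts" "{u, v} \<in> md_edges (Ts ! j)"
  | p q where "p < length Ts" "q < length Ts" "{p, q} \<in> H" "u \<in> md_verts (Ts ! p)" "v \<in> md_verts (Ts ! q)"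
proof (cases "\<exists>T\<in>set Ts. {u, v} \<in> md_edges T")
  case True
  then show ?thesis using that(1) by (auto simp: in_set_conv_nth)
next
  case False
  then obtain u' v' i j where *: "{u, v} = {u', v'}" "i < length Ts" "j < length Ts" "{i, j} \<in> H"
    "u' \<in> md_verts (Ts ! i)" "v' \<in> md_verts (Ts ! j)"
    using assms by auto
  from *(1) consider "u = u'" "v = v'" | "u = v'" "v = u'" by (auto simp: doubleton_eq_iff)
  then show ?thesis
  proof cases
    case 1
    then show ?thesis using that(2)[of i j] * by simp
  next
    case 2
    then show ?thesis using that(2)[of j i] * by (simp add: insert_commute)
  qed
qed

lemma md_edges_child:
  assumes "md_wf (Module H Ts)" "i < length Ts" "u \<in> md_verts (Ts ! i)" "v \<in> md_verts (Ts ! i)"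
  shows "{u, v} \<in> md_edges (Module H Ts) \<longleftrightarrow> {u, v} \<in> md_edges (Ts ! i)"
proof
  assume "{u, v} \<in> md_edges (Module H Ts)"
  then consider j where "j < length Ts" "{u, v} \<in> md_edges (Ts ! j)"
    | p q where "p < length Ts" "q < length Ts" "{p, q} \<in> H"
        "u \<in> md_verts (Ts ! p)" "v \<in> md_verts (Ts ! q)"
    by (rule md_edges_Module_cases)
  then show "{u, v} \<in> md_edges (Ts ! i)"
  proof cases
    case 1
    then have "u \<in> md_verts (Ts ! j)" using md_edges_subset[of "Ts ! j"] assms(1) by fastforce
    then have "j = i" using assms 1 by (auto simp: disjoint_iff)
    then show ?thesis using 1 by simp
  next
    case 2
    then have "p = i" "q = i" using assms by (auto simp: disjoint_iff)
    \<comment> \<open>\<open>H\<close> has no loops, so an edge contributed by the node itself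
      cannot lie inside one child.\<close>
    then have "{i} \<in> H" using 2 by simp
    moreover have "simple_edges {..<length Ts} H" using assms(1) by simp
    ultimately show ?thesis unfolding simple_edges_def by (metis doubleton_eq_iff insert_absorb2)
  qed
qed (use assms(2) in \<open>auto intro!: bexI[of _ "Ts ! i"]\<close>)

lemma md_edges_cross:
  assumes "md_wf (Module H Ts)" "i < length Ts" "j < length Ts" "i \<noteq> j"
    "u \<in> md_verts (Ts ! i)" "v \<in> md_verts (Ts ! j)"
  shows "{u, v} \<in> md_edges (Module H Ts) \<longleftrightarrow> {i, j} \<in> H"
proof
  assume "{u, v} \<in> md_edges (Module H Ts)"
  then consider k where "k < length Ts" "{u, v} \<in> md_edges (Ts ! k)"
    | p q where "p < length Ts" "q < length Ts" "{p, q} \<in> H"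
        "u \<in> md_verts (Ts ! p)" "v \<in> md_verts (Ts ! q)"
    by (rule md_edges_Module_cases)
  then show "{i, j} \<in> H"
  proof cases
    case 1
    then have "u \<in> md_verts (Ts ! k)" "v \<in> md_verts (Ts ! k)"
      using md_edges_subset[of "Ts ! k"] assms(1) by fastforce+
    then have "k = i" "k = j" using assms 1 by (auto simp: disjoint_iff)
    then show ?thesis using assms(4) by simp
  next
    case 2
    then have "p = i" "q = j" using assms by (auto simp: disjoint_iff)
    then show ?thesis using 2 by simp
  qed
next
  assume "{i, j} \<in> H"
  then show "{u, v} \<in> md_edges (Module H Ts)" using assms(2,3,5,6) by auto
qed

text \<open>Descend to the deepest node whose part of \<open>X\<close> still has two elements: each of its children
  then contributes at most one vertex.\<close>

lemma small_module:
  assumes "md_wf T" "X \<subseteq> md_verts T" "2 \<le> card X"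
  shows "\<exists>Y. is_module (\<lambda>u v. {u, v} \<in> md_edges T) X Y \<and> 2 \<le> card Y \<and> card Y \<le> md_width T"
  using assms
proof (induction T arbitrary: X)
  case (Single v)
  then have "card X \<le> card {v}" by (intro card_mono) auto
  then show ?case using Single by simp
next
  case (Module H Ts)
  show ?case
  proof (cases "\<exists>i<length Ts. 2 \<le> card (X \<inter> md_verts (Ts ! i))")
    case True
    then obtain i where i: "i < length Ts" "2 \<le> card (X \<inter> md_verts (Ts ! i))" by blast
    have wf: "md_wf (Ts ! i)" using Module.prems(1) i by simp
    obtain Y where Y: "is_module (\<lambda>u v. {u, v} \<in> md_edges (Ts ! i)) (X \<inter> md_verts (Ts ! i)) Y"
      "2 \<le> card Y" "card Y \<le> md_width (Ts ! i)"
      using Module.IH[of "Ts ! i" "X \<inter> md_verts (Ts ! i)"] i wf by auto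
    \<comment> \<open>Vertices of other children are joined to all or to none of child
      \<open>i\<close>, as \<open>H\<close> prescribes; so a module of the part inside the child is
      a module of all of \<open>X\<close>.\<close>
    have "is_module (\<lambda>u v. {u, v} \<in> md_edges (Module H Ts)) X Y"
      unfolding is_module_def
    proof (intro conjI ballI)
      show "Y \<subseteq> X" using Y(1) by (auto simp: is_module_def)
      fix x a b assume x: "x \<in> X - Y" and ab: "a \<in> Y" "b \<in> Y"
      then have ab': "a \<in> md_verts (Ts ! i)" "b \<in> md_verts (Ts ! i)"
        using Y(1) by (auto simp: is_module_def)
      obtain T' where "T' \<in> set Ts" "x \<in> md_verts T'"
        using x Module.prems(2) by auto
      then obtain j where j: "j < length Ts" "x \<in> md_verts (Ts ! j)"
        by (metis in_set_conv_nth)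
      show "({x, a} \<in> md_edges (Module H Ts)) = ({x, b} \<in> md_edges (Module H Ts))"
      proof (cases "j = i")
        case True
        then have xi: "x \<in> md_verts (Ts ! i)" using j(2) by simp
        have "({x, a} \<in> md_edges (Ts ! i)) = ({x, b} \<in> md_edges (Ts ! i))"
          using Y(1) x ab xi unfolding is_module_def by blast
        then show ?thesis
          unfolding md_edges_child[OF Module.prems(1) i(1) xi ab'(1)]
            md_edges_child[OF Module.prems(1) i(1) xi ab'(2)] .
      next
        case False
        show ?thesis
          unfolding md_edges_cross[OF Module.prems(1) j(1) i(1) False j(2) ab'(1)]
            md_edges_cross[OF Module.prems(1) j(1) i(1) False j(2) ab'(2)] ..
      qed
    qed
    moreover have "md_width (Ts ! i) \<le> md_width (Module H Ts)"
      using i(1) by simp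
    ultimately show ?thesis using Y(2,3) le_trans by blast
  next
    case False
    have "X = (\<Union>i<length Ts. X \<inter> md_verts (Ts ! i))"
    proof (intro equalityI subsetI)
      fix x assume x: "x \<in> X"
      then obtain T' where "T' \<in> set Ts" "x \<in> md_verts T'"
        using Module.prems(2) by auto
      then show "x \<in> (\<Union>i<length Ts. X \<inter> md_verts (Ts ! i))"
        using x by (auto simp: in_set_conv_nth)
    qed auto
    then have "card X \<le> (\<Sum>i<length Ts. card (X \<inter> md_verts (Ts ! i)))"
      by (metis card_UN_le finite_lessThan)
    also have "\<dots> \<le> (\<Sum>i<length Ts. 1)"
      using False by (intro sum_mono) (simp add: not_le less_Suc_eq_le numeral_2_eq_2)
    also have "\<dots> \<le> md_width (Module H Ts)" by simp
    \<comment> \<open>The module is \<open>X\<close> itself.\<close>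
    finally show ?thesis using Module.prems(3) closed_module by metis
  qed
qed

lemma modular_width_attained:
  assumes "is_rb_graph G" "verts G \<noteq> {}"
  obtains T where "is_moddec_of T G" "md_width T = modular_width G"
  using LeastI_ex[of "\<lambda>w. \<exists>T. is_moddec_of T G \<and> md_width T = w"] ex_moddec[OF assms]
  unfolding modular_width_def by blast

text \<open>An induced subgraph gets its bound from a decomposition of the whole graph, so
  modular-width need not be compared between the two graphs.\<close>

lemma small_module_graph:
  assumes "is_rb_graph G" "X \<subseteq> verts G" "2 \<le> card X"
  shows "\<exists>Y. is_module (\<lambda>u v. {u, v} \<in> edges G) X Y \<and> 2 \<le> card Y \<and> card Y \<le> modular_width G"
proof -
  have "verts G \<noteq> {}" using assms(2,3) by auto
  then obtain T where T: "is_moddec_of T G" "md_width T = modular_width G"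
    using modular_width_attained[OF assms(1)] by blast
  then show ?thesis using small_module[of T X] assms unfolding is_moddec_of_def by auto
qed

section \<open>Tables of achievable pairs\<close>

fun unary :: "nat \<Rightarrow> tree" where
  "unary 0 = Tip"
| "unary (Suc n) = Pair Tip (unary n)"

lemma len_unary [simp]: "len (unary n) = n" and size_unary [simp]: "size (unary n) = n"
  by (induction n) auto

lemma unary_Tip [simp]: "unary n = Tip \<longleftrightarrow> n = 0"
  by (cases n) auto

lemma unary_inject [simp]: "unary a = unary b \<longleftrightarrow> a = b"
  by (metis len_unary)

lemma unary_add: "t_add (unary a) (unary b) = unary (a + b)"
  unfolding t_add_def
proof (induction a arbitrary: b)
  case (Suc a)
  show ?case using Suc[of "Suc b"] by simp
qed simp

definition pair_tree :: "nat \<times> nat \<Rightarrow> tree" where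
  "pair_tree e = Pair (unary (fst e)) (unary (snd e))"

lemma pair_tree_inject [simp]: "pair_tree e = pair_tree f \<longleftrightarrow> e = f"
  unfolding pair_tree_def by (metis len_unary prod_eq_iff tree.inject)

text \<open>The set carries the meaning; distinctness serves the size bound
  \<open>size_table\<close>.\<close>

definition table :: "(nat \<times> nat) set \<Rightarrow> tree \<Rightarrow> bool" where
  "table A T \<longleftrightarrow> distinct (list_of T) \<and> set (list_of T) = pair_tree ` A"

lemma table_empty: "table {} Tip"
  by (simp add: table_def)

lemma table_single: "table {e} (Pair (pair_tree e) Tip)"
  by (simp add: table_def)

lemma table_insert_tree:
  assumes "table B acc"
  shows "table (insert e B) (if t_tmem acc Tip (pair_tree e) \<noteq> Tip then acc else Pair (pair_tree e) acc)"
proof -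
  have "t_tmem acc Tip (pair_tree e) \<noteq> Tip \<longleftrightarrow> pair_tree e \<in> set (list_of acc)"
  proof -
    have "t_tmem acc Tip (pair_tree e) \<noteq> Tip \<longleftrightarrow> (\<exists>f\<in>B. fst f = fst e \<and> snd f = snd e)"
      using assms unfolding t_tmem_iff table_def by (simp add: pair_tree_def)
    also have "\<dots> \<longleftrightarrow> e \<in> B" by (metis prod_eq_iff)
    also have "\<dots> \<longleftrightarrow> pair_tree e \<in> set (list_of acc)"
      using assms by (auto simp: table_def)
    finally show ?thesis .
  qed
  then show ?thesis using assms unfolding table_def by auto
qed

lemma table_union:
  assumes "set (list_of T) = pair_tree ` A" "table B acc"
  shows "table (A \<union> B) (t_union T acc)"
  using assms unfolding t_union_def
proof (induction "list_of T" arbitrary: T A B acc)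
  case Nil
  then have "T = Tip" by (metis list_of_eq_Nil)
  then show ?case using Nil.prems by simp
next
  case (Cons z zs)
  obtain b where b: "T = Pair z b" "zs = list_of b" using Cons.hyps(2) by (cases T) auto
  obtain e where e: "e \<in> A" "z = pair_tree e" using Cons.prems(1) Cons.hyps(2)
    by (metis imageE list.set_intros(1))
  obtain A' where A': "A = insert e A'" "set (list_of b) = pair_tree ` A'"
  proof (rule that)
    \<comment> \<open>\<open>e\<close> may occur again in the tail, so \<open>A'\<close> is read off
      from the tail instead of being \<open>A - {e}\<close>.\<close>
    let ?A = "{f \<in> A. pair_tree f \<in> set (list_of b)}"
    have "set (list_of b) \<subseteq> pair_tree ` A" using Cons.prems(1) b by auto
    then show "set (list_of b) = pair_tree ` ?A" by auto
    have "f = e \<or> pair_tree f \<in> set (list_of b)" if "f \<in> A" for f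
    proof -
      have "pair_tree f \<in> insert (pair_tree e) (set (list_of b))" using that Cons.prems(1) b e by auto
      then show ?thesis using pair_tree_inject by auto
    qed
    then show "A = insert e ?A" using e by blast
  qed
  have "table (A' \<union> insert e B) (fold (\<lambda>z a. if t_tmem a Tip z \<noteq> Tip then a else Pair z a) (list_of b)
    (if t_tmem acc Tip z \<noteq> Tip then acc else Pair z acc))"
    unfolding e(2) by (rule Cons.hyps(1)[OF b(2) A'(2) table_insert_tree[OF Cons.prems(2)]])
  then show ?case unfolding A'(1) b(1) by simp
qed

lemma table_insert:
  assumes "table B acc"
  shows "table (insert e B) (t_union (Pair (pair_tree e) Tip) acc)"
  using table_union[of "Pair (pair_tree e) Tip" "{e}" B acc] assms by simp

definition pair_add :: "nat \<times> nat \<Rightarrow> nat \<times> nat \<Rightarrow> nat \<times> nat" where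
  "pair_add e f = (fst e + fst f, snd e + snd f)"

lemma fold_table:
  assumes "\<And>x a B. x \<in> set xs \<Longrightarrow> table B a \<Longrightarrow> table (B \<union> g x) (s x a)" "table B acc"
  shows "table (B \<union> (\<Union>x\<in>set xs. g x)) (fold s xs acc)"
  using assms
proof (induction xs arbitrary: B acc)
  case (Cons x xs)
  have "table (B \<union> g x) (s x acc)" using Cons.prems by simp
  then have "table (B \<union> g x \<union> (\<Union>x\<in>set xs. g x)) (fold s xs (s x acc))"
    by (rule Cons.IH[rotated]) (use Cons.prems(1) in auto)
  then show ?case by (simp add: Un_assoc)
qed simp

lemma table_sum:
  assumes "table A T" "table B acc"
  shows "table (B \<union> pair_add e ` A) (t_sum T acc (pair_tree e))"
proof -
  \<comment> \<open>The union is indexed by trees because the fold runs over them; injectivity of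
    \<open>pair_tree\<close> makes each member a singleton.\<close>
  have "table (B \<union> (\<Union>x\<in>set (list_of T). {pair_add e f |f. pair_tree f = x})) (t_sum T acc (pair_tree e))"
    unfolding t_sum_def
  proof (rule fold_table[OF _ assms(2)])
    fix z a B assume "z \<in> set (list_of T)" and B: "table B a"
    then obtain f where f: "z = pair_tree f" using assms(1) by (auto simp: table_def)
    have *: "Pair (t_add (left (pair_tree e)) (left z)) (t_add (right (pair_tree e)) (right z)) = pair_tree (pair_add e f)"
      unfolding f by (simp add: pair_tree_def pair_add_def unary_add)
    have "{pair_add e f' |f'. pair_tree f' = z} = {pair_add e f}" unfolding f pair_tree_inject by blast
    then show "table (B \<union> {pair_add e f |f. pair_tree f = z}) (t_union (Pair (Pair (t_add (left (pair_tree e)) (left z))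
      (t_add (right (pair_tree e)) (right z))) Tip) a)"
      unfolding * using table_insert[OF B] by simp
  qed
  moreover have "(\<Union>x\<in>set (list_of T). {pair_add e f |f. pair_tree f = x}) = pair_add e ` A"
    using assms(1) pair_tree_inject by (auto simp: table_def)
  ultimately show ?thesis by simp
qed

text \<open>The Minkowski sum, which describes independent choices in disjoint blocks.\<close>

definition sumset :: "(nat \<times> nat) set \<Rightarrow> (nat \<times> nat) set \<Rightarrow> (nat \<times> nat) set" where
  "sumset A B = {pair_add e f |e f. e \<in> A \<and> f \<in> B}"

lemma table_prod:
  assumes "table A T" "table B T'"
  shows "table (sumset A B) (t_prod T Tip T')"
proof -
  have "table ({} \<union> (\<Union>x\<in>set (list_of T). {pair_add e f |e f. pair_tree e = x \<and> f \<in> B})) (t_prod T Tip T')"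
    unfolding t_prod_def
  proof (rule fold_table[OF _ table_empty])
    fix z a B' assume "z \<in> set (list_of T)" and B': "table B' a"
    then obtain e where e: "z = pair_tree e" using assms(1) by (auto simp: table_def)
    have "{pair_add e f |e f. pair_tree e = z \<and> f \<in> B} = pair_add e ` B" unfolding e pair_tree_inject by blast
    then show "table (B' \<union> {pair_add e f |e f. pair_tree e = z \<and> f \<in> B}) (t_sum T' a z)"
      using table_sum[OF assms(2) B'] e by simp
  qed
  moreover have "(\<Union>x\<in>set (list_of T). {pair_add e f |e f. pair_tree e = x \<and> f \<in> B}) = sumset A B"
    using assms(1) unfolding table_def sumset_def by (simp del: split_paired_Ex) blast
  ultimately show ?thesis by simp
qed

definition restrict_pairs :: "(nat \<times> nat) set \<Rightarrow> bool \<Rightarrow> bool \<Rightarrow> (nat \<times> nat) set" where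
  "restrict_pairs A m d = (\<lambda>e. (fst e, if d then 0 else snd e)) ` {e \<in> A. m = (fst e \<noteq> 0)}"

lemma table_opt:
  assumes "table A T"
  shows "table (restrict_pairs A (m \<noteq> Tip) (d \<noteq> Tip)) (t_opt T Tip m d)"
proof -
  let ?g = "\<lambda>e. (fst e, if d \<noteq> Tip then 0 else snd e)"
  have "table ({} \<union> (\<Union>x\<in>set (list_of T). {?g e |e. pair_tree e = x \<and> (m \<noteq> Tip) = (fst e \<noteq> 0)})) (t_opt T Tip m d)"
    unfolding t_opt_def
  proof (rule fold_table[OF _ table_empty])
    fix z a B assume "z \<in> set (list_of T)" and B: "table B a"
    then obtain e where e: "z = pair_tree e" using assms(1) by (auto simp: table_def)
    have c: "(m \<noteq> Tip) = (left z \<noteq> Tip) \<longleftrightarrow> (m \<noteq> Tip) = (fst e \<noteq> 0)"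
      unfolding e pair_tree_def by simp
    have *: "Pair (left z) (if d \<noteq> Tip then Tip else right z) = pair_tree (?g e)"
      unfolding e pair_tree_def by simp
    have S: "{?g f |f. pair_tree f = z \<and> (m \<noteq> Tip) = (fst f \<noteq> 0)} = (if (m \<noteq> Tip) = (fst e \<noteq> 0) then {?g e} else {})"
      unfolding e pair_tree_inject by (cases e) auto
    show "table (B \<union> {?g f |f. pair_tree f = z \<and> (m \<noteq> Tip) = (fst f \<noteq> 0)})
      (if (m \<noteq> Tip) = (left z \<noteq> Tip) then t_union (Pair (Pair (left z) (if d \<noteq> Tip then Tip else right z)) Tip) a else a)"
      unfolding S c *
    proof (cases "(m \<noteq> Tip) = (fst e \<noteq> 0)")
      case True
      show "table (B \<union> (if (m \<noteq> Tip) = (fst e \<noteq> 0) then {?g e} else {}))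
        (if (m \<noteq> Tip) = (fst e \<noteq> 0) then t_union (Pair (pair_tree (?g e)) Tip) a else a)"
        unfolding if_P[OF True] using table_insert[OF B, of "?g e"] by (simp only: Un_insert_right Un_empty_right)
    next
      case False
      show "table (B \<union> (if (m \<noteq> Tip) = (fst e \<noteq> 0) then {?g e} else {}))
        (if (m \<noteq> Tip) = (fst e \<noteq> 0) then t_union (Pair (pair_tree (?g e)) Tip) a else a)"
        unfolding if_not_P[OF False] using B by (simp only: Un_empty_right)
    qed
  qed
  moreover have "(\<Union>x\<in>set (list_of T). {?g e |e. pair_tree e = x \<and> (m \<noteq> Tip) = (fst e \<noteq> 0)})
      = restrict_pairs A (m \<noteq> Tip) (d \<noteq> Tip)"
  proof -
    have *: "(\<Union>x\<in>pair_tree ` A. {g e |e. pair_tree e = x \<and> p e}) = g ` {e \<in> A. p e}"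
      for g :: "nat \<times> nat \<Rightarrow> nat \<times> nat" and p
      by (simp del: split_paired_Ex) blast
    have "set (list_of T) = pair_tree ` A" using assms by (simp add: table_def)
    then show ?thesis unfolding restrict_pairs_def by (simp only: *)
  qed
  ultimately show ?thesis by simp
qed

text \<open>There are \<open>N + 1\<close> values for each component of an entry; an entry has size
  at most \<open>2 * N + 1\<close>, and its list cell adds 1.\<close>

definition "table_bound N = (N + 1) * (N + 1) * (2 * N + (2::nat))"

lemma size_table:
  assumes "table A T" "A \<subseteq> {..N} \<times> {..N}"
  shows "size T \<le> table_bound N"
proof -
  have "size t = (\<Sum>x\<leftarrow>list_of t. size x + 1)" for t by (induction t) auto
  from this[of T] have "size T = (\<Sum>x\<in>set (list_of T). size x + 1)"
    using assms(1) by (simp only: table_def sum_list_distinct_conv_sum_set)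
  also have "\<dots> \<le> (\<Sum>x\<in>set (list_of T). 2 * N + 2)"
    using assms by (intro sum_mono) (force simp: table_def pair_tree_def)
  also have "\<dots> = card (pair_tree ` A) * (2 * N + 2)" using assms(1) by (simp add: table_def)
  also have "\<dots> \<le> (N + 1) * (N + 1) * (2 * N + 2)"
  proof -
    have "card A \<le> card ({..N} \<times> {..N})" by (rule card_mono) (use assms(2) in auto)
    then have "card (pair_tree ` A) \<le> (N + 1) * (N + 1)"
      using card_image_le[of A pair_tree] finite_subset[OF assms(2)] by (simp add: card_cartesian_product)
    then show ?thesis by (rule mult_right_mono) simp
  qed
  finally show ?thesis unfolding table_bound_def .
qed

text \<open>The Minkowski sum of the whole family \<open>Q\<close> over \<open>Y\<close>.\<close>

definition choice_sums :: "('i \<Rightarrow> (nat \<times> nat) set) \<Rightarrow> 'i set \<Rightarrow> (nat \<times> nat) set" where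
  "choice_sums Q Y = {(\<Sum>y\<in>Y. fst (f y), \<Sum>y\<in>Y. snd (f y)) |f. \<forall>y\<in>Y. f y \<in> Q y}"

lemma fold_sumset:
  assumes "distinct ys"
  shows "fold (\<lambda>y. sumset (Q y)) ys B = sumset (choice_sums Q (set ys)) B"
  using assms
proof (induction ys arbitrary: B)
  case Nil
  show ?case by (auto simp: sumset_def choice_sums_def pair_add_def)
next
  case (Cons y ys)
  have "sumset (choice_sums Q (set ys)) (sumset (Q y) B) = sumset (choice_sums Q (set (y # ys))) B" (is "?L = ?R")
  proof (intro equalityI subsetI)
    fix p assume "p \<in> ?L"
    then obtain f e b where *: "\<forall>y\<in>set ys. f y \<in> Q y" "e \<in> Q y" "b \<in> B"
      "p = pair_add (\<Sum>y\<in>set ys. fst (f y), \<Sum>y\<in>set ys. snd (f y)) (pair_add e b)"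
      unfolding sumset_def choice_sums_def by blast
    let ?f = "f(y := e)"
    have eq: "(\<Sum>z\<in>set ys. g (?f z)) = (\<Sum>z\<in>set ys. g (f z))" for g :: "nat \<times> nat \<Rightarrow> nat"
      using Cons.prems by (intro sum.cong) auto
    have "p = pair_add (\<Sum>y\<in>set (y # ys). fst (?f y), \<Sum>y\<in>set (y # ys). snd (?f y)) b"
      using Cons.prems *(4) eq[of fst] eq[of snd] by (simp add: pair_add_def)
    moreover have "\<forall>y\<in>set (y # ys). ?f y \<in> Q y" using * by auto
    ultimately show "p \<in> ?R" using *(3) unfolding sumset_def choice_sums_def by blast
  next
    fix p assume "p \<in> ?R"
    then obtain f b where *: "\<forall>y\<in>set (y # ys). f y \<in> Q y" "b \<in> B"
      "p = pair_add (\<Sum>y\<in>set (y # ys). fst (f y), \<Sum>y\<in>set (y # ys). snd (f y)) b"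
      unfolding sumset_def choice_sums_def by blast
    have "p = pair_add (\<Sum>y\<in>set ys. fst (f y), \<Sum>y\<in>set ys. snd (f y)) (pair_add (f y) b)"
      using Cons.prems *(3) by (simp add: pair_add_def)
    moreover have "\<forall>y\<in>set ys. f y \<in> Q y" "f y \<in> Q y" using *(1) by auto
    ultimately show "p \<in> ?L" using *(2) unfolding sumset_def choice_sums_def by blast
  qed
  then show ?case using Cons by simp
qed

lemma sumset_zero [simp]: "sumset A {(0, 0)} = A"
  unfolding sumset_def pair_add_def by auto

lemma table_comb:
  assumes "\<forall>y\<in>set (list_of ys). table (A y) (tab y)" "table B acc"
  shows "table (fold (\<lambda>y. sumset (restrict_pairs (A y) (t_mem I Tip y \<noteq> Tip) (t_dom I Tip y \<noteq> Tip)))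
    (list_of ys) B) (t_comb ys acc I)"
  using assms unfolding t_comb_def
proof (induction ys arbitrary: B acc)
  case (Pair a b)
  have "table (sumset (restrict_pairs (A a) (t_mem I Tip a \<noteq> Tip) (t_dom I Tip a \<noteq> Tip)) B)
      (t_prod (t_opt (tab a) Tip (t_mem I Tip a) (t_dom I Tip a)) Tip acc)"
    by (rule table_prod[OF table_opt]) (use Pair.prems in auto)
  from Pair.IH(2)[OF _ this] show ?case using Pair.prems(1) by simp
qed simp

text \<open>The pairs obtained for one guess \<open>J\<close>. Membership in \<open>J\<close> is
  expressed through indices because \<open>t_mem\<close> compares indices.\<close>

definition merged :: "(tree \<Rightarrow> (nat \<times> nat) set) \<Rightarrow> tree set \<Rightarrow> tree set \<Rightarrow> (nat \<times> nat) set" where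
  "merged A Y J = choice_sums (\<lambda>y. restrict_pairs (A y) (vid y \<in> vid ` J) (\<exists>z\<in>J. t_adj y z)) Y"

lemma table_comb_merged:
  assumes "\<forall>y\<in>set (list_of Y). table (A y) (tab y)" "distinct (list_of Y)"
  shows "table (merged A (set (list_of Y)) (set (list_of I))) (t_comb Y (Pair (Pair Tip Tip) Tip) I)"
proof -
  have "table {(0, 0)} (Pair (Pair Tip Tip) Tip)"
    using table_single[of "(0, 0)"] by (simp add: pair_tree_def)
  from table_comb[OF assms(1) this, of I] show ?thesis
    unfolding merged_def by (simp add: fold_sumset[OF assms(2)] t_mem_iff t_dom_iff)
qed

text \<open>\<open>I\<close> holds the vertices already guessed to be met and \<open>J\<close>
  ranges over the open guesses inside \<open>rem\<close>. At a leaf nothing is open and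
  \<open>I\<close> is the complete guess.\<close>

lemma table_go:
  assumes "\<forall>y\<in>set (list_of Y). table (A y) (tab y)" "distinct (list_of Y)"
  shows "table (\<Union>J\<in>Pow (set (list_of rem)). merged A (set (list_of Y)) (J \<union> set (list_of I))) (t_go rem I Y)"
proof (induction rem arbitrary: I)
  case Tip
  then show ?case using table_comb_merged[OF assms] by simp
next
  case (Pair a b)
  let ?M = "merged A (set (list_of Y))"
  have eq: "(\<Union>J\<in>Pow (set (list_of (Pair a b))). ?M (J \<union> set (list_of I))) =
    (\<Union>J\<in>Pow (set (list_of b)). ?M (J \<union> set (list_of (Pair a I)))) \<union>
    (\<Union>J\<in>Pow (set (list_of b)). ?M (J \<union> set (list_of I)))"
    by (auto simp: Pow_insert)
  show ?case
    unfolding eq t_go.simps by (rule table_union[OF _ Pair.IH(2)]) (use Pair.IH(2)[of "Pair a I"] in \<open>simp add: table_def\<close>)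
qed

section \<open>Partial domination in a union of modules\<close>

text \<open>\<open>W\<close> restricts the vertices to be dominated but not \<open>D\<close>, so
  domination from outside the block counts.\<close>

definition undom :: "'a rb_graph \<Rightarrow> 'a set \<Rightarrow> 'a set \<Rightarrow> 'a set" where
  "undom G W D = {v \<in> blue G \<inter> W. closed_nbhd G v \<inter> D = {}}"

definition achievable :: "'a rb_graph \<Rightarrow> 'a set \<Rightarrow> (nat \<times> nat) set" where
  "achievable G W = {(card D, card (undom G W D)) |D. D \<subseteq> red G \<inter> W}"

locale module_partition =
  fixes G :: "'a rb_graph" and Y :: "'i set" and W :: "'i \<Rightarrow> 'a set" and adj :: "'i \<Rightarrow> 'i \<Rightarrow> bool"
  assumes fin: "finite Y" "\<And>y. y \<in> Y \<Longrightarrow> finite (W y)"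
    and sub: "\<And>y. y \<in> Y \<Longrightarrow> W y \<subseteq> verts G"
    and disj: "\<And>y z. \<lbrakk>y \<in> Y; z \<in> Y; y \<noteq> z\<rbrakk> \<Longrightarrow> W y \<inter> W z = {}"
    and edge: "\<And>y z u v. \<lbrakk>y \<in> Y; z \<in> Y; y \<noteq> z; u \<in> W y; v \<in> W z\<rbrakk> \<Longrightarrow> {u, v} \<in> edges G \<longleftrightarrow> adj y z"
    and irrefl: "\<And>y. y \<in> Y \<Longrightarrow> \<not> adj y y"
begin

text \<open>A vertex of \<open>D\<close> in an adjacent block is a neighbour of all of
  \<open>W y\<close>, one in any other foreign block is a neighbour of none of it. Hence only two
  things matter: whether some adjacent block is met, and the part of \<open>D\<close> inside
  \<open>W y\<close>.\<close>

lemma undom_block: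
  assumes D: "D \<subseteq> (\<Union>z\<in>Y. W z)" and y: "y \<in> Y"
  shows "undom G (W y) D = (if \<exists>z\<in>Y. D \<inter> W z \<noteq> {} \<and> adj y z then {} else undom G (W y) (D \<inter> W y))"
proof -
  have *: "closed_nbhd G v \<inter> D \<noteq> {} \<longleftrightarrow>
      (\<exists>z\<in>Y. D \<inter> W z \<noteq> {} \<and> adj y z) \<or> closed_nbhd G v \<inter> (D \<inter> W y) \<noteq> {}" if v: "v \<in> W y" for v
  proof
    assume "closed_nbhd G v \<inter> D \<noteq> {}"
    then obtain d where d: "d \<in> closed_nbhd G v" "d \<in> D" by blast
    then obtain z where z: "z \<in> Y" "d \<in> W z" using D by blast
    show "(\<exists>z\<in>Y. D \<inter> W z \<noteq> {} \<and> adj y z) \<or> closed_nbhd G v \<inter> (D \<inter> W y) \<noteq> {}"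
    proof (cases "z = y")
      case False
      then have "d \<noteq> v" using disj[OF z(1) y False] z(2) v by blast
      then have "{v, d} \<in> edges G" using d(1) by (auto simp: closed_nbhd_def insert_commute)
      then have "adj y z" using edge[OF y z(1) _ v z(2)] False by simp
      then show ?thesis using z d by blast
    qed (use z d in blast)
  next
    assume "(\<exists>z\<in>Y. D \<inter> W z \<noteq> {} \<and> adj y z) \<or> closed_nbhd G v \<inter> (D \<inter> W y) \<noteq> {}"
    then show "closed_nbhd G v \<inter> D \<noteq> {}"
    proof
      assume "\<exists>z\<in>Y. D \<inter> W z \<noteq> {} \<and> adj y z"
      then obtain z d where z: "z \<in> Y" "d \<in> D" "d \<in> W z" "adj y z" by blast
      then have "y \<noteq> z" using irrefl y by blast
      then have "{v, d} \<in> edges G" using edge[OF y z(1) _ v z(3)] z(4) by simp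
      then have "d \<in> closed_nbhd G v" using sub[OF z(1)] z(3) by (auto simp: closed_nbhd_def insert_commute)
      then show ?thesis using z(2) by blast
    qed blast
  qed
  show ?thesis
  proof (cases "\<exists>z\<in>Y. D \<inter> W z \<noteq> {} \<and> adj y z")
    case True
    then show ?thesis using * unfolding undom_def by auto
  next
    case False
    then have "closed_nbhd G v \<inter> D = {} \<longleftrightarrow> closed_nbhd G v \<inter> (D \<inter> W y) = {}" if "v \<in> W y" for v
      using *[OF that] by blast
    then show ?thesis using False unfolding undom_def by auto
  qed
qed

lemma card_union_blocks:
  assumes "\<And>y. y \<in> Y \<Longrightarrow> D y \<subseteq> W y"
  shows "card (\<Union>y\<in>Y. D y) = (\<Sum>y\<in>Y. card (D y))"
proof (rule card_UN_disjoint[OF fin(1)])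
  show "\<forall>y\<in>Y. finite (D y)" using assms fin(2) finite_subset by blast
  show "\<forall>y\<in>Y. \<forall>z\<in>Y. y \<noteq> z \<longrightarrow> D y \<inter> D z = {}"
  proof (intro ballI impI)
    fix y z assume "y \<in> Y" "z \<in> Y" "y \<noteq> z"
    then show "D y \<inter> D z = {}" using disj[of y z] assms[of y] assms[of z] by blast
  qed
qed

lemma card_undom_union: "card (undom G (\<Union>y\<in>Y. W y) D) = (\<Sum>y\<in>Y. card (undom G (W y) D))"
proof -
  have "undom G (\<Union>y\<in>Y. W y) D = (\<Union>y\<in>Y. undom G (W y) D)" unfolding undom_def by blast
  moreover have "undom G (W y) D \<subseteq> W y" for y by (auto simp: undom_def)
  ultimately show ?thesis using card_union_blocks[of "\<lambda>y. undom G (W y) D"] by simp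
qed

text \<open>\<open>D\<close> corresponds to the set \<open>J\<close> of blocks that it meets
  together with its parts in the blocks. \<open>J\<close> must be exact: a guessed block has to
  contain a vertex that dominates the neighbouring blocks, and a block that was not guessed must not
  contain an uncounted dominator.\<close>

lemma achievable_union:
  "achievable G (\<Union>y\<in>Y. W y) =
    (\<Union>J\<in>Pow Y. choice_sums (\<lambda>y. restrict_pairs (achievable G (W y)) (y \<in> J) (\<exists>z\<in>J. adj y z)) Y)"
    (is "?L = ?R")
proof (intro equalityI subsetI)
  fix p assume "p \<in> ?L"
  then obtain D where D: "D \<subseteq> red G \<inter> (\<Union>y\<in>Y. W y)"
    "p = (card D, card (undom G (\<Union>y\<in>Y. W y) D))" unfolding achievable_def by blast
  define J where "J = {y \<in> Y. D \<inter> W y \<noteq> {}}"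
  define f where "f y = (card (D \<inter> W y), card (undom G (W y) D))" for y
  have DU: "D = (\<Union>y\<in>Y. D \<inter> W y)" using D(1) by blast
  have "card D = (\<Sum>y\<in>Y. card (D \<inter> W y))"
    using card_union_blocks[of "\<lambda>y. D \<inter> W y"] DU by simp
  then have p: "p = (\<Sum>y\<in>Y. fst (f y), \<Sum>y\<in>Y. snd (f y))"
    using D(2) card_undom_union[of D] by (simp add: f_def)
  have "f y \<in> restrict_pairs (achievable G (W y)) (y \<in> J) (\<exists>z\<in>J. adj y z)" if y: "y \<in> Y" for y
    unfolding restrict_pairs_def
  proof (rule image_eqI)
    let ?e = "(card (D \<inter> W y), card (undom G (W y) (D \<inter> W y)))"
    \<comment> \<open>By finiteness a part is nonempty iff its cardinality is nonzero, so the table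
      entry shows whether the block is met.\<close>
    have "(y \<in> J) = (fst ?e \<noteq> 0)" using y fin(2)[OF y] by (simp add: J_def)
    moreover have "?e \<in> achievable G (W y)" using D(1) unfolding achievable_def by blast
    ultimately show "?e \<in> {e \<in> achievable G (W y). (y \<in> J) = (fst e \<noteq> 0)}" by blast
    have "(\<exists>z\<in>J. adj y z) \<longleftrightarrow> (\<exists>z\<in>Y. D \<inter> W z \<noteq> {} \<and> adj y z)" unfolding J_def by blast
    then have "undom G (W y) D = (if \<exists>z\<in>J. adj y z then {} else undom G (W y) (D \<inter> W y))"
      using undom_block[of D y] D(1) y by (simp only:) simp
    then show "f y = (fst ?e, if \<exists>z\<in>J. adj y z then 0 else snd ?e)"
      by (simp add: f_def)
  qed
  then have "p \<in> choice_sums (\<lambda>y. restrict_pairs (achievable G (W y)) (y \<in> J) (\<exists>z\<in>J. adj y z)) Y"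
    unfolding choice_sums_def p by blast
  moreover have "J \<in> Pow Y" by (auto simp: J_def)
  ultimately show "p \<in> ?R" by blast
next
  fix p assume "p \<in> ?R"
  then obtain J f where J: "J \<subseteq> Y" and p: "p = (\<Sum>y\<in>Y. fst (f y), \<Sum>y\<in>Y. snd (f y))"
    and f: "\<forall>y\<in>Y. f y \<in> restrict_pairs (achievable G (W y)) (y \<in> J) (\<exists>z\<in>J. adj y z)"
    unfolding choice_sums_def by blast
  have "\<forall>y\<in>Y. \<exists>D. D \<subseteq> red G \<inter> W y \<and> (y \<in> J) = (card D \<noteq> 0) \<and>
      f y = (card D, if \<exists>z\<in>J. adj y z then 0 else card (undom G (W y) D))"
  proof
    fix y assume "y \<in> Y"
    then obtain e where e: "e \<in> achievable G (W y)" "(y \<in> J) = (fst e \<noteq> 0)"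
      "f y = (fst e, if \<exists>z\<in>J. adj y z then 0 else snd e)"
      using f unfolding restrict_pairs_def by blast
    then obtain D where "D \<subseteq> red G \<inter> W y" "e = (card D, card (undom G (W y) D))"
      unfolding achievable_def by blast
    then have "D \<subseteq> red G \<inter> W y \<and> (y \<in> J) = (card D \<noteq> 0) \<and>
      f y = (card D, if \<exists>z\<in>J. adj y z then 0 else card (undom G (W y) D))"
      using e(2,3) by (simp only: fst_conv snd_conv)
    then show "\<exists>D. D \<subseteq> red G \<inter> W y \<and> (y \<in> J) = (card D \<noteq> 0) \<and>
      f y = (card D, if \<exists>z\<in>J. adj y z then 0 else card (undom G (W y) D))" by blast
  qed
  from bchoice[OF this] obtain Ds where
    "\<forall>y\<in>Y. Ds y \<subseteq> red G \<inter> W y \<and> (y \<in> J) = (card (Ds y) \<noteq> 0) \<and>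
      f y = (card (Ds y), if \<exists>z\<in>J. adj y z then 0 else card (undom G (W y) (Ds y)))" by blast
  then have Ds: "\<And>y. y \<in> Y \<Longrightarrow> Ds y \<subseteq> red G \<inter> W y"
    "\<And>y. y \<in> Y \<Longrightarrow> (y \<in> J) = (card (Ds y) \<noteq> 0)"
    "\<And>y. y \<in> Y \<Longrightarrow> f y = (card (Ds y), if \<exists>z\<in>J. adj y z then 0 else card (undom G (W y) (Ds y)))"
    by blast+
  define D where "D = (\<Union>y\<in>Y. Ds y)"
  have DW: "D \<inter> W y = Ds y" if y: "y \<in> Y" for y
  proof -
    have "Ds z \<inter> W y = {}" if "z \<in> Y" "z \<noteq> y" for z
      using Ds(1)[OF that(1)] disj[OF that(1) y that(2)] by blast
    then show ?thesis using Ds(1)[OF y] y unfolding D_def by blast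
  qed
  have sub: "D \<subseteq> red G \<inter> (\<Union>y\<in>Y. W y)" using Ds(1) unfolding D_def by blast
  have "card D = (\<Sum>y\<in>Y. fst (f y))"
    unfolding D_def using card_union_blocks[of Ds] Ds(1,3) by simp
  moreover have "card (undom G (W y) D) = snd (f y)" if y: "y \<in> Y" for y
  proof -
    have "D \<inter> W z \<noteq> {} \<longleftrightarrow> z \<in> J" if "z \<in> Y" for z
    proof -
      have "finite (Ds z)" using Ds(1)[OF that] fin(2)[OF that] finite_subset by blast
      then show ?thesis using Ds(2)[OF that] DW[OF that] by simp
    qed
    then have "(\<exists>z\<in>J. adj y z) \<longleftrightarrow> (\<exists>z\<in>Y. D \<inter> W z \<noteq> {} \<and> adj y z)" using J by blast
    then have "undom G (W y) D = (if \<exists>z\<in>J. adj y z then {} else undom G (W y) (Ds y))"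
      using undom_block[of D y] sub y DW[OF y] by (simp only:) simp
    then show ?thesis using Ds(3)[OF y] by simp
  qed
  then have "card (undom G (\<Union>y\<in>Y. W y) D) = (\<Sum>y\<in>Y. snd (f y))"
    using card_undom_union[of D] by simp
  ultimately have "p = (card D, card (undom G (\<Union>y\<in>Y. W y) D))" using p by simp
  then show "p \<in> ?L" using sub unfolding achievable_def by blast
qed

end

lemma achievable_bounds:
  assumes "finite W" "card W \<le> n"
  shows "achievable G W \<subseteq> {..n} \<times> {..n}"
proof -
  have "card D \<le> n" if "D \<subseteq> W" for D using card_mono[OF assms(1) that] assms(2) by simp
  moreover have "undom G W D \<subseteq> W" for D by (auto simp: undom_def)
  ultimately show ?thesis unfolding achievable_def by auto
qed

text \<open>A chosen vertex dominates itself, hence the 0 in the pair for the red case.\<close>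

lemma achievable_single:
  "achievable G {v} = insert (0, of_bool (v \<in> blue G)) (if v \<in> red G then {(1, 0)} else {})"
proof -
  have sub: "D \<subseteq> red G \<inter> {v} \<longleftrightarrow> D = {} \<or> v \<in> red G \<and> D = {v}" for D by auto
  have u: "undom G {v} {} = (if v \<in> blue G then {v} else {})" "undom G {v} {v} = {}"
    by (auto simp: undom_def closed_nbhd_def)
  have "achievable G {v} = {(card D, card (undom G {v} D)) |D. D = {} \<or> v \<in> red G \<and> D = {v}}"
    unfolding achievable_def sub ..
  also have "\<dots> = insert (0, card (undom G {v} {})) (if v \<in> red G then {(1, card (undom G {v} {v}))} else {})"
  proof -
    have "{g D |D. D = {} \<or> v \<in> red G \<and> D = {v}} = insert (g {}) (if v \<in> red G then {g {v}} else {})"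
      for g :: "'a set \<Rightarrow> nat \<times> nat" by auto
    from this[of "\<lambda>D. (card D, card (undom G {v} D))"] show ?thesis by simp
  qed
  finally show ?thesis unfolding u by simp
qed

section \<open>Smallest modules\<close>

text \<open>Comparing with the fixed element \<open>left Y\<close> is enough: a vertex that
  distinguishes two elements of \<open>Y\<close> distinguishes one of them from
  \<open>left Y\<close>. Injectivity of \<open>vid\<close> turns the test on indices into
  membership.\<close>

lemma set_grow:
  assumes "inj_on vid (set (list_of X))" "set (list_of Y) \<subseteq> set (list_of X)" "Y \<noteq> Tip"
  shows "set (list_of (t_grow X Tip Y)) = add_splitters t_adj (set (list_of X)) (set (list_of Y))"
proof -
  have h: "left Y \<in> set (list_of Y)" using assms(3) by (cases Y) auto
  have m: "t_mem Y Tip x \<noteq> Tip \<longleftrightarrow> x \<in> set (list_of Y)" if "x \<in> set (list_of X)" for x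
    unfolding t_mem_iff using inj_on_image_mem_iff[OF assms(1) that assms(2)] .
  have s: "t_split Y Tip x (left Y) \<noteq> Tip \<longleftrightarrow>
      (\<exists>a\<in>set (list_of Y). \<exists>b\<in>set (list_of Y). t_adj x a \<noteq> t_adj x b)" for x
    unfolding t_split_iff using h by metis
  show ?thesis
    unfolding list_of_grow add_splitters_def s using m by auto
qed

lemma set_closure:
  assumes "inj_on vid (set (list_of X))" "set (list_of Y) \<subseteq> set (list_of X)" "Y \<noteq> Tip"
  shows "set (list_of (t_closure fuel Y X)) =
    (add_splitters t_adj (set (list_of X)) ^^ len fuel) (set (list_of Y))"
  using assms(2,3) unfolding t_closure_def
proof (induction fuel arbitrary: Y)
  case (Pair a b)
  let ?Y = "t_grow X Tip Y"
  have s: "set (list_of ?Y) = add_splitters t_adj (set (list_of X)) (set (list_of Y))"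
    using set_grow[OF assms(1) Pair.prems] .
  have "set (list_of Y) \<subseteq> set (list_of ?Y)" using Pair.prems(1) unfolding s by (auto simp: add_splitters_def)
  then have "?Y \<noteq> Tip" using Pair.prems(2) by (cases Y) auto
  then have "set (list_of (fold (\<lambda>_. t_grow X Tip) (list_of b) ?Y)) =
      (add_splitters t_adj (set (list_of X)) ^^ len b) (set (list_of ?Y))"
    using Pair.IH(2) add_splitters_subset s by metis
  then show ?case using s by (simp add: funpow_swap1)
qed simp

text \<open>The starting list may be \<open>u\<close>, \<open>u\<close>; a single round, hence
  \<open>fuel \<noteq> Tip\<close>, already replaces it by a selection from the duplicate-free
  \<open>X\<close>.\<close>

lemma distinct_closure:
  assumes "distinct (list_of X)" "fuel \<noteq> Tip"
  shows "distinct (list_of (t_closure fuel Y X))"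
proof -
  have "distinct (list_of (fold (\<lambda>_. t_grow X Tip) fs Z))" if "distinct (list_of Z)" for fs Z
    using that
  proof (induction fs arbitrary: Z)
    case (Cons f fs)
    have "distinct (list_of (t_grow X Tip Z))" unfolding list_of_grow using assms(1) by simp
    then show ?case using Cons.IH by simp
  qed simp
  moreover have "distinct (list_of (t_grow X Tip Y))" unfolding list_of_grow using assms(1) by simp
  ultimately show ?thesis using assms(2) by (cases fuel) (auto simp: t_closure_def)
qed

text \<open>Minimum search over the candidates \<open>c v\<close> with at least two elements.
  \<open>P\<close> stays abstract so that being a module can be carried along.\<close>

lemma fold_smaller:
  assumes "P acc" "\<And>v. v \<in> set vs \<Longrightarrow> 2 \<le> len (c v) \<Longrightarrow> P (c v)"
  shows "P (fold (\<lambda>v a. t_smaller (c v) a) vs acc) \<and> len (fold (\<lambda>v a. t_smaller (c v) a) vs acc) \<le> len acc \<and>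
    (\<forall>v\<in>set vs. 2 \<le> len (c v) \<longrightarrow> len (fold (\<lambda>v a. t_smaller (c v) a) vs acc) \<le> len (c v))"
  using assms
proof (induction vs arbitrary: acc)
  case (Cons v vs)
  let ?a = "t_smaller (c v) acc"
  have a: "P ?a" "len ?a \<le> len acc" "2 \<le> len (c v) \<Longrightarrow> len ?a \<le> len (c v)"
    using Cons.prems unfolding t_smaller_def right_neq_Tip t_le_iff by auto
  then show ?case using Cons.IH[of ?a] Cons.prems(2) by (auto intro: le_trans)
qed simp

text \<open>The search starts with \<open>X\<close>, a module of itself. Any module with two
  elements contains the closure of one of its pairs, and that closure is a candidate with at least
  two elements.\<close>

lemma smallest_module:
  assumes inj: "inj_on vid (set (list_of X))" and X: "distinct (list_of X)" "2 \<le> len X"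
  defines "S \<equiv> set (list_of X)" and "Y \<equiv> t_outer X X X"
  shows "distinct (list_of Y) \<and> is_module t_adj S (set (list_of Y)) \<and> 2 \<le> len Y" (is "?P Y")
    and "\<And>M. is_module t_adj S M \<Longrightarrow> 2 \<le> card M \<Longrightarrow> len Y \<le> card M"
proof -
  let ?c = "\<lambda>u v. t_closure X (Pair u (Pair v Tip)) X"
  have XT: "X \<noteq> Tip" using X(2) by auto
  have card: "card S = len X" unfolding S_def using distinct_card[OF X(1)] .
  have c: "set (list_of (?c u v)) = (add_splitters t_adj S ^^ card S) {u, v}" "distinct (list_of (?c u v))"
    "is_module t_adj S (set (list_of (?c u v)))" if "u \<in> S" "v \<in> S" for u v
  proof -
    show 1: "set (list_of (?c u v)) = (add_splitters t_adj S ^^ card S) {u, v}"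
      using set_closure[OF inj, of "Pair u (Pair v Tip)" X] that card unfolding S_def by simp
    show "distinct (list_of (?c u v))" by (rule distinct_closure[OF X(1) XT])
    show "is_module t_adj S (set (list_of (?c u v)))"
      unfolding 1 by (rule module_add_splitters) (use that in \<open>auto simp: S_def\<close>)
  qed
  have inner: "?P (t_inner X a u X) \<and> len (t_inner X a u X) \<le> len a \<and>
      (\<forall>v\<in>S. 2 \<le> len (?c u v) \<longrightarrow> len (t_inner X a u X) \<le> len (?c u v))" if "u \<in> S" "?P a" for u a
    unfolding t_inner_def S_def by (rule fold_smaller[where P = ?P, unfolded S_def]) (use that c in \<open>auto simp: S_def\<close>)
  have outer: "?P (fold (\<lambda>u a. t_inner X a u X) us a) \<and> len (fold (\<lambda>u a. t_inner X a u X) us a) \<le> len a \<and>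
      (\<forall>u\<in>set us. \<forall>v\<in>S. 2 \<le> len (?c u v) \<longrightarrow> len (fold (\<lambda>u a. t_inner X a u X) us a) \<le> len (?c u v))"
    if "set us \<subseteq> S" "?P a" for us a
    using that
  proof (induction us arbitrary: a)
    case (Cons u us)
    have u: "u \<in> S" using Cons.prems by simp
    note i = inner[OF u Cons.prems(2)]
    have "?P (fold (\<lambda>u a. t_inner X a u X) us (t_inner X a u X)) \<and>
      len (fold (\<lambda>u a. t_inner X a u X) us (t_inner X a u X)) \<le> len (t_inner X a u X) \<and>
      (\<forall>u'\<in>set us. \<forall>v\<in>S. 2 \<le> len (?c u' v) \<longrightarrow>
        len (fold (\<lambda>u a. t_inner X a u X) us (t_inner X a u X)) \<le> len (?c u' v))"
      by (rule Cons.IH) (use Cons.prems i in auto)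
    then show ?case using i le_trans by (simp, blast)
  qed simp
  have PX: "?P X" using X closed_module unfolding S_def by auto
  have opt: "?P Y \<and> (\<forall>u\<in>S. \<forall>v\<in>S. 2 \<le> len (?c u v) \<longrightarrow> len Y \<le> len (?c u v))"
    using outer[of "list_of X" X] PX unfolding Y_def t_outer_def S_def by blast
  then show "?P Y" by blast
  fix M assume M: "is_module t_adj S M" "2 \<le> card M"
  obtain u v where uv: "u \<in> M" "v \<in> M" "u \<noteq> v"
    using M(2) by (metis One_nat_def card_le_Suc0_iff_eq card.infinite not_less_eq_eq numeral_2_eq_2 le0 nat_le_linear Suc_n_not_le_n le_trans)
  then have uvS: "u \<in> S" "v \<in> S" using M(1) by (auto simp: is_module_def)
  have fin: "finite M" using M(1) finite_subset unfolding is_module_def S_def by blast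
  have "set (list_of (?c u v)) \<subseteq> M"
    unfolding c(1)[OF uvS] by (rule add_splitters_module[OF M(1)]) (use uv in auto)
  then have le: "len (?c u v) \<le> card M"
    using card_mono[OF fin, of "set (list_of (?c u v))"] distinct_card[OF c(2)[OF uvS]] by simp
  have "{u, v} \<subseteq> set (list_of (?c u v))"
    unfolding c(1)[OF uvS] by (rule funpow_add_splitters) (use uvS in auto)
  then have "card {u, v} \<le> card (set (list_of (?c u v)))" by (rule card_mono[rotated]) simp
  then have "2 \<le> len (?c u v)"
    using uv(3) distinct_card[OF c(2)[OF uvS]] by simp
  then show "len Y \<le> card M" using opt uvS le le_trans by blast
qed

section \<open>Contracting modules\<close>

text \<open>\<open>W\<close> maps an index to the block that it represents. Rows are original rows
  of length \<open>n\<close> and keep entries for vertices that are no longer current.\<close>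

definition valid_record :: "nat \<Rightarrow> nat rb_graph \<Rightarrow> (nat \<Rightarrow> nat set) \<Rightarrow> tree \<Rightarrow> bool" where
  "valid_record n G W x \<longleftrightarrow> vid x < n \<and> size (idx x) \<le> n \<and>
     list_of (row x) = map (\<lambda>v. enc_bool ({vid x, v} \<in> edges G)) [0..<n] \<and>
     table (achievable G (W (vid x))) (tab x)"

definition apart :: "nat rb_graph \<Rightarrow> (nat \<Rightarrow> nat set) \<Rightarrow> tree \<Rightarrow> tree \<Rightarrow> bool" where
  "apart G W x z \<longleftrightarrow> W (vid x) \<inter> W (vid z) = {} \<and>
     (\<forall>u\<in>W (vid x). \<forall>v\<in>W (vid z). {u, v} \<in> edges G \<longleftrightarrow> {vid x, vid z} \<in> edges G)"

definition valid :: "nat \<Rightarrow> nat rb_graph \<Rightarrow> tree \<Rightarrow> (nat \<Rightarrow> nat set) \<Rightarrow> bool" where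
  "valid n G X W \<longleftrightarrow> distinct (map vid (list_of X)) \<and>
     (\<forall>x\<in>set (list_of X). valid_record n G W x) \<and>
     (\<Union>x\<in>set (list_of X). W (vid x)) = {..<n} \<and>
     (\<forall>x\<in>set (list_of X). \<forall>z\<in>set (list_of X). vid x \<noteq> vid z \<longrightarrow> apart G W x z)"

lemma apart_sym:
  assumes "apart G W x z"
  shows "apart G W z x"
  unfolding apart_def
proof (intro conjI ballI)
  show "W (vid z) \<inter> W (vid x) = {}" using assms unfolding apart_def by blast
  fix u v assume "u \<in> W (vid z)" "v \<in> W (vid x)"
  then have "{v, u} \<in> edges G \<longleftrightarrow> {vid x, vid z} \<in> edges G" using assms unfolding apart_def by blast
  then show "{u, v} \<in> edges G \<longleftrightarrow> {vid z, vid x} \<in> edges G"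
    by (simp only: insert_commute[of u v] insert_commute[of "vid z" "vid x"])
qed

lemma valid_recordD:
  assumes "valid_record n G W x"
  shows "vid x < n" "size (idx x) \<le> n"
    "list_of (row x) = map (\<lambda>v. enc_bool ({vid x, v} \<in> edges G)) [0..<n]"
    "table (achievable G (W (vid x))) (tab x)"
  using assms unfolding valid_record_def by blast+

lemma valid_rec: "valid n G X W \<Longrightarrow> x \<in> set (list_of X) \<Longrightarrow> valid_record n G W x"
  by (simp add: valid_def)

lemma valid_apart:
  "valid n G X W \<Longrightarrow> x \<in> set (list_of X) \<Longrightarrow> z \<in> set (list_of X) \<Longrightarrow> vid x \<noteq> vid z \<Longrightarrow> apart G W x z"
  by (simp add: valid_def)

lemma valid_inj: "valid n G X W \<Longrightarrow> inj_on vid (set (list_of X))"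
  by (simp add: valid_def distinct_map)

lemma valid_distinct: "valid n G X W \<Longrightarrow> distinct (list_of X)"
  by (simp add: valid_def distinct_map)

lemma valid_adj:
  assumes "valid n G X W" "x \<in> set (list_of X)" "z \<in> set (list_of X)"
  shows "t_adj x z \<longleftrightarrow> {vid x, vid z} \<in> edges G"
proof -
  have *: "vid z < n" "list_of (row x) = map (\<lambda>v. enc_bool ({vid x, v} \<in> edges G)) [0..<n]"
    using valid_recordD[OF valid_rec[OF assms(1)]] assms(2,3) by blast+
  then have "vid z < len (row x)" by simp
  from t_adj_nth[OF this] show ?thesis using *(1) unfolding *(2) by simp
qed

text \<open>The blocks of \<open>Y\<close> are united under the index of \<open>h\<close>. The new
  table is correct by \<open>achievable_union\<close>, and adjacency to the outside by the module
  property, which lets \<open>h\<close> speak for all of \<open>Y\<close>.\<close>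

lemma valid_merge:
  assumes G: "is_rb_graph G" "verts G = {..<n}" and v: "valid n G X W"
    and Y: "distinct (list_of Y)" "is_module t_adj (set (list_of X)) (set (list_of Y))" "2 \<le> len Y"
  shows "\<exists>W'. valid n G (t_merge Y X) W'" and "len (t_merge Y X) < len X"
proof -
  define SX SY where "SX = set (list_of X)" and "SY = set (list_of Y)"
  define h where "h = left Y"
  have YT: "Y \<noteq> Tip" using Y(3) by auto
  have YX: "SY \<subseteq> SX" using Y(2) by (simp add: is_module_def SX_def SY_def)
  have h: "h \<in> SY" using YT unfolding h_def SY_def by (cases Y) auto
  have inj: "inj_on vid SX" using valid_inj[OF v] by (simp add: SX_def)
  have X: "valid_record n G W x" if "x \<in> SX" for x
    using valid_rec[OF v] that by (simp add: SX_def)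
  have WU: "(\<Union>x\<in>SX. W (vid x)) = {..<n}" using v unfolding valid_def SX_def by blast
  have WD: "W (vid x) \<inter> W (vid z) = {}" if "x \<in> SX" "z \<in> SX" "x \<noteq> z" for x z
  proof -
    have "vid x \<noteq> vid z" using inj that by (auto simp: inj_on_def)
    then show ?thesis using valid_apart[OF v] that unfolding apart_def SX_def by blast
  qed
  have WE: "{a, b} \<in> edges G \<longleftrightarrow> {vid x, vid z} \<in> edges G"
    if "x \<in> SX" "z \<in> SX" "x \<noteq> z" "a \<in> W (vid x)" "b \<in> W (vid z)" for x z a b
  proof -
    have "vid x \<noteq> vid z" using inj that by (auto simp: inj_on_def)
    then show ?thesis using valid_apart[OF v] that unfolding apart_def SX_def by blast
  qed
  have loop: "{a} \<notin> edges G" for a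
    using G(1) unfolding is_rb_graph_def simple_edges_def by (metis doubleton_eq_iff insert_absorb2)
  interpret module_partition G SY "\<lambda>y. W (vid y)" t_adj
  proof
    show "finite SY" by (simp add: SY_def)
    show V: "W (vid y) \<subseteq> verts G" if "y \<in> SY" for y using WU YX that G(2) by blast
    show "finite (W (vid y))" if "y \<in> SY" for y
      by (rule finite_subset[OF V[OF that]]) (simp add: G(2))
    show "W (vid y) \<inter> W (vid z) = {}" if "y \<in> SY" "z \<in> SY" "y \<noteq> z" for y z using WD YX that by blast
    show "{u, v} \<in> edges G \<longleftrightarrow> t_adj y z"
      if "y \<in> SY" "z \<in> SY" "y \<noteq> z" "u \<in> W (vid y)" "v \<in> W (vid z)" for y z u v
      using WE[of y z u v] valid_adj[OF v, of y z] YX that by (auto simp: SX_def)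
    show "\<not> t_adj y y" if "y \<in> SY" for y
      using valid_adj[OF v, of y y] YX that loop by (auto simp: SX_def)
  qed
  define U where "U = (\<Union>y\<in>SY. W (vid y))"
  have "table (\<Union>J\<in>Pow SY. merged (\<lambda>y. achievable G (W (vid y))) SY (J \<union> set (list_of Tip))) (t_go Y Tip Y)"
    unfolding SY_def
  proof (rule table_go[OF _ Y(1)], intro ballI)
    fix y assume "y \<in> set (list_of Y)"
    then have "y \<in> SX" using YX by (auto simp: SY_def)
    then show "table (achievable G (W (vid y))) (tab y)" by (rule valid_recordD(4)[OF X])
  qed
  \<comment> \<open>On current vertices \<open>vid\<close> is injective, so comparing indices
    amounts to comparing records.\<close>
  moreover have "merged (\<lambda>y. achievable G (W (vid y))) SY (J \<union> set (list_of Tip)) =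
      choice_sums (\<lambda>y. restrict_pairs (achievable G (W (vid y))) (y \<in> J) (\<exists>z\<in>J. t_adj y z)) SY"
    if J: "J \<subseteq> SY" for J
  proof -
    have "vid y \<in> vid ` J \<longleftrightarrow> y \<in> J" if "y \<in> SY" for y
      using inj_on_image_mem_iff[OF inj, of y J] YX that J by blast
    then show ?thesis unfolding merged_def choice_sums_def by simp
  qed
  ultimately have T: "table (achievable G U) (t_go Y Tip Y)"
    unfolding U_def achievable_union by simp
  define new where "new = Pair (idx h) (Pair (row h) (t_go Y Tip Y))"
  have vn: "vid new = vid h" "row new = row h" "tab new = t_go Y Tip Y" by (simp_all add: new_def)
  have "t_mem Y Tip x = Tip \<longleftrightarrow> x \<notin> SY" if "x \<in> SX" for x
    using t_mem_iff[of Y x] inj_on_image_mem_iff[OF inj that YX] by (auto simp: SY_def)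
  then have "filter (\<lambda>x. t_mem Y Tip x = Tip) (list_of X) = filter (\<lambda>x. x \<notin> SY) (list_of X)"
    by (intro filter_cong) (auto simp: SX_def)
  then have L: "list_of (t_merge Y X) = new # rev (filter (\<lambda>x. x \<notin> SY) (list_of X))"
    unfolding t_merge_def by (simp add: list_of_minus new_def h_def)
  then have S: "set (list_of (t_merge Y X)) = insert new (SX - SY)" by (auto simp: SX_def)
  have hX: "h \<in> SX" using h YX by blast
  have vrest: "vid x \<noteq> vid h" if "x \<in> SX - SY" for x using that inj hX h by (auto simp: inj_on_def)
  have "card SY + card (SX - SY) = card SX"
    using YX by (metis SX_def List.finite_set card_Diff_subset card_mono finite_subset le_add_diff_inverse)
  moreover have "card SY = len Y" unfolding SY_def using distinct_card[OF Y(1)] .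
  moreover have "card SX = len X" unfolding SX_def using distinct_card[OF valid_distinct[OF v]] .
  moreover have "length (filter (\<lambda>x. x \<notin> SY) (list_of X)) = card (SX - SY)"
    using distinct_card[of "filter (\<lambda>x. x \<notin> SY) (list_of X)"] valid_distinct[OF v]
    by (simp add: SX_def set_diff_eq)
  ultimately show "len (t_merge Y X) < len X" using Y(3) L by simp
  define W' where "W' = W(vid h := U)"
  have W'n: "W' (vid new) = U" by (simp add: W'_def vn)
  have W'r: "W' (vid x) = W (vid x)" if "x \<in> SX - SY" for x using vrest[OF that] by (simp add: W'_def)
  have cross: "W' (vid x) \<inter> U = {} \<and> (\<forall>a\<in>W' (vid x). \<forall>b\<in>U. {a, b} \<in> edges G \<longleftrightarrow> {vid x, vid h} \<in> edges G)"
    if x: "x \<in> SX - SY" for x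
  proof (intro conjI ballI)
    show "W' (vid x) \<inter> U = {}"
      unfolding W'r[OF x] U_def using WD[of x] x YX by blast
    fix a b assume ab: "a \<in> W' (vid x)" "b \<in> U"
    then obtain y where y: "y \<in> SY" "b \<in> W (vid y)" by (auto simp: U_def)
    have "{a, b} \<in> edges G \<longleftrightarrow> {vid x, vid y} \<in> edges G"
      using WE[of x y a b] x y YX ab(1) W'r[OF x] by auto
    also have "\<dots> \<longleftrightarrow> t_adj x y" using valid_adj[OF v, of x y] x y YX by (auto simp: SX_def)
    \<comment> \<open>The module property replaces the arbitrary element \<open>y\<close> by the
      representative \<open>h\<close>.\<close>
    also have "\<dots> \<longleftrightarrow> t_adj x h" using Y(2) x y(1) h unfolding is_module_def SX_def SY_def by blast
    also have "\<dots> \<longleftrightarrow> {vid x, vid h} \<in> edges G" using valid_adj[OF v, of x h] x hX by (auto simp: SX_def)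
    finally show "{a, b} \<in> edges G \<longleftrightarrow> {vid x, vid h} \<in> edges G" .
  qed
  have "valid n G (t_merge Y X) W'"
    unfolding valid_def S
  proof (intro conjI)
    have "inj_on vid (SX - SY)" by (rule inj_on_subset[OF inj]) blast
    moreover have "vid h \<notin> vid ` (SX - SY)"
    proof
      assume "vid h \<in> vid ` (SX - SY)"
      then obtain x where "x \<in> SX - SY" "vid h = vid x" by blast
      then show False using vrest[of x] by simp
    qed
    ultimately show "distinct (map vid (list_of (t_merge Y X)))"
      unfolding L using valid_distinct[OF v] vn
      by (auto simp: distinct_map SX_def inj_on_def image_iff)
    show "\<forall>x\<in>insert new (SX - SY). valid_record n G W' x"
    proof (intro ballI)
      fix x assume "x \<in> insert new (SX - SY)"
      then consider "x = new" | "x \<in> SX - SY" by blast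
      then show "valid_record n G W' x"
      proof cases
        case 1
        have i: "idx new = idx h" by (simp add: new_def)
        show ?thesis
          using valid_recordD(1-3)[OF X[OF hX]] T
          unfolding 1 valid_record_def vn(2,3) i W'n[unfolded i] by blast
      next
        case 2
        then show ?thesis using X[of x] W'r[OF 2] unfolding valid_record_def by simp
      qed
    qed
    have "(\<Union>x\<in>insert new (SX - SY). W' (vid x)) = U \<union> (\<Union>x\<in>SX - SY. W (vid x))"
      using W'n W'r by auto
    also have "\<dots> = {..<n}" unfolding U_def WU[symmetric] using YX by blast
    finally show "(\<Union>x\<in>insert new (SX - SY). W' (vid x)) = {..<n}" .
    show "\<forall>x\<in>insert new (SX - SY). \<forall>z\<in>insert new (SX - SY). vid x \<noteq> vid z \<longrightarrow> apart G W' x z"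
    proof (intro ballI impI)
      fix x z assume xz: "x \<in> insert new (SX - SY)" "z \<in> insert new (SX - SY)" "vid x \<noteq> vid z"
      then consider "x = new" "z \<in> SX - SY" | "z = new" "x \<in> SX - SY" | "x \<in> SX - SY" "z \<in> SX - SY" "x \<noteq> z"
        by blast
      then show "apart G W' x z"
      proof cases
        case 1
        have "apart G W' z x" using cross[OF 1(2)] unfolding 1(1) apart_def W'n unfolding vn(1) by blast
        then show ?thesis by (rule apart_sym)
      next
        case 2
        show ?thesis using cross[OF 2(2)] unfolding 2(1) apart_def W'n unfolding vn(1) by blast
      next
        case 3
        show ?thesis using WD[of x z] WE[of x z] 3 unfolding apart_def W'r[OF 3(1)] W'r[OF 3(2)] by blast
      qed
    qed
  qed
  then show "\<exists>W'. valid n G (t_merge Y X) W'" by blast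
qed

text \<open>The indices of the current vertices induce a subgraph of \<open>G\<close> that is
  isomorphic to the current graph under \<open>vid\<close>. A small module of this subgraph pulls
  back to the records, and the computed module is no larger.\<close>

lemma valid_outer:
  assumes G: "is_rb_graph G" "verts G = {..<n}" and v: "valid n G X W" and X: "right X \<noteq> Tip"
  defines "Y \<equiv> t_outer X X X"
  shows "distinct (list_of Y)" "is_module t_adj (set (list_of X)) (set (list_of Y))" "2 \<le> len Y"
    "len Y \<le> modular_width G"
proof -
  have 2: "2 \<le> len X" using X by (simp only: right_neq_Tip)
  note sm = smallest_module[OF valid_inj[OF v] valid_distinct[OF v] 2, folded Y_def]
  show "distinct (list_of Y)" "is_module t_adj (set (list_of X)) (set (list_of Y))" "2 \<le> len Y"
    using sm(1) by blast+
  let ?S = "set (list_of X)"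
  have "vid ` ?S \<subseteq> verts G" using valid_recordD(1)[OF valid_rec[OF v]] G(2) by auto
  moreover have "2 \<le> card (vid ` ?S)"
    using card_image[OF valid_inj[OF v]] distinct_card[OF valid_distinct[OF v]] 2 by simp
  ultimately obtain M where M: "is_module (\<lambda>u v. {u, v} \<in> edges G) (vid ` ?S) M" "2 \<le> card M"
    "card M \<le> modular_width G"
    using small_module_graph[OF G(1)] by blast
  define M' where "M' = {x \<in> ?S. vid x \<in> M}"
  have im: "vid ` M' = M" using M(1) unfolding M'_def is_module_def by auto
  have "card M' = card M"
    unfolding im[symmetric] by (rule card_image[symmetric], rule inj_on_subset[OF valid_inj[OF v]]) (auto simp: M'_def)
  moreover have "is_module t_adj ?S M'"
    unfolding is_module_def
  proof (intro conjI ballI)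
    show "M' \<subseteq> ?S" by (auto simp: M'_def)
    fix x a b assume x: "x \<in> ?S - M'" and ab: "a \<in> M'" "b \<in> M'"
    then have "vid x \<in> vid ` ?S - M" "vid a \<in> M" "vid b \<in> M" by (auto simp: M'_def)
    then have "{vid x, vid a} \<in> edges G \<longleftrightarrow> {vid x, vid b} \<in> edges G"
      using M(1) unfolding is_module_def by blast
    moreover have "a \<in> ?S" "b \<in> ?S" "x \<in> ?S" using x ab by (auto simp: M'_def)
    ultimately show "t_adj x a = t_adj x b" using valid_adj[OF v] by simp
  qed
  ultimately show "len Y \<le> modular_width G" using sm(2)[of M'] M(2,3) by simp
qed

definition "t_step a = (if right a \<noteq> Tip then t_merge (t_outer a a a) a else a)"

lemma t_contract_eq: "t_contract fuel X = fold (\<lambda>_. t_step) (list_of fuel) X"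
  unfolding t_contract_def t_step_def ..

lemma valid_step:
  assumes G: "is_rb_graph G" "verts G = {..<n}" and v: "valid n G X W"
  shows "\<exists>W'. valid n G (t_step X) W'" and "len (t_step X) \<le> max 1 (len X - 1)"
proof -
  show "\<exists>W'. valid n G (t_step X) W'"
    using v valid_merge(1)[OF G v valid_outer(1-3)[OF G v]] unfolding t_step_def by auto
  show "len (t_step X) \<le> max 1 (len X - 1)"
  proof (cases "right X = Tip")
    case True
    then have "len X \<le> 1" using right_neq_Tip[of X] by simp
    then show ?thesis using True by (simp add: t_step_def)
  next
    case False
    then show ?thesis using valid_merge(2)[OF G v valid_outer(1-3)[OF G v False]] by (simp add: t_step_def)
  qed
qed

text \<open>A round replaces at least two vertices by one; once a single vertex is left, further
  rounds change nothing.\<close>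

lemma valid_contract:
  assumes G: "is_rb_graph G" "verts G = {..<n}" and v: "valid n G X W"
  shows "(\<exists>W'. valid n G (t_contract fuel X) W') \<and> len (t_contract fuel X) \<le> max 1 (len X - len fuel)"
  unfolding t_contract_eq
  using v
proof (induction fuel arbitrary: X W)
  case Tip
  then show ?case by auto
next
  case (Pair a b)
  obtain W' where W': "valid n G (t_step X) W'" using valid_step(1)[OF G Pair.prems] by blast
  from Pair.IH(2)[OF this] valid_step(2)[OF G Pair.prems] show ?case by fastforce
qed

lemma contract_table:
  assumes G: "is_rb_graph G" "verts G = {..<n}" "1 \<le> n" and v: "valid n G X W" "len X \<le> len fuel"
  shows "table (achievable G {..<n}) (tab (left (t_contract fuel X)))"
proof -
  let ?Z = "t_contract fuel X"
  obtain W' where W': "valid n G ?Z W'" and l: "len ?Z \<le> 1"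
    using valid_contract[OF G(1,2) v(1), of fuel] v(2) by auto
  have UN: "(\<Union>x\<in>set (list_of ?Z). W' (vid x)) = {..<n}" using W' unfolding valid_def by blast
  moreover have "{..<n} \<noteq> {}" using G(3) by (simp add: lessThan_empty_iff)
  ultimately have "?Z \<noteq> Tip" by auto
  then obtain x where x: "list_of ?Z = [x]" "left ?Z = x" using l by (cases ?Z) auto
  then have "W' (vid x) = {..<n}" using UN by simp
  moreover have "table (achievable G (W' (vid x))) (tab x)"
    by (rule valid_recordD(4)[OF valid_rec[OF W']]) (simp add: x(1))
  ultimately show ?thesis using x(2) by simp
qed

section \<open>Initial state\<close>

lemma list_of_enc_list [simp]: "list_of (enc_list xs) = xs"
  by (induction xs) auto

lemma enc_bool_unary: "enc_bool b = unary (of_bool b)"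
  by (simp add: enc_bool_def)

lemma table_inittab:
  assumes "left c = enc_bool (v \<in> red G)" "right c = enc_bool (v \<in> blue G)"
  shows "table (achievable G {v}) (t_inittab c)"
  unfolding t_inittab_def assms achievable_single enc_bool_unary
  by (auto simp: table_def pair_tree_def)

lemma valid_init:
  assumes G: "is_rb_graph G" "verts G = {..<n}"
  shows "valid n G (right (t_init (enc_graph n G) Tip)) (\<lambda>v. {v})" "len (right (t_init (enc_graph n G) Tip)) = n"
proof -
  define r where "r u = Pair (Pair (enc_bool (u \<in> red G)) (enc_bool (u \<in> blue G)))
    (enc_list (map (\<lambda>v. enc_bool ({u, v} \<in> edges G)) [0..<n]))" for u
  define rec where "rec u = Pair (unary u) (Pair (right (r u)) (t_inittab (left (r u))))" for u
  define s where "s = (\<lambda>r a. Pair (Pair Tip (left a))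
    (Pair (Pair (left a) (Pair (right r) (t_inittab (left r)))) (right a)))"
  have "left (fold s (map r [0..<m]) Tip) = unary m \<and>
    list_of (right (fold s (map r [0..<m]) Tip)) = rev (map rec [0..<m])" for m
    by (induction m) (auto simp: s_def rec_def)
  then have L: "list_of (right (t_init (enc_graph n G) Tip)) = rev (map rec [0..<n])"
    unfolding t_init_def enc_graph_def s_def[symmetric] r_def[symmetric] by simp
  then show "len (right (t_init (enc_graph n G) Tip)) = n" by simp
  have v: "vid (rec u) = u" for u by (simp add: rec_def)
  have t: "table (achievable G {u}) (tab (rec u))" for u
    unfolding rec_def by (simp, rule table_inittab) (simp_all add: r_def)
  have "map (vid \<circ> rec) [0..<n] = [0..<n]" using v by (simp add: comp_def)
  then have "distinct (map vid (rev (map rec [0..<n])))" by (simp add: rev_map[symmetric])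
  then show "valid n G (right (t_init (enc_graph n G) Tip)) (\<lambda>v. {v})"
    unfolding valid_def L using v t by (auto simp: valid_record_def apart_def rec_def r_def)
qed

section \<open>Truncated binary numbers\<close>

lemma len_t_add [simp]: "len (t_add r s) = len r + len s"
  unfolding t_add_def
proof (induction r arbitrary: s)
  case (Pair a b)
  show ?case using Pair.IH(2)[of "Pair Tip s"] by simp
qed simp

lemma len_t_cap [simp]: "len (t_cap v g) = min (len v) (len g)"
  by (simp add: t_cap_def t_le_iff)

lemma enc_nat_eq_Tip: "enc_nat b = Tip \<longleftrightarrow> b = 0"
  by (subst enc_nat.simps) simp

lemma left_enc_nat: "left (enc_nat b) \<noteq> Tip \<longleftrightarrow> odd b"
  by (subst enc_nat.simps) (auto simp: enc_bool_def)

lemma right_enc_nat: "right (enc_nat b) = enc_nat (b div 2)"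
proof (cases "b = 0")
  case True
  then show ?thesis by (simp add: enc_nat.simps)
next
  case False
  then show ?thesis by (subst enc_nat.simps) simp
qed

text \<open>One doubling step preserves \<open>v + p * q\<close> up to truncation at
  \<open>n\<close>. Truncating the doubled weight matters only if it exceeds \<open>n\<close> while
  digits remain, and then both sides equal \<open>n\<close>.\<close>

lemma min_double:
  fixes n v p q :: nat
  shows "min n (min (if odd q then p + v else v) n + min (p + p) n * (q div 2)) = min n (v + p * q)"
proof -
  have q: "q = 2 * (q div 2) + (if odd q then 1 else 0)" by (simp add: odd_two_times_div_two_nat)
  define k where "k = q div 2"
  have pq: "p * q = (p + p) * k + (if odd q then p else 0)"
    by (subst q, fold k_def) (simp add: algebra_simps)
  show ?thesis
  proof (cases "k = 0")
    case True
    then show ?thesis using pq unfolding k_def[symmetric] by auto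
  next
    case False
    show ?thesis
    proof (cases "p + p \<le> n")
      case True
      then show ?thesis using pq unfolding k_def[symmetric] by auto
    next
      case c: False
      have "n \<le> n * k" "n * k \<le> (p + p) * k" using False c by (auto intro: mult_le_mono1)
      then have "n \<le> x + n * k" "n \<le> v + p * q" for x using pq by linarith+
      then show ?thesis unfolding k_def[symmetric] using c by (simp add: min_absorb1)
    qed
  qed
qed

definition "t_capstep g a = (if left a \<noteq> Tip then Pair (right (left a))
  (Pair (t_cap (if left (left a) \<noteq> Tip then t_add (right (right a)) (left (right a)) else left (right a)) g)
        (t_cap (t_add (right (right a)) (right (right a))) g)) else a)"

lemma t_caploop_eq: "t_caploop fuel a g = fold (\<lambda>_. t_capstep g) (list_of fuel) a"
  unfolding t_caploop_def t_capstep_def ..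

text \<open>With \<open>a = (bits, (v, p))\<close>, the invariant is that \<open>v + p q\<close> does not change up to truncation at \<open>len g\<close>,
  where \<open>q\<close> is the number denoted by the remaining bits.\<close>

lemma caploop_correct:
  assumes "left a = enc_nat q" "len (left (right a)) \<le> len g" "1 \<le> len (right (right a))" "1 \<le> len g"
  shows "\<exists>q'. left (t_caploop fuel a g) = enc_nat q' \<and>
    len (left (right (t_caploop fuel a g))) \<le> len g \<and>
    min (len g) (len (left (right (t_caploop fuel a g))) + len (right (right (t_caploop fuel a g))) * q') =
      min (len g) (len (left (right a)) + len (right (right a)) * q) \<and>
    (q' = 0 \<or> min (len g) (len (right (right a)) + len fuel) \<le> len (right (right (t_caploop fuel a g))))"
  using assms unfolding t_caploop_eq
proof (induction fuel arbitrary: a q)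
  case Tip
  then show ?case by auto
next
  case (Pair x y)
  show ?case
  proof (cases "q = 0")
    case True
    then have "left a = Tip" using Pair.prems(1) by (simp add: enc_nat_eq_Tip)
    then have s: "t_capstep g a = a" by (simp add: t_capstep_def)
    have "fold (\<lambda>_. t_capstep g) fs a = a" for fs :: "tree list" by (induction fs) (simp_all add: s)
    then have f: "fold (\<lambda>_. t_capstep g) (list_of (Pair x y)) a = a" .
    show ?thesis unfolding f using Pair.prems True by auto
  next
    case False
    then have ne: "left a \<noteq> Tip" using Pair.prems(1) by (simp add: enc_nat_eq_Tip)
    define b where "b = t_capstep g a"
    have b: "left b = enc_nat (q div 2)"
      "len (left (right b)) = min (if odd q then len (right (right a)) + len (left (right a)) else len (left (right a))) (len g)"
      "len (right (right b)) = min (len (right (right a)) + len (right (right a))) (len g)"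
      unfolding b_def t_capstep_def using ne Pair.prems(1) by (simp_all add: right_enc_nat left_enc_nat)
    have "1 \<le> len (right (right b))" "len (left (right b)) \<le> len g"
      using b(2,3) Pair.prems(3,4) by auto
    from Pair.IH(2)[OF b(1) this(2,1) Pair.prems(4)]
    obtain q' where q': "left (fold (\<lambda>_. t_capstep g) (list_of y) b) = enc_nat q'"
      "len (left (right (fold (\<lambda>_. t_capstep g) (list_of y) b))) \<le> len g"
      "min (len g) (len (left (right (fold (\<lambda>_. t_capstep g) (list_of y) b))) +
        len (right (right (fold (\<lambda>_. t_capstep g) (list_of y) b))) * q') =
       min (len g) (len (left (right b)) + len (right (right b)) * (q div 2))"
      "q' = 0 \<or> min (len g) (len (right (right b)) + len y) \<le> len (right (right (fold (\<lambda>_. t_capstep g) (list_of y) b)))"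
      by blast
    have M1: "min (len g) (len (left (right b)) + len (right (right b)) * (q div 2)) =
        min (len g) (len (left (right a)) + len (right (right a)) * q)"
      unfolding b(2,3) by (rule min_double)
    \<comment> \<open>The weight is at least 1, so doubling raises it by at least 1 until it reaches
      the cap; this pays for the fuel consumed.\<close>
    have M2: "min (len g) (len (right (right a)) + len (Pair x y)) \<le> min (len g) (len (right (right b)) + len y)"
      using b(3) Pair.prems(3) by (simp add: min_def)
    have F: "fold (\<lambda>_. t_capstep g) (list_of (Pair x y)) a = fold (\<lambda>_. t_capstep g) (list_of y) b"
      by (simp add: b_def)
    show ?thesis unfolding F
      by (rule exI[of _ q'], intro conjI, rule q'(1), rule q'(2), rule trans[OF q'(3) M1])
        (use q'(4) le_trans[OF M2] in blast)
  qed
qed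

text \<open>If digits remain after \<open>len fuel\<close> rounds, the current weight has reached
  \<open>len fuel\<close>. The number is then at least that large, and \<open>fuel\<close> itself is
  the truncated value.\<close>

lemma len_t_capped:
  assumes "1 \<le> len fuel"
  shows "len (t_capped fuel (enc_nat b)) = min (len fuel) b"
proof -
  let ?a = "Pair (enc_nat b) (Pair Tip (Pair Tip Tip))"
  let ?r = "t_caploop fuel ?a fuel"
  obtain q' where q': "left ?r = enc_nat q'" "len (left (right ?r)) \<le> len fuel"
    "min (len fuel) (len (left (right ?r)) + len (right (right ?r)) * q') = min (len fuel) b"
    "q' = 0 \<or> len fuel \<le> len (right (right ?r))"
    using caploop_correct[of ?a b fuel fuel] assms by auto
  show ?thesis
  proof (cases "q' = 0")
    case True
    then show ?thesis using q' by (simp add: t_capped_def enc_nat_eq_Tip Let_def)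
  next
    case False
    then have "len fuel \<le> len (right (right ?r)) * q'" using q'(4)
      by (metis Suc_leI mult.right_neutral mult_le_mono not_gr0 One_nat_def)
    then have "len fuel = min (len fuel) b" using q'(3) by simp
    then show ?thesis using False q'(1) by (simp add: t_capped_def enc_nat_eq_Tip Let_def)
  qed
qed

section \<open>Correctness of the program\<close>

text \<open>A set that dominates after deletion of \<open>S\<close> misses only vertices of
  \<open>S\<close>. Conversely, the vertices missed by \<open>D\<close> are disjoint from
  \<open>D\<close>, as every vertex lies in its own closed neighbourhood; so deleting them removes
  no dominator.\<close>

lemma rbr_yes_iff:
  assumes G: "is_rb_graph G"
  shows "rbr_yes G k \<gamma> \<longleftrightarrow> (\<exists>(r, s)\<in>achievable G (verts G). int r \<le> \<gamma> \<and> int s \<le> k)"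
proof
  have V: "red G \<subseteq> verts G" "blue G \<subseteq> verts G" "finite (verts G)" using G by (auto simp: is_rb_graph_def)
  assume "rbr_yes G k \<gamma>"
  then obtain S g where S: "S \<subseteq> blue G" "int (card S) \<le> k" "gamma_rb (delete_verts G S) = enat g" "int g \<le> \<gamma>"
    unfolding rbr_yes_def by blast
  let ?H = "delete_verts G S"
  \<comment> \<open>The infimum is finite, so dominating sets exist, and by well-ordering the
    infimum is attained.\<close>
  have "{D. rb_dominating ?H D} \<noteq> {}"
  proof
    assume e: "{D. rb_dominating ?H D} = {}"
    have "gamma_rb ?H = top" unfolding gamma_rb_def e by simp
    then show False using S(3) by (simp add: top_enat_def)
  qed
  then obtain D\<^sub>0 where "rb_dominating ?H D\<^sub>0" by blast
  then have "enat (card D\<^sub>0) \<in> (\<lambda>D. enat (card D)) ` {D. rb_dominating ?H D}" by simp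
  then have "gamma_rb ?H \<in> (\<lambda>D. enat (card D)) ` {D. rb_dominating ?H D}"
    unfolding gamma_rb_def by (rule wellorder_InfI)
  then obtain D where D: "rb_dominating ?H D" "card D = g" using S(3) by auto
  have "undom G (verts G) D \<subseteq> S"
  proof
    fix v assume v: "v \<in> undom G (verts G) D"
    show "v \<in> S"
    proof (rule ccontr)
      assume "v \<notin> S"
      then have "closed_nbhd ?H v \<inter> D \<noteq> {}"
        using D(1) v unfolding rb_dominating_def undom_def by (simp add: delete_verts_def)
      moreover have "closed_nbhd ?H v \<subseteq> closed_nbhd G v"
        unfolding closed_nbhd_def delete_verts_def by auto
      ultimately show False using v unfolding undom_def by blast
    qed
  qed
  moreover have "finite S" by (rule finite_subset[OF _ V(3)]) (use S(1) V(2) in blast)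
  ultimately have "card (undom G (verts G) D) \<le> card S" by (rule card_mono[rotated])
  moreover have "D \<subseteq> red G \<inter> verts G" using D(1) V unfolding rb_dominating_def delete_verts_def by auto
  then have "(card D, card (undom G (verts G) D)) \<in> achievable G (verts G)" unfolding achievable_def by blast
  ultimately show "\<exists>(r, s)\<in>achievable G (verts G). int r \<le> \<gamma> \<and> int s \<le> k"
    using S(2,4) D(2) by (intro bexI[of _ "(card D, card (undom G (verts G) D))"]) auto
next
  have V: "red G \<subseteq> verts G" "blue G \<subseteq> verts G" "finite (verts G)" using G by (auto simp: is_rb_graph_def)
  assume "\<exists>(r, s)\<in>achievable G (verts G). int r \<le> \<gamma> \<and> int s \<le> k"
  then obtain D where D: "D \<subseteq> red G" "int (card D) \<le> \<gamma>" "int (card (undom G (verts G) D)) \<le> k"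
    unfolding achievable_def by auto
  define S where "S = undom G (verts G) D"
  have DS: "D \<inter> S = {}" by (auto simp: S_def undom_def closed_nbhd_def)
  have "rb_dominating (delete_verts G S) D"
    unfolding rb_dominating_def
  proof (intro conjI ballI)
    show "D \<subseteq> red (delete_verts G S)" using D(1) DS by (auto simp: delete_verts_def)
    fix v assume v: "v \<in> blue (delete_verts G S)"
    then have vG: "v \<in> blue G" "v \<notin> S" by (auto simp: delete_verts_def)
    then have "closed_nbhd G v \<inter> D \<noteq> {}" using V by (auto simp: S_def undom_def)
    then obtain d where d: "d \<in> D" "d = v \<or> d \<in> verts G \<and> {d, v} \<in> edges G" by (auto simp: closed_nbhd_def)
    then have "d \<in> closed_nbhd (delete_verts G S) v"
      using DS vG(2) by (auto simp: closed_nbhd_def delete_verts_def)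
    then show "closed_nbhd (delete_verts G S) v \<inter> D \<noteq> {}" using d(1) by blast
  qed
  then have le: "gamma_rb (delete_verts G S) \<le> enat (card D)"
    unfolding gamma_rb_def by (intro INF_lower) simp
  then obtain g where g: "gamma_rb (delete_verts G S) = enat g" by (cases "gamma_rb (delete_verts G S)") auto
  then have "int g \<le> \<gamma>" using le D(2) by simp
  then show "rbr_yes G k \<gamma>" unfolding rbr_yes_def using g D(3) by (auto simp: S_def undom_def intro!: exI[of _ S])
qed

lemma enc_int_parts: "left (enc_int z) \<noteq> Tip \<longleftrightarrow> z < 0" "right (enc_int z) = enc_nat (nat \<bar>z\<bar>)"
  by (simp_all add: enc_int_def)

lemma len_enc_graph: "len (enc_graph n G) = n"
  by (simp add: enc_graph_def)

lemma t_main_correct: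
  assumes G: "is_rb_graph G" "verts G = {..<n}" "1 \<le> n"
  shows "t_main (enc_instance n G k \<gamma>) \<noteq> Tip \<longleftrightarrow> rbr_yes G k \<gamma>"
proof (cases "k < 0 \<or> \<gamma> < 0")
  case True
  then have "\<not> rbr_yes G k \<gamma>" unfolding rbr_yes_def by auto
  moreover have "t_main (enc_instance n G k \<gamma>) = Tip"
    using True by (auto simp: t_main_def enc_instance_def enc_int_parts)
  ultimately show ?thesis by simp
next
  case False
  let ?g = "enc_graph n G"
  let ?T = "tab (left (t_contract ?g (right (t_init ?g Tip))))"
  have T: "table (achievable G {..<n}) ?T"
    by (rule contract_table[OF G valid_init(1)[OF G(1,2)]]) (simp add: valid_init(2)[OF G(1,2)] len_enc_graph)
  have l: "1 \<le> len ?g" using G(3) by (simp add: len_enc_graph)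
  have m: "t_main (enc_instance n G k \<gamma>) =
      t_decide ?T Tip (t_capped ?g (enc_nat (nat k))) (t_capped ?g (enc_nat (nat \<gamma>)))"
    using False by (simp add: t_main_def enc_instance_def enc_int_def)
  have "t_main (enc_instance n G k \<gamma>) \<noteq> Tip \<longleftrightarrow>
      (\<exists>(r, s)\<in>achievable G {..<n}. r \<le> min n (nat \<gamma>) \<and> s \<le> min n (nat k))"
    unfolding m t_decide_iff len_t_capped[OF l] len_enc_graph T[unfolded table_def, THEN conjunct2]
    by (simp add: pair_tree_def case_prod_unfold)
  \<comment> \<open>Entries of achievable pairs are at most \<open>n\<close>, so truncating the two
    bounds at \<open>n\<close> changes no comparison.\<close>
  also have "\<dots> \<longleftrightarrow> (\<exists>(r, s)\<in>achievable G {..<n}. int r \<le> \<gamma> \<and> int s \<le> k)"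
  proof -
    have "r \<le> n \<and> s \<le> n" if "(r, s) \<in> achievable G {..<n}" for r s
      using achievable_bounds[of "{..<n}" n G] that by auto
    then show ?thesis using False by (intro bex_cong refl) (auto simp: nat_le_iff le_nat_iff)
  qed
  finally show ?thesis using rbr_yes_iff[OF G(1)] G(2) by simp
qed

section \<open>Running time\<close>

text \<open>Without calls the number of steps is constant whatever the sizes of the arguments; this
  also covers binary numbers of unbounded length.\<close>

lemma ptime_den_nocall:
  assumes "wf_expr (\<lambda>_. None) k e" "\<And>w m env. S w m env \<Longrightarrow> length env = k"
  shows "ptime P S e (\<lambda>env. den F env e)"
  using assms(1)
proof (induction e)
  case (Cond c a b)
  show ?case unfolding den.simps
    by (rule ptime_Cond) (use Cond in \<open>auto elim: ptime_subset\<close>)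
qed (use assms(2) in \<open>auto intro: ptime_Var ptime_Tip ptime_Pair ptime_Left ptime_Right\<close>)

lemmas known19 = polys_known[OF polys19]

lemma poly_fun_prog:
  "1 \<le> f \<Longrightarrow> f < 19 \<Longrightarrow> arity f = k \<Longrightarrow> poly_fun prog f k (sem f)"
  using polys19 unfolding polys_def by auto

text \<open>The counter is copied in every round, so the accumulator does not grow as
  \<open>poly_fun_loop\<close> requires. The step has no calls and takes constant time, so the
  number of rows is all that has to be bounded.\<close>

definition init_dom :: "nat \<Rightarrow> nat \<Rightarrow> tree list \<Rightarrow> bool" where
  "init_dom w m env \<longleftrightarrow> (\<exists>xs acc. env = [xs, acc] \<and> len xs \<le> m)"

lemma ptime_init: "ptime prog init_dom (prog ! 19) (\<lambda>env. t_init (env ! 0) (env ! 1))"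
proof -
  define e where "e = PairE (PairE TipE (LeftE (Var 1))) (PairE (PairE (LeftE (Var 1))
      (PairE (RightE elemE) (PairE (PairE TipE (RightE (LeftE elemE)))
         (Cond (LeftE (LeftE elemE)) (PairE (PairE oneE TipE) TipE) TipE)))) (RightE (Var 1)))"
  have "ptime prog init_dom (prog ! 19) (\<lambda>env. tloop (\<lambda>env. den sem env e) (env ! 0) (env ! 1) (drop 2 env))"
  proof (rule ptime_loop[of 19 prog 0 e])
    show "prog ! 19 = loopE 19 0 e" by (simp add: prog_def e_def)
    show "ptime prog (\<lambda>w m env. init_dom w m env \<and> hd env \<noteq> Tip) e (\<lambda>env. den sem env e)"
      by (rule ptime_den_nocall[of 2]) (auto simp: e_def oneE_def init_dom_def)
  qed (auto simp: length_prog init_dom_def)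
  then show ?thesis
  proof (rule ptime_cong)
    fix w m env assume "init_dom w m env"
    then obtain xs acc where env: "env = [xs, acc]" by (auto simp: init_dom_def)
    show "tloop (\<lambda>env. den sem env e) (env ! 0) (env ! 1) (drop 2 env) = t_init (env ! 0) (env ! 1)"
      unfolding env t_init_def by (simp, rule tloop_fold) (simp add: e_def oneE_def t_inittab_def)
  qed
qed

definition tables_le :: "nat \<Rightarrow> (tree \<Rightarrow> (nat \<times> nat) set) \<Rightarrow> tree \<Rightarrow> bool" where
  "tables_le m A Y \<longleftrightarrow> (\<forall>y\<in>set (list_of Y). table (A y) (tab y) \<and> A y \<subseteq> {..m} \<times> {..m})"

text \<open>\<open>t_prod\<close> multiplies tables, so the accumulator is bounded by its meaning:
  \<open>m - len ys\<close> grows by one per processed block, and a block adds at most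
  \<open>m\<close> to each component.\<close>

definition comb_dom :: "nat \<Rightarrow> nat \<Rightarrow> tree list \<Rightarrow> bool" where
  "comb_dom w m env \<longleftrightarrow> (\<exists>ys acc I A B. env = [ys, acc, I] \<and> size ys \<le> m \<and> size I \<le> m \<and> tables_le m A ys \<and>
     table B acc \<and> B \<subseteq> {..(m - len ys) * m} \<times> {..(m - len ys) * m})"

lemma poly_table_bound: "poly_bdd h \<Longrightarrow> poly_bdd (\<lambda>m. table_bound (h m))"
  unfolding table_bound_def by (intro poly_bdd_intros)

lemma square_mono: "A \<subseteq> {..a} \<times> {..a} \<Longrightarrow> a \<le> b \<Longrightarrow> A \<subseteq> {..b::nat} \<times> {..b}"
  by fastforce

lemma ptime_comb: "ptime prog comb_dom (prog ! 20) (\<lambda>env. t_comb (env ! 0) (env ! 1) (env ! 2))"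
proof -
  define e where "e = Call 14 [Call 15 [RightE (RightE elemE), TipE, Call 3 [Var 2, TipE, elemE],
      Call 4 [Var 2, TipE, elemE]], TipE, Var 1]"
  have den: "den sem [Pair a b, acc, I] e = t_prod (t_opt (tab a) Tip (t_mem I Tip a) (t_dom I Tip a)) Tip acc"
    for a b acc I by (simp add: e_def sem_def)
  have "ptime prog comb_dom (prog ! 20) (\<lambda>env. tloop (\<lambda>env. den sem env e) (env ! 0) (env ! 1) (drop 2 env))"
  proof (rule ptime_loop[of 20 prog 1 e])
    show "prog ! 20 = loopE 20 1 e" by (simp add: prog_def e_def)
    show "20 < length prog" by (simp add: length_prog)
    show "\<exists>xs acc cs. env = xs # acc # cs \<and> length cs = 1 \<and> len xs \<le> m" if D: "comb_dom w m env" for w m env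
      using D len_le_size le_trans unfolding comb_dom_def by fastforce
    show "comb_dom w m (b # den sem (Pair a b # acc # cs) e # cs)"
      if D: "comb_dom w m (Pair a b # acc # cs)" for w m a b acc cs
    proof -
      obtain I A B where *: "cs = [I]" "size (Pair a b) \<le> m" "size I \<le> m" "tables_le m A (Pair a b)"
        "table B acc" "B \<subseteq> {..(m - len (Pair a b)) * m} \<times> {..(m - len (Pair a b)) * m}"
        using D unfolding comb_dom_def by auto
      have a: "table (A a) (tab a)" "A a \<subseteq> {..m} \<times> {..m}" using *(4) by (auto simp: tables_le_def)
      define R where "R = restrict_pairs (A a) (t_mem I Tip a \<noteq> Tip) (t_dom I Tip a \<noteq> Tip)"
      have R: "R \<subseteq> {..m} \<times> {..m}" using a(2) unfolding R_def restrict_pairs_def by fastforce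
      have T: "table (sumset R B) (den sem (Pair a b # acc # cs) e)"
        unfolding *(1) den R_def by (rule table_prod[OF table_opt[OF a(1)] *(5)])
      have "len (Pair a b) \<le> m" using len_le_size[of "Pair a b"] *(2) by linarith
      then have "m - len b = Suc (m - len (Pair a b))" by simp
      then have "(m - len b) * m = m + (m - len (Pair a b)) * m" by simp
      then have "sumset R B \<subseteq> {..(m - len b) * m} \<times> {..(m - len b) * m}"
        using R *(6) unfolding sumset_def pair_add_def by (fastforce intro: add_mono)
      moreover have "tables_le m A b" using *(4) by (auto simp: tables_le_def)
      ultimately show ?thesis unfolding comb_dom_def using *(1,2,3) T by auto
    qed
    have "psize comb_dom (\<lambda>env. env ! i)" if i: "i < 3" for i
    proof (rule psizeI[of "\<lambda>m. m + table_bound (m * m)"])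
      show "poly_bdd (\<lambda>m. m + table_bound (m * m))" by (intro poly_bdd_intros poly_table_bound)
      fix w m env assume "comb_dom w m env"
      then obtain ys acc I A B where *: "env = [ys, acc, I]" "size ys \<le> m" "size I \<le> m"
        "table B acc" "B \<subseteq> {..(m - len ys) * m} \<times> {..(m - len ys) * m}"
        unfolding comb_dom_def by blast
      have "size acc \<le> table_bound (m * m)"
        by (rule size_table[OF *(4) square_mono[OF *(5)]]) simp
      moreover have "i = 0 \<or> i = 1 \<or> i = 2" using i by linarith
      ultimately show "size (env ! i) \<le> m + table_bound (m * m)" using *(1-3) by auto
    qed
    then have "ptime prog comb_dom e (\<lambda>env. den sem env e)"
      by (intro conjunct1[OF ptime_den[OF known19]]) (auto simp: comb_dom_def e_def known_def arity_def)
    then show "ptime prog (\<lambda>w m env. comb_dom w m env \<and> hd env \<noteq> Tip) e (\<lambda>env. den sem env e)"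
      by (rule ptime_subset) blast
  qed
  then show ?thesis
  proof (rule ptime_cong)
    fix w m env assume "comb_dom w m env"
    then obtain ys acc I where env: "env = [ys, acc, I]" by (auto simp: comb_dom_def)
    show "tloop (\<lambda>env. den sem env e) (env ! 0) (env ! 1) (drop 2 env) = t_comb (env ! 0) (env ! 1) (env ! 2)"
      unfolding env t_comb_def by (simp, rule tloop_fold) (simp add: den)
  qed
qed

text \<open>An element of \<open>rem\<close> moves to \<open>I\<close> or is dropped, so
  \<open>size rem + size I\<close> never increases along the recursion.\<close>

definition go_dom :: "nat \<Rightarrow> nat \<Rightarrow> tree list \<Rightarrow> bool" where
  "go_dom w m env \<longleftrightarrow> (\<exists>rem I Y A. env = [rem, I, Y] \<and> len rem \<le> w \<and> size rem + size I \<le> m \<and> size Y \<le> m \<and>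
     distinct (list_of Y) \<and> tables_le m A Y)"

text \<open>However many guesses are united, each entry is a sum of at most \<open>m\<close> numbers
  up to \<open>m\<close>, and duplicates are removed.\<close>

lemma size_go:
  assumes "size Y \<le> m" "distinct (list_of Y)" "tables_le m A Y"
  shows "size (t_go rem I Y) \<le> table_bound (m * m)"
proof (rule size_table[OF table_go[of Y A]])
  show "\<forall>y\<in>set (list_of Y). table (A y) (tab y)" "distinct (list_of Y)"
    using assms by (auto simp: tables_le_def)
  let ?S = "set (list_of Y)"
  have c: "card ?S \<le> m" using distinct_card[OF assms(2)] len_le_size[of Y] assms(1) by simp
  have "merged A ?S J \<subseteq> {..m * m} \<times> {..m * m}" for J
  proof
    fix p assume "p \<in> merged A ?S J"
    then obtain f where f: "p = (\<Sum>y\<in>?S. fst (f y), \<Sum>y\<in>?S. snd (f y))"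
      "\<forall>y\<in>?S. f y \<in> restrict_pairs (A y) (vid y \<in> vid ` J) (\<exists>z\<in>J. t_adj y z)"
      unfolding merged_def choice_sums_def by blast
    have "fst (f y) \<le> m \<and> snd (f y) \<le> m" if y: "y \<in> ?S" for y
    proof -
      obtain e where "e \<in> A y" "f y = (fst e, if \<exists>z\<in>J. t_adj y z then 0 else snd e)"
        using f(2) y unfolding restrict_pairs_def by blast
      moreover have "A y \<subseteq> {..m} \<times> {..m}" using assms(3) y by (auto simp: tables_le_def)
      ultimately show ?thesis by fastforce
    qed
    then have "(\<Sum>y\<in>?S. fst (f y)) \<le> card ?S * m" "(\<Sum>y\<in>?S. snd (f y)) \<le> card ?S * m"
      using sum_bounded_above[of ?S "\<lambda>y. fst (f y)" m] sum_bounded_above[of ?S "\<lambda>y. snd (f y)" m] by auto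
    moreover have "card ?S * m \<le> m * m" using c by (rule mult_le_mono1)
    ultimately have "(\<Sum>y\<in>?S. fst (f y)) \<le> m * m" "(\<Sum>y\<in>?S. snd (f y)) \<le> m * m" by linarith+
    then show "p \<in> {..m * m} \<times> {..m * m}" using f(1) by simp
  qed
  then show "(\<Union>J\<in>Pow (set (list_of rem)). merged A ?S (J \<union> set (list_of I))) \<subseteq> {..m * m} \<times> {..m * m}"
    by blast
qed

text \<open>The call tree over \<open>rem\<close> is a full binary tree, so its \<open>2 ^ len rem\<close> leaves dominate.\<close>

lemma ptime_go: "ptime prog go_dom (prog ! 21) (\<lambda>env. t_go (env ! 0) (env ! 1) (env ! 2))"
proof -
  let ?leaf = "Call 20 [Var 2, PairE (PairE TipE TipE) TipE, Var 1]"
  let ?node = "Call 12 [Call 21 [RightE (Var 0), PairE elemE (Var 1), Var 2], Call 21 [RightE (Var 0), Var 1, Var 2]]"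
  have P: "prog ! 21 = Cond (Var 0) ?node ?leaf" "21 < length prog" "12 < length prog" "20 < length prog"
    by (simp_all add: prog_def)
  \<comment> \<open>Leaves are costed with \<open>w = 0\<close>, because the factor
    \<open>2 ^ w\<close> is used up by their number.\<close>
  define L where "L w m env \<longleftrightarrow> go_dom w m env \<and> w = 0" for w m env
  have "ptime prog L ?leaf (\<lambda>env. (\<lambda>env. t_comb (env ! 0) (env ! 1) (env ! 2))
      (map (\<lambda>g. g env) [\<lambda>env. env ! 2, \<lambda>env. Pair (Pair Tip Tip) Tip, \<lambda>env. env ! 1]))"
  proof (rule ptime_Call[OF _ P(4) ptime_comb poly_bdd_id])
    show "list_all2 (ptime prog L) [Var 2, PairE (PairE TipE TipE) TipE, Var 1]
      [\<lambda>env. env ! 2, \<lambda>env. Pair (Pair Tip Tip) Tip, \<lambda>env. env ! 1]"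
      by (auto intro!: ptime_Var ptime_Pair ptime_Tip simp: L_def go_dom_def)
    fix w m env assume "L w m env"
    then obtain rem I Y A where *: "env = [rem, I, Y]" "size rem + size I \<le> m" "size Y \<le> m"
      "distinct (list_of Y)" "tables_le m A Y"
      unfolding L_def go_dom_def by blast
    have "table {(0, 0)} (Pair (Pair Tip Tip) Tip)"
      using table_single[of "(0, 0)"] by (simp add: pair_tree_def)
    then have "comb_dom 0 m [Y, Pair (Pair Tip Tip) Tip, I]"
      unfolding comb_dom_def using * by (intro exI[of _ Y] exI[of _ I] exI[of _ A] exI[of _ "{(0, 0)}"] exI[of _ "Pair (Pair Tip Tip) Tip"]) auto
    then show "\<exists>w'\<le>w. \<exists>m'\<le>m. comb_dom w' m' (map (\<lambda>g. g env)
        [\<lambda>env. env ! 2, \<lambda>env. Pair (Pair Tip Tip) Tip, \<lambda>env. env ! 1])"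
      unfolding *(1) by (intro exI[of _ 0] exI[of _ m]) auto
  qed
  then have "ptime prog L ?leaf (\<lambda>env. t_comb (env ! 2) (Pair (Pair Tip Tip) Tip) (env ! 1))"
    by (rule ptime_cong) (simp add: numeral_2_eq_2)
  then obtain hl where hl: "poly_bdd hl" "\<And>w m env. L w m env \<Longrightarrow>
      \<exists>t\<le>2 ^ w * hl m. eval prog env ?leaf (t_comb (env ! 2) (Pair (Pair Tip Tip) Tip) (env ! 1)) t"
    using that by (rule ptimeE')
  have "ptime prog (sized 2) (prog ! 12) (sem 12)"
    using poly_fun_prog[of 12 2] by (simp add: poly_fun_def arity_def)
  then obtain hu where hu: "poly_bdd hu" "mono hu" "\<And>w m env. sized 2 w m env \<Longrightarrow>
      \<exists>t\<le>2 ^ w * hu m. eval prog env (prog ! 12) (sem 12 env) t"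
    using that by (rule ptimeE)
  \<comment> \<open>\<open>c m\<close> covers an inner node: the union of two results and 16 steps
    of overhead. With \<open>t + c m\<close> on the left the induction closes, since two subtrees
    leave one \<open>c m\<close> to spare. The 2 next to \<open>hl m\<close> is the test and the
    conditional at a leaf.\<close>
  define c where "c m = hu (table_bound (m * m)) + 16" for m
  have main: "\<exists>t. t + c m \<le> 2 ^ len rem * (hl m + 2 + c m) \<and> eval prog [rem, I, Y] (prog ! 21) (t_go rem I Y) t"
    if "size rem + size I \<le> m" "size Y \<le> m" "distinct (list_of Y)" "tables_le m A Y" for rem I Y m A
    using that
  proof (induction rem arbitrary: I)
    case Tip
    have "L 0 m [Tip, I, Y]" using Tip unfolding L_def go_dom_def by auto
    then obtain t where t: "t \<le> hl m" "eval prog [Tip, I, Y] ?leaf (t_go Tip I Y) t"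
      using hl(2) by fastforce
    have "eval prog [Tip, I, Y] (Var 0) Tip 1" using eval_Var[of 0 "[Tip, I, Y]" prog] by simp
    from eval_Cond_False[OF this t(2)] have "eval prog [Tip, I, Y] (prog ! 21) (t_go Tip I Y) (1 + t + 1)"
      unfolding P(1) .
    then show ?case using t(1) by (intro exI[of _ "1 + t + 1"]) simp
  next
    case (Pair a b)
    let ?env = "[Pair a b, I, Y]"
    obtain t1 where t1: "t1 + c m \<le> 2 ^ len b * (hl m + 2 + c m)"
      "eval prog [b, Pair a I, Y] (prog ! 21) (t_go b (Pair a I) Y) t1"
      using Pair.IH(2)[of "Pair a I"] Pair.prems by auto
    obtain t2 where t2: "t2 + c m \<le> 2 ^ len b * (hl m + 2 + c m)"
      "eval prog [b, I, Y] (prog ! 21) (t_go b I Y) t2"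
      using Pair.IH(2)[of I] Pair.prems by auto
    have v0: "eval prog ?env (Var 0) (Pair a b) 1" using eval_Var[of 0 ?env prog] by simp
    have v1: "eval prog ?env (Var 1) I 1" using eval_Var[of 1 ?env prog] by simp
    have v2: "eval prog ?env (Var 2) Y 1" using eval_Var[of 2 ?env prog] by simp
    have r: "eval prog ?env (RightE (Var 0)) b 2" using eval_Right[OF v0] by (simp add: numeral_2_eq_2)
    have l: "eval prog ?env elemE a 2" using eval_Left[OF v0] by (simp add: numeral_2_eq_2)
    have p: "eval prog ?env (PairE elemE (Var 1)) (Pair a I) 4" using eval_Pair[OF l v1] by (simp add: eval_nat_numeral)
    note c1 = eval_Call[OF P(2) evals_Cons[OF r evals_Cons[OF p evals_Cons[OF v2 evals_Nil]]] t1(2)]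
    note c2 = eval_Call[OF P(2) evals_Cons[OF r evals_Cons[OF v1 evals_Cons[OF v2 evals_Nil]]] t2(2)]
    have "sized 2 0 (table_bound (m * m)) [t_go b (Pair a I) Y, t_go b I Y]"
      unfolding sized_def using size_go[OF Pair.prems(2-4)] by simp
    then obtain u where u: "u \<le> hu (table_bound (m * m))"
      "eval prog [t_go b (Pair a I) Y, t_go b I Y] (prog ! 12) (t_go (Pair a b) I Y) u"
      using hu(3)[of 0 "table_bound (m * m)" "[t_go b (Pair a I) Y, t_go b I Y]"] by (auto simp: sem_def)
    from eval_Cond_True[OF v0 _ eval_Call[OF P(3) evals_Cons[OF c1 evals_Cons[OF c2 evals_Nil]] u(2)]]
    have "eval prog ?env (prog ! 21) (t_go (Pair a b) I Y) (t1 + t2 + u + 16)"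
      unfolding P(1) by (simp add: algebra_simps)
    moreover have "t1 + t2 + u + 16 + c m \<le> 2 ^ len (Pair a b) * (hl m + 2 + c m)"
      using t1(1) t2(1) u(1) unfolding c_def by simp
    ultimately show ?case by blast
  qed
  show ?thesis
  proof (rule ptimeI[of "\<lambda>m. hl m + 2 + c m"])
    show "poly_bdd (\<lambda>m. hl m + 2 + c m)"
      unfolding c_def by (intro poly_bdd_intros hl(1) poly_bdd_comp[OF hu(1)] poly_table_bound)
    fix w m env assume "go_dom w m env"
    then obtain rem I Y A where *: "env = [rem, I, Y]" "len rem \<le> w" "size rem + size I \<le> m" "size Y \<le> m"
      "distinct (list_of Y)" "tables_le m A Y"
      unfolding go_dom_def by blast
    obtain t where t: "t + c m \<le> 2 ^ len rem * (hl m + 2 + c m)" "eval prog [rem, I, Y] (prog ! 21) (t_go rem I Y) t"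
      using main[OF *(3-6)] by blast
    have "(2::nat) ^ len rem * (hl m + 2 + c m) \<le> 2 ^ w * (hl m + 2 + c m)"
      using *(2) by (intro mult_right_mono power_increasing) auto
    then have "t \<le> 2 ^ w * (hl m + 2 + c m)" using t(1) by linarith
    then show "\<exists>t\<le>2 ^ w * (hl m + 2 + c m). eval prog env (prog ! 21) (t_go (env ! 0) (env ! 1) (env ! 2)) t"
      using t(2) *(1) by (auto simp: numeral_2_eq_2)
  qed
qed

definition merge_dom :: "nat \<Rightarrow> nat \<Rightarrow> tree list \<Rightarrow> bool" where
  "merge_dom w m env \<longleftrightarrow> (\<exists>Y X A. env = [Y, X] \<and> len Y \<le> w \<and> size Y \<le> m \<and> size X \<le> m \<and>
     distinct (list_of Y) \<and> tables_le m A Y)"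

lemma ptime_merge: "ptime prog merge_dom (prog ! 22) (\<lambda>env. t_merge (env ! 0) (env ! 1))"
proof -
  have len: "length env = 2" if "merge_dom w m env" for w m env using that by (auto simp: merge_dom_def)
  have sz: "psize merge_dom (\<lambda>env. env ! i)" if i: "i < 2" for i
  proof (rule psizeI[OF poly_bdd_id])
    fix w m env assume "merge_dom w m env"
    moreover have "i = 0 \<or> i = 1" using i by linarith
    ultimately show "size (env ! i) \<le> m" by (auto simp: merge_dom_def)
  qed
  have v: "ptime prog merge_dom (Var i) (\<lambda>env. env ! i)" if "i < 2" for i
    by (rule ptime_Var) (use len that in simp)
  have go: "ptime prog merge_dom (Call 21 [Var 0, TipE, Var 0]) (\<lambda>env. (\<lambda>env. t_go (env ! 0) (env ! 1) (env ! 2))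
      (map (\<lambda>g. g env) [\<lambda>env. env ! 0, \<lambda>_. Tip, \<lambda>env. env ! 0]))"
  proof (rule ptime_Call[OF _ _ ptime_go])
    show "list_all2 (ptime prog merge_dom) [Var 0, TipE, Var 0] [\<lambda>env. env ! 0, \<lambda>_. Tip, \<lambda>env. env ! 0]"
      using v[of 0] ptime_Tip by simp
    show "21 < length prog" by (simp add: length_prog)
    fix w m env assume "merge_dom w m env"
    then obtain Y X A where *: "env = [Y, X]" "len Y \<le> w" "size Y \<le> m" "distinct (list_of Y)" "tables_le m A Y"
      unfolding merge_dom_def by blast
    then have "go_dom w m [Y, Tip, Y]"
      unfolding go_dom_def by (intro exI[of _ Y] exI[of _ Tip] exI[of _ A]) simp
    then show "\<exists>w'\<le>w. \<exists>m'\<le>m. go_dom w' m' (map (\<lambda>g. g env) [\<lambda>env. env ! 0, \<lambda>_. Tip, \<lambda>env. env ! 0])"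
      using *(1) by auto
  qed (rule poly_bdd_id)
  have minus: "ptime prog merge_dom (Call 16 [Var 1, TipE, Var 0])
      (\<lambda>env. den sem env (Call 16 [Var 1, TipE, Var 0]))"
    by (rule conjunct1[OF ptime_den[where \<Gamma> = "known 19", OF known19 len sz]]) (auto simp: known_def arity_def)
  have "prog ! 22 = PairE (PairE (LeftE elemE) (PairE (LeftE (RightE elemE)) (Call 21 [Var 0, TipE, Var 0])))
      (Call 16 [Var 1, TipE, Var 0])"
    by (simp add: prog_def)
  moreover note ptime_Pair[OF ptime_Pair[OF ptime_Left[OF ptime_Left[OF v[of 0]]]
    ptime_Pair[OF ptime_Left[OF ptime_Right[OF ptime_Left[OF v[of 0]]]] go]] minus]
  ultimately show ?thesis
    by (simp only:) (rule ptime_cong, simp, simp add: t_merge_def sem_def numeral_2_eq_2)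
qed

text \<open>\<open>m\<close> is exactly the number of vertices and \<open>w\<close> the
  modular-width. The size of \<open>X\<close> is derived from validity in \<open>size_valid\<close>,
  so it cannot compound from round to round.\<close>

definition contract_dom :: "nat \<Rightarrow> nat \<Rightarrow> tree list \<Rightarrow> bool" where
  "contract_dom w m env \<longleftrightarrow> (\<exists>G fuel X W. env = [fuel, X] \<and> len fuel \<le> m \<and> is_rb_graph G \<and> verts G = {..<m} \<and>
     valid m G X W \<and> w = modular_width G)"

lemma contract_domE:
  assumes "contract_dom w m env"
  obtains G fuel X W where "env = [fuel, X]" "len fuel \<le> m" "is_rb_graph G" "verts G = {..<m}"
    "valid m G X W" "w = modular_width G"
  using assms unfolding contract_dom_def by blast

lemma size_sum_list: "size t = (\<Sum>x\<leftarrow>list_of t. size x + 1)"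
  by (induction t) auto

lemma size_sum_list_le:
  assumes "\<And>x. x \<in> set (list_of t) \<Longrightarrow> size x \<le> b"
  shows "size t \<le> len t * (b + 1)"
proof -
  have "(\<Sum>x\<leftarrow>list_of t. size x + 1) \<le> (\<Sum>x\<leftarrow>list_of t. b + 1)"
    using assms by (intro sum_list_mono) simp
  then show ?thesis unfolding size_sum_list[of t, symmetric] by (simp add: sum_list_triv)
qed

lemma valid_tables_le:
  assumes "valid n G X W"
  shows "tables_le n (\<lambda>x. achievable G (W (vid x))) X"
  unfolding tables_le_def
proof
  fix x assume x: "x \<in> set (list_of X)"
  have "(\<Union>x\<in>set (list_of X). W (vid x)) = {..<n}" using assms unfolding valid_def by blast
  then have sub: "W (vid x) \<subseteq> {..<n}" using x by blast
  then have "achievable G (W (vid x)) \<subseteq> {..n} \<times> {..n}"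
    using card_mono[OF _ sub] finite_subset[OF sub] by (intro achievable_bounds) auto
  then show "table (achievable G (W (vid x))) (tab x) \<and> achievable G (W (vid x)) \<subseteq> {..n} \<times> {..n}"
    using valid_recordD(4)[OF valid_rec[OF assms x]] by blast
qed

lemma size_valid:
  assumes "valid n G X W"
  shows "size X \<le> n * (3 * n + table_bound n + 3)"
proof -
  have "size x \<le> 3 * n + table_bound n + 2" if x: "x \<in> set (list_of X)" for x
  proof -
    note r = valid_recordD[OF valid_rec[OF assms x]]
    have "size (row x) \<le> len (row x) * (1 + 1)"
      by (rule size_sum_list_le) (use r(3) size_enc_bool in auto)
    then have "size (row x) \<le> 2 * n" using r(3) by simp
    moreover have "size (tab x) \<le> table_bound n"
      using size_table[of "achievable G (W (vid x))" "tab x" n] valid_tables_le[OF assms] x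
      by (auto simp: tables_le_def)
    moreover have "size x \<le> size (idx x) + (size (row x) + size (tab x)) + 2"
      by (cases x; cases "right x") auto
    ultimately show ?thesis using r(2) by linarith
  qed
  then have "size X \<le> len X * (3 * n + table_bound n + 2 + 1)" by (rule size_sum_list_le)
  moreover have "len X \<le> n"
  proof -
    have "vid ` set (list_of X) \<subseteq> {..<n}" using valid_recordD(1)[OF valid_rec[OF assms]] by auto
    then have "card (vid ` set (list_of X)) \<le> n" using card_mono[of "{..<n}"] by fastforce
    then show ?thesis using card_image[OF valid_inj[OF assms]] distinct_card[OF valid_distinct[OF assms]] by simp
  qed
  then have "len X * (3 * n + table_bound n + 2 + 1) \<le> n * (3 * n + table_bound n + 2 + 1)"
    by (rule mult_le_mono1)
  ultimately have "size X \<le> n * (3 * n + table_bound n + 2 + 1)" by (rule le_trans)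
  moreover have "3 * n + table_bound n + 2 + 1 = 3 * n + table_bound n + 3" by simp
  ultimately show ?thesis by (simp only:)
qed

lemma tables_le_mono: "tables_le m A X \<Longrightarrow> set (list_of Y) \<subseteq> set (list_of X) \<Longrightarrow> m \<le> m' \<Longrightarrow> tables_le m' A Y"
  unfolding tables_le_def using square_mono by (meson subsetD)

lemma ptime_contract: "ptime prog contract_dom (prog ! 23) (\<lambda>env. t_contract (env ! 0) (env ! 1))"
proof -
  let ?merge = "Call 22 [Call 10 [Var 1, Var 1, Var 1], Var 1]"
  let ?outer = "Call 10 [Var 1, Var 1, Var 1]"
  let ?e = "Cond (RightE (Var 1)) ?merge (Var 1)"
  let ?g = "\<lambda>env. t_step (env ! 1)"
  \<comment> \<open>The domain of the merging branch: with two current vertices,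
    \<open>valid_outer\<close> supplies a module of at most \<open>w\<close> elements, as
    \<open>merge_dom\<close> demands.\<close>
  define C where "C w m env \<longleftrightarrow> contract_dom w m env \<and> right (env ! 1) \<noteq> Tip" for w m env
  have len: "length env = 2" if "contract_dom w m env" for w m env
    by (rule contract_domE[OF that]) simp
  have v1: "ptime prog contract_dom (Var 1) (\<lambda>env. env ! 1)" by (rule ptime_Var) (use len in simp)
  have sz1: "psize contract_dom (\<lambda>env. env ! 1)"
  proof (rule psizeI[of "\<lambda>n. n * (3 * n + table_bound n + 3)"])
    show "poly_bdd (\<lambda>n. n * (3 * n + table_bound n + 3))" by (intro poly_bdd_intros poly_table_bound)
    fix w m env assume "contract_dom w m env"
    then show "size (env ! 1) \<le> m * (3 * m + table_bound m + 3)"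
    proof (rule contract_domE)
      fix G fuel X W assume "env = [fuel, X]" "valid m G X W"
      then show ?thesis using size_valid[of m G X W] by simp
    qed
  qed
  have v1C: "ptime prog C (Var 1) (\<lambda>env. env ! 1)" by (rule ptime_subset[OF v1]) (simp add: C_def)
  have sz1C: "psize C (\<lambda>env. env ! 1)" by (rule psize_subset[OF sz1]) (simp add: C_def)
  have p10: "poly_fun prog 10 (length [\<lambda>env::tree list. env ! 1, \<lambda>env. env ! 1, \<lambda>env. env ! 1]) (sem 10)"
    by (rule poly_fun_prog) (simp_all add: arity_def)
  have sem10: "sem 10 (map (\<lambda>g. g env) [\<lambda>env. env ! 1, \<lambda>env. env ! 1, \<lambda>env. env ! 1]) =
      t_outer (env ! 1) (env ! 1) (env ! 1)" for env
    by (simp add: sem_def numeral_2_eq_2)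
  have outer: "ptime prog C ?outer (\<lambda>env. t_outer (env ! 1) (env ! 1) (env ! 1))"
    by (rule ptime_cong[OF ptime_Call_poly[OF p10] sem10]) (use v1C sz1C in auto)
  have sz_outer: "psize C (\<lambda>env. t_outer (env ! 1) (env ! 1) (env ! 1))"
    by (rule psize_cong[OF psize_Call_poly[OF p10] sem10]) (use sz1C in auto)
  obtain h1 where h1: "poly_bdd h1" "\<And>w m env. C w m env \<Longrightarrow> size (env ! 1) \<le> h1 m"
    using that by (rule psizeE'[OF sz1C])
  obtain h2 where h2: "poly_bdd h2" "\<And>w m env. C w m env \<Longrightarrow> size (t_outer (env ! 1) (env ! 1) (env ! 1)) \<le> h2 m"
    using that by (rule psizeE'[OF sz_outer])
  let ?gs = "[\<lambda>env. t_outer (env ! 1) (env ! 1) (env ! 1), \<lambda>env. env ! 1]"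
  have merge: "ptime prog C ?merge (\<lambda>env. (\<lambda>env. t_merge (env ! 0) (env ! 1)) (map (\<lambda>g. g env) ?gs))"
  proof (rule ptime_Call[OF _ _ ptime_merge])
    show "list_all2 (ptime prog C) [?outer, Var 1] ?gs" using outer v1C by simp
    show "22 < length prog" by (simp add: length_prog)
    show "poly_bdd (\<lambda>m. m + h1 m + h2 m)" by (intro poly_bdd_intros h1(1) h2(1))
    fix w m env assume CC: "C w m env"
    then have "contract_dom w m env" by (simp add: C_def)
    then obtain G fuel X W where *: "env = [fuel, X]" "is_rb_graph G" "verts G = {..<m}" "valid m G X W"
      "w = modular_width G" by (rule contract_domE)
    have X2: "right X \<noteq> Tip" using CC *(1) by (simp add: C_def)
    note o = valid_outer[OF *(2-4) X2]
    have "set (list_of (t_outer X X X)) \<subseteq> set (list_of X)" using o(2) unfolding is_module_def by blast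
    from tables_le_mono[OF valid_tables_le[OF *(4)] this, of "m + h1 m + h2 m"]
    have "tables_le (m + h1 m + h2 m) (\<lambda>x. achievable G (W (vid x))) (t_outer X X X)" by simp
    then have "merge_dom w (m + h1 m + h2 m) [t_outer X X X, X]"
      unfolding merge_dom_def using o h1(2)[OF CC] h2(2)[OF CC] *(1,5) by auto
    then show "\<exists>w'\<le>w. \<exists>m'\<le>m + h1 m + h2 m. merge_dom w' m' (map (\<lambda>g. g env) ?gs)"
      using *(1) by auto
  qed
  have step: "ptime prog contract_dom ?e (\<lambda>env. if right (env ! 1) \<noteq> Tip
      then (\<lambda>env. t_merge (env ! 0) (env ! 1)) (map (\<lambda>g. g env) ?gs) else env ! 1)"
    by (rule ptime_Cond[OF ptime_Right[OF v1]])
      (rule ptime_subset[OF merge], simp add: C_def, rule ptime_subset[OF v1], blast)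
  have step': "ptime prog contract_dom ?e ?g"
    by (rule ptime_cong[OF step]) (simp add: t_step_def)
  have "ptime prog contract_dom (prog ! 23) (\<lambda>env. tloop ?g (env ! 0) (env ! 1) (drop 2 env))"
  proof (rule ptime_loop[of 23 prog 0 ?e])
    show "23 < length prog" by (simp add: length_prog)
    show "prog ! 23 = loopE 23 0 ?e" by (simp add: prog_def)
    show "\<exists>xs acc cs. env = xs # acc # cs \<and> length cs = 0 \<and> len xs \<le> m" if "contract_dom w m env" for w m env
      by (rule contract_domE[OF that]) simp
    show "contract_dom w m (b # ?g (Pair a b # acc # cs) # cs)" if D: "contract_dom w m (Pair a b # acc # cs)"
      for w m a b acc cs
    proof -
      obtain G W where *: "cs = []" "len (Pair a b) \<le> m" "is_rb_graph G" "verts G = {..<m}" "valid m G acc W"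
        "w = modular_width G"
        using D by (elim contract_domE) simp
      obtain W' where "valid m G (t_step acc) W'" using valid_step(1)[OF *(3-5)] by blast
      then have "contract_dom w m [b, t_step acc]"
        unfolding contract_dom_def using * by (intro exI[of _ G] exI[of _ b] exI[of _ "t_step acc"] exI[of _ W']) simp
      then show ?thesis using *(1) by simp
    qed
    show "ptime prog (\<lambda>w m env. contract_dom w m env \<and> hd env \<noteq> Tip) ?e ?g"
      by (rule ptime_subset[OF step']) blast
  qed
  then show ?thesis
  proof (rule ptime_cong)
    fix w m env assume "contract_dom w m env"
    then obtain fuel X where env: "env = [fuel, X]" by (rule contract_domE)
    show "tloop ?g (env ! 0) (env ! 1) (drop 2 env) = t_contract (env ! 0) (env ! 1)"
      unfolding env t_contract_eq by (simp, rule tloop_fold) simp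
  qed
qed

text \<open>A unary number need not consist of \<open>Tip\<close> cells: \<open>t_cap\<close> may
  return \<open>g\<close>, whose elements can be large. Addition only puts \<open>Tip\<close> cells
  in front of one summand, so sizes exceed lengths by at most one \<open>size g\<close>.\<close>

definition cap_ok :: "tree \<Rightarrow> tree \<Rightarrow> bool" where
  "cap_ok g v \<longleftrightarrow> len v \<le> len g \<and> size v \<le> len v + size g"

lemma cap_ok_cap: "size v \<le> len v + size g \<Longrightarrow> cap_ok g (t_cap v g)"
  by (auto simp: cap_ok_def t_cap_def t_le_iff)

lemma cap_ok_add: "cap_ok g s \<Longrightarrow> cap_ok g (t_cap (t_add r s) g)"
  by (rule cap_ok_cap) (simp add: size_t_add cap_ok_def)

lemma cap_ok_size: "cap_ok g v \<Longrightarrow> size v \<le> 2 * size g"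
  using len_le_size[of g] by (simp add: cap_ok_def)

text \<open>The remaining digits \<open>left acc\<close> are unrestricted, as \<open>k\<close> and
  \<gamma> may have any length; the fuel limits how many are processed.\<close>

definition caploop_dom :: "nat \<Rightarrow> nat \<Rightarrow> tree list \<Rightarrow> bool" where
  "caploop_dom w m env \<longleftrightarrow> (\<exists>fuel acc g. env = [fuel, acc, g] \<and> len fuel \<le> m \<and> size g \<le> m \<and>
     cap_ok g (left (right acc)) \<and> cap_ok g (right (right acc)))"

lemma cap_ok_capstep:
  assumes "cap_ok g (left (right a))" "cap_ok g (right (right a))"
  shows "cap_ok g (left (right (t_capstep g a)))" "cap_ok g (right (right (t_capstep g a)))"
  using assms cap_ok_add cap_ok_cap[of "left (right a)" g]
  by (auto simp: t_capstep_def cap_ok_def[of g "left (right a)"])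

lemma ptime_caploop: "ptime prog caploop_dom (prog ! 24) (\<lambda>env. t_caploop (env ! 0) (env ! 1) (env ! 2))"
proof -
  let ?v = "LeftE (RightE (Var 1))" and ?p = "RightE (RightE (Var 1))"
  let ?fv = "\<lambda>env::tree list. left (right (env ! 1))" and ?fp = "\<lambda>env::tree list. right (right (env ! 1))"
  let ?fg = "\<lambda>env::tree list. env ! 2"
  let ?sum = "Cond (LeftE (LeftE (Var 1))) (Call 2 [?p, ?v]) ?v"
  let ?e = "Cond (LeftE (Var 1)) (PairE (RightE (LeftE (Var 1)))
      (PairE (Call 17 [?sum, Var 2]) (Call 17 [Call 2 [?p, ?p], Var 2]))) (Var 1)"
  let ?D = caploop_dom
  have len: "length env = 3" if "?D w m env" for w m env using that by (auto simp: caploop_dom_def)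
  have t: "ptime prog ?D e (\<lambda>env. den sem env e)" if "wf_expr (\<lambda>_. None) 3 e" for e
    by (rule ptime_den_nocall[OF that len])
  have ts: "ptime prog ?D ?v ?fv" "ptime prog ?D ?p ?fp" "ptime prog ?D (Var 2) ?fg"
    using t[of ?v] t[of ?p] t[of "Var 2"] by simp_all
  have pz: "poly_bdd (\<lambda>m. 2 * m)" by (intro poly_bdd_intros)
  have zs: "psize ?D ?fv" "psize ?D ?fp" "psize ?D ?fg"
    using cap_ok_size by (auto intro!: psizeI[OF pz] simp: caploop_dom_def) (meson le_trans mult_le_mono2)+
  have p2: "poly_fun prog 2 2 (sem 2)" and p17: "poly_fun prog 17 2 (sem 17)"
    by (rule poly_fun_prog; simp add: arity_def)+
  have add: "ptime prog ?D (Call 2 [a, b]) (\<lambda>env. t_add (f env) (g env))" "psize ?D (\<lambda>env. t_add (f env) (g env))"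
    if "ptime prog ?D a f" "ptime prog ?D b g" "psize ?D f" "psize ?D g" for a b f g
    using ptime_Call_poly[of prog 2 "[f, g]" "sem 2" ?D "[a, b]"] psize_Call_poly[of prog 2 "[f, g]" "sem 2" ?D]
      p2 that by (auto simp: sem_def numeral_2_eq_2)
  have cap: "ptime prog ?D (Call 17 [a, b]) (\<lambda>env. t_cap (f env) (g env))"
    if "ptime prog ?D a f" "ptime prog ?D b g" "psize ?D f" "psize ?D g" for a b f g
    using ptime_Call_poly[of prog 17 "[f, g]" "sem 17" ?D "[a, b]"] p17 that
    by (auto simp: sem_def numeral_2_eq_2)
  note c = add(1)[OF ts(2,1) zs(2,1)]
  have "ptime prog ?D ?sum (\<lambda>env. if den sem env (LeftE (LeftE (Var 1))) \<noteq> Tip then t_add (?fp env) (?fv env) else ?fv env)"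
    by (rule ptime_Cond[OF t]) (simp, rule ptime_subset[OF c], blast, rule ptime_subset[OF ts(1)], blast)
  note s1 = cap[OF this ts(3) psize_if[OF add(2)[OF ts(2,1) zs(2,1)] zs(1)] zs(3)]
  note s2 = cap[OF add(1)[OF ts(2,2) zs(2,2)] ts(3) add(2)[OF ts(2,2) zs(2,2)] zs(3)]
  have r: "ptime prog ?D (RightE (LeftE (Var 1))) (\<lambda>env. den sem env (RightE (LeftE (Var 1))))" by (rule t) simp
  note body = ptime_Pair[OF r ptime_Pair[OF s1 s2]]
  let ?B = "\<lambda>env. Pair (den sem env (RightE (LeftE (Var 1)))) (Pair
    (t_cap (if den sem env (LeftE (LeftE (Var 1))) \<noteq> Tip then t_add (?fp env) (?fv env) else ?fv env) (?fg env))
    (t_cap (t_add (?fp env) (?fp env)) (?fg env)))"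
  have "ptime prog ?D ?e (\<lambda>env. if den sem env (LeftE (Var 1)) \<noteq> Tip then ?B env else den sem env (Var 1))"
    by (rule ptime_Cond[OF t]) (simp, rule ptime_subset[OF body], blast, rule ptime_subset[OF t], simp, blast)
  then have step: "ptime prog ?D ?e (\<lambda>env. t_capstep (env ! 2) (env ! 1))"
    by (rule ptime_cong) (simp add: t_capstep_def)
  have "ptime prog ?D (prog ! 24) (\<lambda>env. tloop (\<lambda>env. t_capstep (env ! 2) (env ! 1)) (env ! 0) (env ! 1) (drop 2 env))"
  proof (rule ptime_loop[of 24 prog 1 ?e])
    show "24 < length prog" by (simp add: length_prog)
    show "prog ! 24 = loopE 24 1 ?e" by (simp add: prog_def)
    show "\<exists>xs acc cs. env = xs # acc # cs \<and> length cs = 1 \<and> len xs \<le> m" if "?D w m env" for w m env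
      using that by (auto simp: caploop_dom_def)
    show "?D w m (b # t_capstep ((Pair a b # acc # cs) ! 2) ((Pair a b # acc # cs) ! 1) # cs)"
      if "?D w m (Pair a b # acc # cs)" for w m a b acc cs
      using that cap_ok_capstep unfolding caploop_dom_def by auto
    show "ptime prog (\<lambda>w m env. ?D w m env \<and> hd env \<noteq> Tip) ?e (\<lambda>env. t_capstep (env ! 2) (env ! 1))"
      by (rule ptime_subset[OF step]) blast
  qed
  then show ?thesis
  proof (rule ptime_cong)
    fix w m env assume "?D w m env"
    then obtain fuel a g where env: "env = [fuel, a, g]" by (auto simp: caploop_dom_def)
    show "tloop (\<lambda>env. t_capstep (env ! 2) (env ! 1)) (env ! 0) (env ! 1) (drop 2 env) =
      t_caploop (env ! 0) (env ! 1) (env ! 2)"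
      unfolding env t_caploop_eq by (simp, rule tloop_fold) simp
  qed
qed

text \<open>\<open>1 \<le> len g\<close> lets the initial weight 1 respect the cap.\<close>

definition capped_dom :: "nat \<Rightarrow> nat \<Rightarrow> tree list \<Rightarrow> bool" where
  "capped_dom w m env \<longleftrightarrow> (\<exists>g z. env = [g, z] \<and> 1 \<le> len g \<and> size g \<le> m)"

lemma cap_ok_init: "1 \<le> len g \<Longrightarrow> cap_ok g Tip \<and> cap_ok g (Pair Tip Tip)"
  using len_le_size[of g] by (simp add: cap_ok_def)

lemma ptime_capped: "ptime prog capped_dom (prog ! 25) (\<lambda>env. t_capped (env ! 0) (env ! 1))"
proof -
  let ?D = capped_dom
  have len: "length env = 2" if "?D w m env" for w m env using that by (auto simp: capped_dom_def)
  have t: "ptime prog ?D e (\<lambda>env. den sem env e)" if "wf_expr (\<lambda>_. None) 2 e" for e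
    by (rule ptime_den_nocall[OF that len])
  let ?arg = "PairE (Var 1) (PairE TipE oneE)"
  let ?farg = "\<lambda>env::tree list. Pair (env ! 1) (Pair Tip (Pair Tip Tip))"
  have ts: "ptime prog ?D (Var 0) (\<lambda>env. env ! 0)" "ptime prog ?D ?arg ?farg"
    using t[of "Var 0"] t[of ?arg] by (simp_all add: oneE_def)
  let ?gs = "[\<lambda>env. env ! 0, ?farg, \<lambda>env. env ! 0]"
  have loop: "ptime prog ?D (Call 24 [Var 0, ?arg, Var 0])
      (\<lambda>env. (\<lambda>env. t_caploop (env ! 0) (env ! 1) (env ! 2)) (map (\<lambda>g. g env) ?gs))"
  proof (rule ptime_Call[OF _ _ ptime_caploop])
    show "list_all2 (ptime prog ?D) [Var 0, ?arg, Var 0] ?gs" using ts by simp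
    show "24 < length prog" by (simp add: length_prog)
    fix w m env assume "?D w m env"
    then obtain g z where *: "env = [g, z]" "1 \<le> len g" "size g \<le> m" by (auto simp: capped_dom_def)
    then have "caploop_dom w m (map (\<lambda>g. g env) ?gs)"
      unfolding caploop_dom_def using cap_ok_init[OF *(2)] len_le_size[of g] by auto
    then show "\<exists>w'\<le>w. \<exists>m'\<le>m. caploop_dom w' m' (map (\<lambda>g. g env) ?gs)" by blast
  qed (rule poly_bdd_id)
  define D2 where "D2 w m env \<longleftrightarrow> length env = 2" for w m :: nat and env :: "tree list"
  have p26: "ptime prog D2 (prog ! 26) (\<lambda>env. den sem env (prog ! 26))"
    by (rule ptime_den_nocall[of 2]) (auto simp: prog_def D2_def)
  let ?hs = "[\<lambda>env. (\<lambda>env. t_caploop (env ! 0) (env ! 1) (env ! 2)) (map (\<lambda>g. g env) ?gs), \<lambda>env. env ! 0]"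
  have "ptime prog ?D (Call 26 [Call 24 [Var 0, ?arg, Var 0], Var 0])
      (\<lambda>env. (\<lambda>env. den sem env (prog ! 26)) (map (\<lambda>g. g env) ?hs))"
    by (rule ptime_Call[OF _ _ p26 poly_bdd_id]) (use loop ts(1) in \<open>auto simp: D2_def length_prog\<close>)
  moreover have "prog ! 25 = Call 26 [Call 24 [Var 0, ?arg, Var 0], Var 0]" by (simp add: prog_def)
  ultimately show ?thesis
    by (simp only:) (rule ptime_cong, simp, simp add: t_capped_def prog_def numeral_2_eq_2 Let_def)
qed

lemma psize_capped: "psize capped_dom (\<lambda>env. t_capped (env ! 0) (env ! 1))"
proof (rule psizeI[of "\<lambda>m. 2 * m"])
  show "poly_bdd (\<lambda>m. 2 * m)" by (intro poly_bdd_intros)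
  fix w m env assume "capped_dom w m env"
  then obtain g z where *: "env = [g, z]" "1 \<le> len g" "size g \<le> m" by (auto simp: capped_dom_def)
  have inv: "cap_ok g (left (right (fold (\<lambda>_. t_capstep g) fs a)))"
    if "cap_ok g (left (right a))" "cap_ok g (right (right a))" for fs :: "tree list" and a
    using that
  proof (induction fs arbitrary: a)
    case (Cons f fs)
    show ?case using Cons.IH[OF cap_ok_capstep[OF Cons.prems]] by simp
  qed simp
  have "cap_ok g (left (right (t_caploop g (Pair z (Pair Tip (Pair Tip Tip))) g)))"
    unfolding t_caploop_eq by (rule inv) (use cap_ok_init[OF *(2)] in auto)
  from cap_ok_size[OF this] show "size (t_capped (env ! 0) (env ! 1)) \<le> 2 * m"
    using * by (auto simp: t_capped_def Let_def)
qed

text \<open>The parameter is the number of vertices and not the input size, which also depends on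
  the digits of \<open>k\<close> and \<gamma>.\<close>

definition main_dom :: "nat \<Rightarrow> nat \<Rightarrow> tree list \<Rightarrow> bool" where
  "main_dom w m env \<longleftrightarrow> (\<exists>G k \<gamma>. env = [enc_instance m G k \<gamma>] \<and> 1 \<le> m \<and> is_rb_graph G \<and> verts G = {..<m} \<and>
     w = modular_width G)"

lemma main_domE:
  assumes "main_dom w m env"
  obtains G k \<gamma> where "env = [enc_instance m G k \<gamma>]" "1 \<le> m" "is_rb_graph G" "verts G = {..<m}"
    "w = modular_width G"
  using assms unfolding main_dom_def by blast

lemma size_enc_graph: "size (enc_graph n G) \<le> n * (2 * n + 5)"
proof -
  have row: "size (enc_list (map (\<lambda>v. enc_bool ({u, v} \<in> edges G)) [0..<n])) \<le> n * (1 + 1)" for u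
    using size_sum_list_le[of "enc_list (map (\<lambda>v. enc_bool ({u, v} \<in> edges G)) [0..<n])" 1] size_enc_bool by auto
  have "size x \<le> 2 * n + 4" if x: "x \<in> set (list_of (enc_graph n G))" for x
  proof -
    obtain u where "x = Pair (Pair (enc_bool (u \<in> red G)) (enc_bool (u \<in> blue G)))
      (enc_list (map (\<lambda>v. enc_bool ({u, v} \<in> edges G)) [0..<n]))"
      using x unfolding enc_graph_def by auto
    then show ?thesis
      using row[of u] size_enc_bool[of "u \<in> red G"] size_enc_bool[of "u \<in> blue G"] by simp
  qed
  then have "size (enc_graph n G) \<le> len (enc_graph n G) * (2 * n + 4 + 1)" by (rule size_sum_list_le)
  then show ?thesis unfolding len_enc_graph by (simp add: algebra_simps)
qed

lemma ptime_main: "ptime prog main_dom (prog ! 0) (\<lambda>env. t_main (env ! 0))"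
proof -
  let ?D = main_dom
  have len: "length env = 1" if "?D w m env" for w m env by (rule main_domE[OF that]) simp
  have t: "ptime prog ?D e (\<lambda>env. den sem env e)" if "wf_expr (\<lambda>_. None) 1 e" for e
    by (rule ptime_den_nocall[OF that len])
  let ?G = "LeftE (Var 0)" and ?fG = "\<lambda>env::tree list. left (env ! 0)"
  let ?k = "RightE (LeftE (RightE (Var 0)))" and ?fk = "\<lambda>env::tree list. right (left (right (env ! 0)))"
  let ?c = "RightE (RightE (RightE (Var 0)))" and ?fc = "\<lambda>env::tree list. right (right (right (env ! 0)))"
  have ts: "ptime prog ?D ?G ?fG" "ptime prog ?D ?k ?fk" "ptime prog ?D ?c ?fc"
    using t[of ?G] t[of ?k] t[of ?c] by simp_all
  have E: "left (enc_instance m G k \<gamma>) = enc_graph m G" for m G k \<gamma> by (simp add: enc_instance_def)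
  define h where "h m = m * (2 * m + 5)" for m :: nat
  have h: "poly_bdd h" unfolding h_def by (intro poly_bdd_intros)
  let ?init = "Call 19 [?G, TipE]"
  let ?gi = "[?fG, \<lambda>_. Tip]"
  have init: "ptime prog ?D ?init (\<lambda>env. (\<lambda>env. t_init (env ! 0) (env ! 1)) (map (\<lambda>g. g env) ?gi))"
  proof (rule ptime_Call[OF _ _ ptime_init poly_bdd_id])
    show "list_all2 (ptime prog ?D) [?G, TipE] ?gi" using ts ptime_Tip by simp
    show "19 < length prog" by (simp add: length_prog)
    show "\<exists>w'\<le>w. \<exists>m'\<le>m. init_dom w' m' (map (\<lambda>g. g env) ?gi)" if "?D w m env" for w m env
      by (rule main_domE[OF that], intro exI[of _ w] conjI exI[of _ m]) (simp_all add: init_dom_def E len_enc_graph)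
  qed
  let ?gc = "[?fG, \<lambda>env. right ((\<lambda>env. t_init (env ! 0) (env ! 1)) (map (\<lambda>g. g env) ?gi))]"
  let ?contract = "Call 23 [?G, RightE ?init]"
  let ?fcontract = "\<lambda>env. (\<lambda>env. t_contract (env ! 0) (env ! 1)) (map (\<lambda>g. g env) ?gc)"
  have contract: "ptime prog ?D ?contract ?fcontract"
  proof (rule ptime_Call[OF _ _ ptime_contract poly_bdd_id])
    show "list_all2 (ptime prog ?D) [?G, RightE ?init] ?gc" using ts ptime_Right[OF init] by simp
    show "23 < length prog" by (simp add: length_prog)
    fix w m env assume "?D w m env"
    then obtain G k \<gamma> where *: "env = [enc_instance m G k \<gamma>]" "is_rb_graph G" "verts G = {..<m}" "w = modular_width G"
      by (rule main_domE)
    have "contract_dom w m (map (\<lambda>g. g env) ?gc)"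
      unfolding contract_dom_def using valid_init(1)[OF *(2,3)] *
      by (intro exI[of _ G] exI[of _ "enc_graph m G"] exI[of _ "right (t_init (enc_graph m G) Tip)"] exI[of _ "\<lambda>v. {v}"])
        (simp add: E len_enc_graph)
    then show "\<exists>w'\<le>w. \<exists>m'\<le>m. contract_dom w' m' (map (\<lambda>g. g env) ?gc)" by blast
  qed
  \<comment> \<open>The size of the final table is read off from its meaning, not from the loop that
    produced it.\<close>
  have szT: "psize ?D (\<lambda>env. tab (left (?fcontract env)))"
  proof (rule psizeI[of table_bound])
    show "poly_bdd table_bound" using poly_table_bound[OF poly_bdd_id] by simp
    fix w m env assume "?D w m env"
    then obtain G k \<gamma> where *: "env = [enc_instance m G k \<gamma>]" "is_rb_graph G" "verts G = {..<m}" "1 \<le> m"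
      by (rule main_domE)
    have "table (achievable G {..<m}) (tab (left (t_contract (enc_graph m G) (right (t_init (enc_graph m G) Tip)))))"
      by (rule contract_table[OF *(2-4) valid_init(1)[OF *(2,3)]]) (simp add: valid_init(2)[OF *(2,3)] len_enc_graph)
    from size_table[OF this achievable_bounds] show "size (tab (left (?fcontract env))) \<le> table_bound m"
      using *(1) by (simp add: E)
  qed
  have capped: "ptime prog ?D (Call 25 [?G, e]) (\<lambda>env. t_capped (?fG env) (f env))"
    "psize ?D (\<lambda>env. t_capped (?fG env) (f env))" if e: "ptime prog ?D e f" for e f
  proof -
    have dom: "\<exists>w'\<le>w. \<exists>m'\<le>h m. capped_dom w' m' [?fG env, f env]" if "?D w m env" for w m env
      by (rule main_domE[OF that], intro exI[of _ w] conjI exI[of _ "h m"])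
        (simp_all add: capped_dom_def E len_enc_graph h_def size_enc_graph)
    have "ptime prog ?D (Call 25 [?G, e]) (\<lambda>env. (\<lambda>env. t_capped (env ! 0) (env ! 1)) (map (\<lambda>g. g env) [?fG, f]))"
      by (rule ptime_Call[OF _ _ ptime_capped h]) (use ts e dom in \<open>auto simp: length_prog\<close>)
    then show "ptime prog ?D (Call 25 [?G, e]) (\<lambda>env. t_capped (?fG env) (f env))" by simp
    have "psize ?D (\<lambda>env. (\<lambda>env. t_capped (env ! 0) (env ! 1)) [?fG env, f env])"
      by (rule psize_shift[OF psize_capped h]) (use dom in blast)
    then show "psize ?D (\<lambda>env. t_capped (?fG env) (f env))" by simp
  qed
  let ?gd = "[\<lambda>env. tab (left (?fcontract env)), \<lambda>_. Tip, \<lambda>env. t_capped (?fG env) (?fk env), \<lambda>env. t_capped (?fG env) (?fc env)]"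
  let ?decide = "Call 18 [RightE (RightE (LeftE ?contract)), TipE, Call 25 [?G, ?k], Call 25 [?G, ?c]]"
  have "ptime prog ?D ?decide (\<lambda>env. sem 18 (map (\<lambda>g. g env) ?gd))"
  proof (rule ptime_Call_poly)
    show "poly_fun prog 18 (length ?gd) (sem 18)" by (rule poly_fun_prog) (simp_all add: arity_def)
    show "list_all2 (ptime prog ?D) [RightE (RightE (LeftE ?contract)), TipE, Call 25 [?G, ?k], Call 25 [?G, ?c]] ?gd"
      using ptime_Right[OF ptime_Right[OF ptime_Left[OF contract]]] ptime_Tip capped(1)[OF ts(2)] capped(1)[OF ts(3)]
      by simp
    show "\<forall>g\<in>set ?gd. psize ?D g"
      using szT psize_Tip capped(2)[OF ts(2)] capped(2)[OF ts(3)] by simp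
  qed
  then have decide: "ptime prog ?D ?decide (\<lambda>env. t_decide (tab (left (t_contract (?fG env) (right (t_init (?fG env) Tip)))))
      Tip (t_capped (?fG env) (?fk env)) (t_capped (?fG env) (?fc env)))"
    by (rule ptime_cong) (simp add: sem_def numeral_2_eq_2 numeral_3_eq_3)
  have P0: "prog ! 0 = Cond (LeftE (LeftE (RightE (Var 0)))) TipE (Cond (LeftE (RightE (RightE (Var 0)))) TipE ?decide)"
    by (simp add: prog_def)
  have "ptime prog ?D (Cond (LeftE (RightE (RightE (Var 0)))) TipE ?decide)
      (\<lambda>env. if den sem env (LeftE (RightE (RightE (Var 0)))) \<noteq> Tip then Tip
        else t_decide (tab (left (t_contract (?fG env) (right (t_init (?fG env) Tip)))))
      Tip (t_capped (?fG env) (?fk env)) (t_capped (?fG env) (?fc env)))" (is "ptime _ _ ?e1 ?g1")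
    by (rule ptime_Cond[OF t]) (simp, rule ptime_Tip, rule ptime_subset[OF decide], blast)
  then have "ptime prog ?D (Cond (LeftE (LeftE (RightE (Var 0)))) TipE ?e1)
      (\<lambda>env. if den sem env (LeftE (LeftE (RightE (Var 0)))) \<noteq> Tip then Tip else ?g1 env)"
    by (intro ptime_Cond[OF t]) (simp, rule ptime_Tip, erule ptime_subset, blast)
  then show ?thesis
    unfolding P0 by (rule ptime_cong) (simp add: t_main_def)
qed

theorem theorem3:
  shows "\<exists>(P :: program) (C :: nat) (d :: nat).
    \<forall>(n :: nat) (G :: nat rb_graph) (k :: int) (\<gamma> :: int).
      1 \<le> n \<and> verts G = {..<n} \<and> rbr_instance G k \<gamma> \<longrightarrow>
      (\<exists>v t. runs P (enc_instance n G k \<gamma>) v t \<and>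
             (v \<noteq> Tip \<longleftrightarrow> rbr_yes G k \<gamma>) \<and>
             t \<le> C * 2 ^ modular_width G * n ^ d)"
proof -
  obtain h where h: "poly_bdd h" "\<And>w m env. main_dom w m env \<Longrightarrow>
      \<exists>t\<le>2 ^ w * h m. eval prog env (prog ! 0) (t_main (env ! 0)) t"
    using that by (rule ptimeE'[OF ptime_main])
  obtain C d where Cd: "\<And>m. h m \<le> C * Suc m ^ d" using h(1) unfolding poly_bdd_def by blast
  show ?thesis
  \<comment> \<open>\<open>poly_bdd\<close> bounds by powers of \<open>Suc n\<close>; the factor
    \<open>2 ^ d\<close> comes from \<open>Suc n \<le> 2 * n\<close> for
    \<open>n \<ge> 1\<close>.\<close>
  proof (rule exI[of _ prog], rule exI[of _ "C * 2 ^ d"], rule exI[of _ d], intro allI impI)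
    fix n :: nat and G :: "nat rb_graph" and k \<gamma> :: int
    assume "1 \<le> n \<and> verts G = {..<n} \<and> rbr_instance G k \<gamma>"
    then have *: "1 \<le> n" "verts G = {..<n}" "is_rb_graph G" by (auto simp: rbr_instance_def)
    let ?x = "enc_instance n G k \<gamma>"
    have "main_dom (modular_width G) n [?x]" unfolding main_dom_def using * by auto
    then obtain t where t: "t \<le> 2 ^ modular_width G * h n" "eval prog [?x] (prog ! 0) (t_main ?x) t"
      using h(2)[of "modular_width G" n "[?x]"] by auto
    have "Suc n ^ d \<le> (2 * n) ^ d" using *(1) by (intro power_mono) auto
    then have "h n \<le> C * (2 * n) ^ d" using Cd[of n] by (meson le_trans mult_le_mono2)
    then have "2 ^ modular_width G * h n \<le> 2 ^ modular_width G * (C * (2 * n) ^ d)" by (rule mult_le_mono2)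
    from le_trans[OF t(1) this] have "t \<le> 2 ^ modular_width G * (C * (2 * n) ^ d)" .
    then have "t \<le> C * 2 ^ d * 2 ^ modular_width G * n ^ d"
      by (simp add: power_mult_distrib ac_simps)
    moreover have "runs prog ?x (t_main ?x) t"
      unfolding runs_def using t(2) length_prog by auto
    ultimately show "\<exists>v t. runs prog ?x v t \<and> (v \<noteq> Tip \<longleftrightarrow> rbr_yes G k \<gamma>) \<and>
        t \<le> C * 2 ^ d * 2 ^ modular_width G * n ^ d"
      using t_main_correct[OF *(3,2,1), of k \<gamma>] by blast
  qed
qed

end
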